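(* For every $n\geq 1$, the Lusternik-Schnirelmann category of the homogeneous space $U(n)/O(n)$ satisfies $\mathrm{cat}\, \big(U(n)/O(n)\big)=n$.
   Context: For a topological space $X$, an open set $U\subset X$ is called categorical when it is contractible in $X$ (the inclusion $U\hookrightarrow X$ is homotopic to a constant map). The LS category $\mathrm{cat}\, X$ is the minimum number, minus one, of categorical open sets needed to cover $X$. $O(n)\subset U(n)$ is the subgroup of real orthogonal matrices. *)

theory Defs
  imports "HOL-Analysis.Analysis" "HOL-Library.Extended_Nat"
begin

definition categorical :: "'a topology \<Rightarrow> 'a set \<Rightarrow> bool" where
  "categorical X U \<longleftrightarrow> openin X U \<and>
     (\<exists>c\<in>topspace X. homotopic_with (\<lambda>h. True) (subtopology X U) X (\<lambda>x. x) (\<lambda>x. c))"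

(* The value is infinity if there is no finite categorical cover. Subtraction on enat truncates,
   which matters only for the empty space: it gets the value 0 instead of -1. *)
definition LS_cat :: "'a topology \<Rightarrow> enat" where
  "LS_cat X =
     (INF \<U> \<in> {\<U>. finite \<U> \<and> (\<forall>U\<in>\<U>. categorical X U) \<and> \<Union>\<U> = topspace X}. enat (card \<U>)) - 1"

definition quotient_topology :: "'a topology \<Rightarrow> ('a \<Rightarrow> 'b) \<Rightarrow> 'b topology" where
  "quotient_topology X f =
     topology (\<lambda>V. V \<subseteq> f ` topspace X \<and> openin X {x \<in> topspace X. f x \<in> V})"

lemma openin_quotient_topology:
  "openin (quotient_topology X f) V \<longleftrightarrow>
     V \<subseteq> f ` topspace X \<and> openin X {x \<in> topspace X. f x \<in> V}"
proof -
  have "istopology (\<lambda>V. V \<subseteq> f ` topspace X \<and> openin X {x \<in> topspace X. f x \<in> V})"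
    unfolding istopology_def
  proof (intro conjI allI impI)
    fix S T
    assume S: "S \<subseteq> f ` topspace X \<and> openin X {x \<in> topspace X. f x \<in> S}"
      and T: "T \<subseteq> f ` topspace X \<and> openin X {x \<in> topspace X. f x \<in> T}"
    show "S \<inter> T \<subseteq> f ` topspace X" using S by blast
    have "{x \<in> topspace X. f x \<in> S \<inter> T} =
        {x \<in> topspace X. f x \<in> S} \<inter> {x \<in> topspace X. f x \<in> T}" by blast
    then show "openin X {x \<in> topspace X. f x \<in> S \<inter> T}" using S T by (simp add: openin_Int)
  next
    fix K
    assume K: "\<forall>S\<in>K. S \<subseteq> f ` topspace X \<and> openin X {x \<in> topspace X. f x \<in> S}"
    show "\<Union>K \<subseteq> f ` topspace X" using K by blast
    have "{x \<in> topspace X. f x \<in> \<Union>K} = (\<Union>S\<in>K. {x \<in> topspace X. f x \<in> S})" by blast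
    then show "openin X {x \<in> topspace X. f x \<in> \<Union>K}" using K by auto
  qed
  then show ?thesis by (simp add: quotient_topology_def)
qed

lemma topspace_quotient_topology [simp]:
  "topspace (quotient_topology X f) = f ` topspace X"
proof
  show "topspace (quotient_topology X f) \<subseteq> f ` topspace X"
    using openin_quotient_topology openin_topspace by metis
  have "{x \<in> topspace X. f x \<in> f ` topspace X} = topspace X" by blast
  then have "openin (quotient_topology X f) (f ` topspace X)"
    by (simp add: openin_quotient_topology)
  then show "f ` topspace X \<subseteq> topspace (quotient_topology X f)"
    by (rule openin_subset)
qed

lemma quotient_map_quotient_topology: "quotient_map X (quotient_topology X f) f"
  by (simp add: quotient_map_def openin_quotient_topology)

definition conj_transpose :: "complex ^ 'n ^ 'm \<Rightarrow> complex ^ 'm ^ 'n" where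
  "conj_transpose A = map_matrix cnj (transpose A)"

definition unitary_matrices :: "(complex ^ 'n ^ 'n) set" where
  "unitary_matrices = {A. conj_transpose A ** A = mat 1 \<and> A ** conj_transpose A = mat 1}"

definition real_orthogonal_matrices :: "(complex ^ 'n ^ 'n) set" where
  "real_orthogonal_matrices = map_matrix complex_of_real ` {Q. orthogonal_matrix Q}"

lemma real_orthogonal_subset_unitary:
  "(real_orthogonal_matrices :: (complex ^ 'n ^ 'n) set) \<subseteq> unitary_matrices"
proof
  fix A :: "complex ^ 'n ^ 'n"
  assume "A \<in> real_orthogonal_matrices"
  then obtain Q :: "real ^ 'n ^ 'n" where Q: "orthogonal_matrix Q"
    and A: "A = map_matrix complex_of_real Q"
    unfolding real_orthogonal_matrices_def by blast
  have mult: "map_matrix complex_of_real R ** map_matrix complex_of_real S =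
      map_matrix complex_of_real (R ** S)" for R S :: "real ^ 'n ^ 'n"
    by (simp add: vec_eq_iff matrix_matrix_mult_def)
  have ct: "conj_transpose A = map_matrix complex_of_real (transpose Q)"
    by (simp add: A conj_transpose_def transpose_def vec_eq_iff)
  have one: "map_matrix complex_of_real (mat 1 :: real ^ 'n ^ 'n) = mat 1"
    by (simp add: vec_eq_iff mat_def)
  have "transpose Q ** Q = mat 1" "Q ** transpose Q = mat 1"
    using Q by (auto simp: orthogonal_matrix_def)
  then show "A \<in> unitary_matrices"
    unfolding unitary_matrices_def mem_Collect_eq ct unfolding A by (simp add: mult one)
qed

definition orthogonal_coset :: "complex ^ 'n ^ 'n \<Rightarrow> (complex ^ 'n ^ 'n) set" where
  "orthogonal_coset A = (\<lambda>Q. A ** Q) ` real_orthogonal_matrices"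

(* The points are the left cosets of O(n) in U(n), where n = CARD('n). *)
definition unitary_mod_orthogonal :: "(complex ^ 'n ^ 'n) set topology" where
  "unitary_mod_orthogonal = quotient_topology (top_of_set unitary_matrices) orthogonal_coset"

end

theory Submission
  imports Defs "HOL-Library.Z2" "HOL-Combinatorics.Permutations"
begin

text \<open>The map \<open>A \<mapsto> A A\<^sup>T\<close> identifies \<open>U(n)/O(n)\<close> with the space of symmetric unitary matrices.
Deleting the matrices having a fixed unit number as an eigenvalue leaves a set that the Cayley transform
contracts; a matrix has at most \<open>n\<close> eigenvalues, so \<open>n + 1\<close> such sets cover.

Suppose conversely that \<open>n\<close> categorical sets cover. Over each of them the tautological real bundle is trivial,
which gives maps \<open>G\<^sub>k\<close> from matrices to real matrices that commute with sign changes of columns and such that at every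
unitary \<open>A\<close> some \<open>G\<^sub>k A\<close> is invertible. Take unit vectors \<open>a\<^sub>j \<in> S\<^bsup>2n-1-j\<^esup>\<close> in complex \<open>n\<close>-space and \<open>v\<^sub>k \<in> S\<^bsup>k\<^esup>\<close>
(\<open>j, k < n\<close>). Then the real functions \<open>Re \<langle>a\<^sub>i, a\<^sub>j\<rangle>\<close>, \<open>Im \<langle>a\<^sub>i, a\<^sub>j\<rangle>\<close> and \<open>(v\<^sub>k G\<^sub>k(a))\<^sub>j\<close> are odd or even in every
variable and have no common zero. This contradicts the Borsuk-Ulam theorem for products of spheres, because
the coefficient of \<open>\<Prod>\<^sub>j x\<^sub>j\<^bsup>2n-1-j\<^esup> \<Prod>\<^sub>k y\<^sub>k\<^bsup>k\<^esup>\<close> in \<open>\<Prod>\<^sub>i\<^sub><\<^sub>j (x\<^sub>i + x\<^sub>j)\<^sup>2 \<Prod>\<^sub>j\<^sub>k (x\<^sub>j + y\<^sub>k)\<close> is odd. (In terms of characteristic classes: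
the product of the Stiefel-Whitney classes \<open>w\<^sub>1, \<dots>, w\<^sub>n\<close> is nonzero.)\<close>

section \<open>Chains modulo 2\<close>

text \<open>The spheres encode \<open>w_1 ... w_n \<noteq> 0\<close>, whose degree 1 + ... + n is
  the dimension of U(n)/O(n). A vector \<open>v_k\<close> in S^k with \<open>v_k G_k = 0\<close>
  witnesses that the first \<open>k + 1\<close> rows of \<open>G_k\<close> are dependent, a
  condition of codimension \<open>n - k\<close>: the coefficient of \<open>y_k^k\<close> in
  \<Prod>_j (x_j + y_k) is the elementary symmetric polynomial of degree \<open>n - k\<close>, which
  stands for \<open>w_(n-k)\<close>. Two real equations for every pair of columns cut the unitary
  matrices out of the product of spheres. Modulo signs of the columns these matrices form a bundle
  over U(n)/O(n) with a real flag manifold as fibre; restricting column \<open>j\<close> to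
  codimension \<open>j\<close> multiplies by \<Prod>_j x_j^j, the top class of the fibre. There are
  then exactly as many functions as dimensions, n(n-1) + n^2 = n(2n-1), so that their cup product
  can be evaluated on a top cell.

  The test functions must make sense on the whole product of spheres, also where the columns are not
  orthonormal. This is why trivialisations appear as equivariant maps defined on all
  matrices.\<close>

declare Z2.add_bit_eq_xor [simp del] Z2.mult_bit_eq_and [simp del]

lemma bit_add_self [simp]: "a + a = (0::bit)" by (cases a) auto
lemma bit_add_self_left [simp]: "a + (a + b) = (b::bit)" by (cases a; cases b) auto
lemma bit_eq_iff_add: "a = b \<longleftrightarrow> a + b = (0::bit)" by (cases a; cases b) auto

text \<open>A simplex is the list of its vertices, a chain modulo 2 is a list of simplices, and two chains count as
equal when every function to \<^typ>\<open>bit\<close> has the same sum over them. The empty simplex is a face of a vertex, so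
boundaries are augmented.\<close>

fun faces :: "'a list \<Rightarrow> 'a list list" where
  "faces [] = []"
| "faces (x # xs) = xs # map ((#) x) (faces xs)"

text \<open>The standard subdivision of a prism: its simplices run through
  \<open>f x_0, ..., f x_i, g x_i, ..., g x_m\<close>. Modulo 2 there are no signs.\<close>

fun prism :: "('a \<Rightarrow> 'b) \<Rightarrow> ('a \<Rightarrow> 'b) \<Rightarrow> 'a list \<Rightarrow> 'b list list" where
  "prism f g [] = []"
| "prism f g (x # xs) = (f x # map g (x # xs)) # map ((#) (f x)) (prism f g xs)"

text \<open>The cup product of the coboundaries of the given \<open>0\<close>-cochains.\<close>

fun cup :: "('a \<Rightarrow> bit) list \<Rightarrow> 'a list \<Rightarrow> bit" where
  "cup [] xs = 1"
| "cup (s # ss) (x # y # xs) = (s x + s y) * cup ss (y # xs)"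
| "cup (s # ss) xs = 0"

definition chain_sum :: "('a \<Rightarrow> bit) \<Rightarrow> 'a list \<Rightarrow> bit" where
  "chain_sum \<phi> c = sum_list (map \<phi> c)"

lemma chain_sum_simps [simp]: "chain_sum \<phi> [] = 0" "chain_sum \<phi> (x # c) = \<phi> x + chain_sum \<phi> c"
  "chain_sum \<phi> (c @ c') = chain_sum \<phi> c + chain_sum \<phi> c'" "chain_sum (\<lambda>_. 0) c = 0"
  by (auto simp: chain_sum_def)

lemma chain_sum_map [simp]: "chain_sum \<phi> (map f c) = chain_sum (\<lambda>x. \<phi> (f x)) c"
  by (simp add: chain_sum_def comp_def)

lemma chain_sum_concat: "chain_sum \<phi> (concat cs) = chain_sum (chain_sum \<phi>) cs"
  by (induction cs) auto

lemma chain_sum_add: "chain_sum (\<lambda>x. \<phi> x + \<psi> x) c = chain_sum \<phi> c + chain_sum \<psi> c"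
  by (simp add: chain_sum_def sum_list_addf)

lemma chain_sum_mult: "chain_sum (\<lambda>x. k * \<phi> x) c = k * chain_sum \<phi> c"
  by (simp add: chain_sum_def sum_list_const_mult)

lemma chain_sum_cong: "(\<And>x. x \<in> set c \<Longrightarrow> \<phi> x = \<psi> x) \<Longrightarrow> chain_sum \<phi> c = chain_sum \<psi> c"
  unfolding chain_sum_def by (metis map_cong)

lemma faces_map: "faces (map f xs) = map (map f) (faces xs)"
  by (induction xs) auto

text \<open>The chain homotopy formula. The induction needs all \<open>\<phi>\<close> at once,
  because the recursion puts \<open>f x\<close> in front of every later simplex.\<close>

lemma faces_prism:
  "chain_sum (\<lambda>\<rho>. chain_sum \<phi> (faces \<rho>)) (prism f g \<sigma>) =
     \<phi> (map f \<sigma>) + \<phi> (map g \<sigma>) + chain_sum (\<lambda>\<tau>. chain_sum \<phi> (prism f g \<tau>)) (faces \<sigma>)"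
proof (induction \<sigma> arbitrary: \<phi>)
  case (Cons x xs)
  show ?case using Cons[of "\<lambda>\<tau>. \<phi> (f x # \<tau>)"]
    by (simp add: chain_sum_add faces_map ac_simps)
qed auto

text \<open>The prisms between consecutive maps telescope to a homology from \<open>z\<close> to its image under \<open>h K\<close>, which is then coned off.\<close>

lemma cycle_filling:
  fixes h :: "nat \<Rightarrow> 'a \<Rightarrow> 'a" and c :: 'a and K :: nat
  assumes cyc: "\<And>\<phi>. chain_sum (\<lambda>\<sigma>. chain_sum \<phi> (faces \<sigma>)) z = 0"
    and h0: "\<And>\<sigma> x. \<sigma> \<in> set z \<Longrightarrow> x \<in> set \<sigma> \<Longrightarrow> h 0 x = x"
  defines "w \<equiv> concat (map (\<lambda>k. concat (map (prism (h k) (h (Suc k))) z)) [0..<K])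
             @ map (\<lambda>\<sigma>. c # map (h K) \<sigma>) z"
  shows "chain_sum (\<lambda>\<sigma>. chain_sum \<phi> (faces \<sigma>)) w = chain_sum \<phi> z"
proof -
  have 1: "chain_sum (\<lambda>\<sigma>. chain_sum \<phi> (faces \<sigma>)) (concat (map (\<lambda>k. concat (map (prism (h k) (h (Suc k))) z)) [0..<K]))
      = chain_sum (\<lambda>\<sigma>. \<phi> (map (h 0) \<sigma>)) z + chain_sum (\<lambda>\<sigma>. \<phi> (map (h K) \<sigma>)) z"
    by (induction K) (simp_all add: chain_sum_concat faces_prism chain_sum_add cyc ac_simps)
  have 2: "chain_sum (\<lambda>\<sigma>. \<phi> (map (h 0) \<sigma>)) z = chain_sum \<phi> z"
    by (rule chain_sum_cong) (metis h0 map_idI)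
  show ?thesis unfolding w_def
    by (simp add: 1 2 chain_sum_add faces_map cyc ac_simps)
qed

text \<open>By the induction hypothesis for \<open>ss\<close>, the faces that keep the first two
  vertices contribute a single term; what remains is the sum of the differences of \<open>s\<close>
  around the triangle \<open>x, y, z\<close>, which is 0.\<close>

lemma cup_cocycle: "length \<sigma> = length ss + 2 \<Longrightarrow> chain_sum (cup ss) (faces \<sigma>) = 0"
proof (induction ss arbitrary: \<sigma>)
  case Nil
  then obtain x y where "\<sigma> = [x,y]" by (auto simp: length_Suc_conv)
  then show ?case by simp
next
  case (Cons s ss)
  then obtain x y z xs where \<sigma>: "\<sigma> = x # y # z # xs" "length xs = length ss"
    by (auto simp: length_Suc_conv)
  have "chain_sum (cup ss) (faces (y # z # xs)) = 0" using Cons.IH[of "y#z#xs"] \<sigma> by simp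
  then have *: "chain_sum (\<lambda>\<tau>. cup ss (y # \<tau>)) (faces (z # xs)) = cup ss (z # xs)"
    by (subst bit_eq_iff_add) (simp add: ac_simps)
  have "chain_sum (\<lambda>\<tau>. cup (s#ss) (x # y # \<tau>)) (faces (z#xs)) = (s x + s y) * cup ss (z # xs)"
    by (simp only: cup.simps chain_sum_mult *)
  then show ?case using \<sigma> by (simp add: algebra_simps)
qed

text \<open>The Leibniz rule, with \<open>cup ss\<close> closed. It gives a cup product a primitive,
  so that \<open>chain_sum_cup\<close> can pass from a cell to its boundary.\<close>

lemma cup_coboundary:
  assumes "length \<sigma> = length ss + 2"
  shows "chain_sum (\<lambda>\<tau>. s (hd \<tau>) * cup ss \<tau>) (faces \<sigma>) = cup (s # ss) \<sigma>"
proof -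
  obtain x y xs where \<sigma>: "\<sigma> = x # y # xs" "length xs = length ss"
    using assms by (auto simp: length_Suc_conv)
  have "chain_sum (cup ss) (faces (x#y#xs)) = 0" using cup_cocycle assms \<sigma> by blast
  then have *: "cup ss (x#xs) + chain_sum (\<lambda>\<tau>. cup ss (x # y # \<tau>)) (faces xs) = cup ss (y # xs)"
    by (subst bit_eq_iff_add) (simp add: ac_simps)
  have "s x * cup ss (x#xs) + s x * chain_sum (\<lambda>\<tau>. cup ss (x # y # \<tau>)) (faces xs) = s x * cup ss (y # xs)"
    by (simp only: * distrib_left[symmetric])
  then show ?thesis using \<sigma> by (simp add: chain_sum_mult distrib_right del: bit_add_self)
qed

section \<open>A Borsuk-Ulam theorem for products of spheres\<close>

lemma sum_sym_bit:
  fixes G :: "'i \<Rightarrow> 'i \<Rightarrow> bit"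
  assumes "finite A" "\<And>i j. G i j = G j i" "\<And>i. G i i = 0"
  shows "(\<Sum>i\<in>A. \<Sum>j\<in>A. G i j) = 0"
  using assms(1)
proof induction
  case (insert x A)
  have "(\<Sum>i\<in>A. G i x) = (\<Sum>i\<in>A. G x i)" by (rule sum.cong) (auto intro: assms(2))
  with insert show ?case by (simp add: sum.distrib assms(3) ac_simps)
qed simp

section \<open>Products of spheres and hemispheres, and sign changes of single factors\<close>

definition coord_sphere :: "(nat \<Rightarrow> 'v::euclidean_space) \<Rightarrow> nat \<Rightarrow> 'v set" where
  "coord_sphere b d = {v. norm v = 1 \<and> v \<in> span (b ` {..d})}"

definition hemisphere :: "(nat \<Rightarrow> 'v::euclidean_space) \<Rightarrow> nat \<Rightarrow> 'v set" where
  "hemisphere b d = {v \<in> coord_sphere b d. 0 \<le> v \<bullet> b d}"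

definition sphere_product :: "(nat \<Rightarrow> 'v::euclidean_space) \<Rightarrow> ('i::finite \<Rightarrow> nat) \<Rightarrow> ('v ^ 'i) set" where
  "sphere_product b a = {y. \<forall>i. y $ i \<in> coord_sphere b (a i)}"

definition hemisphere_product :: "(nat \<Rightarrow> 'v::euclidean_space) \<Rightarrow> ('i::finite \<Rightarrow> nat) \<Rightarrow> ('v ^ 'i) set" where
  "hemisphere_product b a = {y. \<forall>i. y $ i \<in> hemisphere b (a i)}"

definition flip :: "'i::finite \<Rightarrow> 'v::euclidean_space ^ 'i \<Rightarrow> 'v ^ 'i" where
  "flip i y = (\<chi> j. if j = i then - (y $ j) else y $ j)"

lemma flip_flip [simp]: "flip i (flip i y) = y"
  by (simp add: flip_def vec_eq_iff)

lemma flip_commute: "flip i (flip j y) = flip j (flip i y)"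
  by (simp add: flip_def vec_eq_iff)

lemma dist_flip [simp]: "dist (flip i x) (flip i y) = dist x y"
proof -
  have "dist ((flip i x) $ j) ((flip i y) $ j) = dist (x $ j) (y $ j)" for j
    by (simp add: flip_def dist_minus)
  then show ?thesis by (simp add: dist_vec_def)
qed

lemma closed_coord_sphere: "closed (coord_sphere b d)"
proof -
  have "coord_sphere b d = sphere 0 1 \<inter> span (b ` {..d})" by (auto simp: coord_sphere_def)
  then show ?thesis by (simp add: closed_Int closed_subspace)
qed

lemma closed_hemisphere: "closed (hemisphere b d)"
proof -
  have "hemisphere b d = coord_sphere b d \<inter> {v. 0 \<le> v \<bullet> b d}" by (auto simp: hemisphere_def)
  moreover have "closed {v. 0 \<le> v \<bullet> b d}" by (intro closed_Collect_le continuous_intros)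
  ultimately show ?thesis by (simp add: closed_Int closed_coord_sphere)
qed

lemma compact_sphere_product: "compact (sphere_product b a)"
proof -
  have "sphere_product b a = (\<Inter>i. (\<lambda>y. y $ i) -` coord_sphere b (a i))" by (auto simp: sphere_product_def)
  moreover have "closed ((\<lambda>y. y $ i) -` coord_sphere b (a i))" for i
    by (intro continuous_closed_vimage closed_coord_sphere) (auto intro: continuous_intros)
  ultimately have "closed (sphere_product b a)" by auto
  moreover have "bounded (sphere_product b a)"
    unfolding bounded_iff
  proof (intro exI ballI)
    fix y assume y: "y \<in> sphere_product b a"
    have "norm y \<le> (\<Sum>i\<in>UNIV. norm (y $ i))"
      by (simp add: norm_vec_def L2_set_le_sum)
    then show "norm y \<le> real CARD('b)" using y by (simp add: sphere_product_def coord_sphere_def)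
  qed
  ultimately show ?thesis by (simp add: compact_eq_bounded_closed)
qed

lemma compact_hemisphere_product: "compact (hemisphere_product b a)"
proof -
  have "hemisphere_product b a = sphere_product b a \<inter> (\<Inter>i. (\<lambda>y. y $ i) -` hemisphere b (a i))" by (auto simp: hemisphere_product_def hemisphere_def sphere_product_def)
  moreover have "closed ((\<lambda>y. y $ i) -` hemisphere b (a i))" for i
    by (intro continuous_closed_vimage closed_hemisphere) (auto intro: continuous_intros)
  then have "closed (\<Inter>i. (\<lambda>y. y $ i) -` hemisphere b (a i))" by auto
  ultimately show ?thesis by (simp only: compact_Int_closed compact_sphere_product)
qed

definition contraction :: "(nat \<Rightarrow> 'v::euclidean_space) \<Rightarrow> ('i::finite \<Rightarrow> nat) \<Rightarrow> real \<Rightarrow> 'v ^ 'i \<Rightarrow> 'v ^ 'i" where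
  "contraction b a t y = (\<chi> i. sgn ((1 - t) *\<^sub>R y $ i + t *\<^sub>R b (a i)))"

definition orthonormal_upto :: "(nat \<Rightarrow> 'v::euclidean_space) \<Rightarrow> nat \<Rightarrow> bool" where
  "orthonormal_upto b D \<longleftrightarrow> (\<forall>m<D. \<forall>n<D. b m \<bullet> b n = (if m = n then 1 else 0))"

text \<open>Pairing with the pole \<open>b (a i)\<close> gives \<open>t\<close> plus a nonnegative
  term, so a zero could occur only at \<open>t = 0\<close>, where the vector is the unit vector
  \<open>y $ i\<close>.\<close>

lemma contraction_nonzero:
  assumes "orthonormal_upto b D" "\<And>i. a i < D" "t \<in> {0..1}" "y \<in> hemisphere_product b a"
  shows "(1 - t) *\<^sub>R y $ i + t *\<^sub>R b (a i) \<noteq> 0"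
proof
  assume 0: "(1 - t) *\<^sub>R y $ i + t *\<^sub>R b (a i) = 0"
  have y: "norm (y $ i) = 1" "0 \<le> y $ i \<bullet> b (a i)" using assms(4) by (auto simp: hemisphere_product_def hemisphere_def coord_sphere_def)
  have "((1 - t) *\<^sub>R y $ i + t *\<^sub>R b (a i)) \<bullet> b (a i) = (1 - t) * (y $ i \<bullet> b (a i)) + t"
    using assms(1,2) by (simp add: orthonormal_upto_def inner_add_left)
  moreover have "(1 - t) * (y $ i \<bullet> b (a i)) \<ge> 0" using y assms(3) by simp
  ultimately have "t = 0" using 0 assms(3) by simp
  then show False using 0 y by auto
qed

lemma contraction_in_hemisphere_product:
  assumes "orthonormal_upto b D" "\<And>i. a i < D" "t \<in> {0..1}" "y \<in> hemisphere_product b a"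
  shows "contraction b a t y \<in> hemisphere_product b a"
proof -
  have "sgn ((1 - t) *\<^sub>R y $ i + t *\<^sub>R b (a i)) \<in> hemisphere b (a i)" for i
  proof -
    let ?w = "(1 - t) *\<^sub>R y $ i + t *\<^sub>R b (a i)"
    have y: "y $ i \<in> span (b ` {..a i})" "0 \<le> y $ i \<bullet> b (a i)"
      using assms(4) by (auto simp: hemisphere_product_def hemisphere_def coord_sphere_def)
    have "?w \<in> span (b ` {..a i})"
      by (intro span_add span_scale y(1) span_base) auto
    moreover have "0 \<le> ?w \<bullet> b (a i)" using y assms by (simp add: orthonormal_upto_def inner_add_left)
    ultimately show ?thesis using contraction_nonzero[OF assms, of i]
      by (simp add: hemisphere_def coord_sphere_def norm_sgn sgn_div_norm span_scale)
  qed
  then show ?thesis by (simp add: contraction_def hemisphere_product_def)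
qed

lemma contraction_0: "y \<in> hemisphere_product b a \<Longrightarrow> contraction b a 0 y = y"
  by (simp add: contraction_def hemisphere_product_def hemisphere_def coord_sphere_def vec_eq_iff sgn_div_norm)

lemma contraction_1: "contraction b a 1 x = contraction b a 1 y"
  by (simp add: contraction_def)

text \<open>Uniformity in time is wanted as well as in space, since a prism mixes vertices at two
  consecutive times.\<close>

lemma contraction_uniform:
  fixes b :: "nat \<Rightarrow> 'v::euclidean_space" and a :: "'i::finite \<Rightarrow> nat"
  assumes "orthonormal_upto b D" "\<And>i. a i < D" "\<epsilon> > 0"
  shows "\<exists>\<delta>>0. \<forall>s\<in>{0..1}. \<forall>t\<in>{0..1}. \<forall>x\<in>hemisphere_product b a. \<forall>y\<in>hemisphere_product b a.
    \<bar>s - t\<bar> < \<delta> \<longrightarrow> dist x y < \<delta> \<longrightarrow> dist (contraction b a s x) (contraction b a t y) < \<epsilon>"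
proof -
  have c: "continuous_on ({0..1} \<times> hemisphere_product b a) (\<lambda>p. contraction b a (fst p) (snd p))"
    unfolding contraction_def
  proof (intro continuous_on_vec_lambda continuous_on_sgn continuous_intros ballI)
    fix i and p :: "real \<times> ('v ^ 'i)" assume "p \<in> {0..1} \<times> hemisphere_product b a"
    then have "fst p \<in> {0..1}" "snd p \<in> hemisphere_product b a" by auto
    then show "(1 - fst p) *\<^sub>R snd p $ i + fst p *\<^sub>R b (a i) \<noteq> 0"
      by (intro contraction_nonzero[OF assms(1)] assms(2))
  qed
  have "uniformly_continuous_on ({0..1} \<times> hemisphere_product b a) (\<lambda>p. contraction b a (fst p) (snd p))"
    by (intro compact_uniformly_continuous c compact_Times compact_hemisphere_product compact_Icc)
  then obtain d where d: "d > 0" "\<And>p q. p \<in> {0..1} \<times> hemisphere_product b a \<Longrightarrow> q \<in> {0..1} \<times> hemisphere_product b a \<Longrightarrow>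
     dist p q < d \<Longrightarrow> dist (contraction b a (fst p) (snd p)) (contraction b a (fst q) (snd q)) < \<epsilon>"
    using assms(3) unfolding uniformly_continuous_on_def by metis
  show ?thesis
  proof (intro exI[of _ "d/2"] conjI ballI impI)
    fix s t :: real and x y
    assume *: "s \<in> {0..1}" "t \<in> {0..1}" "x \<in> hemisphere_product b a" "y \<in> hemisphere_product b a" "\<bar>s - t\<bar> < d/2" "dist x y < d/2"
    have "dist (s,x) (t,y) \<le> \<bar>s - t\<bar> + dist x y"
      using sqrt_sum_squares_le_sum_abs[of "dist s t" "dist x y"] by (simp add: dist_Pair_Pair dist_real_def)
    then have "dist (s,x) (t,y) < d" using * by simp
    then show "dist (contraction b a s x) (contraction b a t y) < \<epsilon>" using d(2)[of "(s,x)" "(t,y)"] * by simp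
  qed (use d in auto)
qed

lemma span_lower_orth:
  assumes "orthonormal_upto b D" "d < D" "v \<in> span (b ` {..<d})"
  shows "v \<bullet> b d = 0"
  using assms(3)
proof (induction rule: span_induct)
  case base
  show ?case by (simp add: subspace_def inner_add_left)
next
  case (step x)
  then show ?case using assms by (auto simp: orthonormal_upto_def)
qed

text \<open>The hemisphere of one dimension less lies on the equator of factor \<open>i\<close>,
  where the pairing with \<open>b (a i)\<close> is 0; so both antipodal copies satisfy the sign
  condition.\<close>

lemma hemisphere_product_face:
  assumes "orthonormal_upto b D" "\<And>i. a i < D" "a i \<noteq> 0" "y \<in> hemisphere_product b (a(i := a i - 1))"
  shows "y \<in> hemisphere_product b a" "flip i y \<in> hemisphere_product b a"
proof -
  have yj: "y $ j \<in> hemisphere b (a j)" if "j \<noteq> i" for j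
    using assms(4) that by (auto simp: hemisphere_product_def dest: spec[of _ j])
  have "y $ i \<in> hemisphere b (a i - 1)"
    using assms(4) by (auto simp: hemisphere_product_def dest: spec[of _ i])
  then have yi: "norm (y $ i) = 1" "y $ i \<in> span (b ` {..a i - 1})" by (auto simp: hemisphere_def coord_sphere_def)
  have "{..a i - 1} = {..<a i}" using assms(3) by auto
  then have "y $ i \<bullet> b (a i) = 0" using span_lower_orth[OF assms(1), of "a i" "y $ i"] assms(2) yi by simp
  moreover have "y $ i \<in> span (b ` {..a i})" using yi span_mono[of "b ` {..a i - 1}" "b ` {..a i}"] by fastforce
  ultimately have "y $ i \<in> hemisphere b (a i)" "- (y $ i) \<in> hemisphere b (a i)" using yi by (auto simp: hemisphere_def coord_sphere_def span_neg)
  then show "y \<in> hemisphere_product b a" "flip i y \<in> hemisphere_product b a" using yj by (auto simp: hemisphere_product_def flip_def) metis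
qed

section \<open>Chains of small mesh representing products of hemispheres\<close>

lemma set_prism: "\<rho> \<in> set (prism f g \<sigma>) \<Longrightarrow> set \<rho> \<subseteq> f ` set \<sigma> \<union> g ` set \<sigma>"
  by (induction \<sigma> arbitrary: \<rho>) fastforce+

lemma length_prism: "\<rho> \<in> set (prism f g \<sigma>) \<Longrightarrow> length \<rho> = Suc (length \<sigma>)"
  by (induction \<sigma> arbitrary: \<rho>) auto

text \<open>A hemisphere of dimension 0 is the single point \<open>b 0\<close> and has no antipodal
  faces, hence the summand 0 for \<open>a i = 0\<close>.\<close>

definition boundary_sum ::
    "(('v::euclidean_space ^ 'i::finite) list \<Rightarrow> bit) \<Rightarrow> (('i \<Rightarrow> nat) \<Rightarrow> ('v ^ 'i) list list) \<Rightarrow> ('i \<Rightarrow> nat) \<Rightarrow> bit" where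
  "boundary_sum \<phi> E a = (\<Sum>i\<in>UNIV. if a i = (0::nat) then 0 else
     chain_sum (\<lambda>\<tau>. \<phi> \<tau> + \<phi> (map (flip i) \<tau>)) (E (a(i := a i - 1))))"

text \<open>\<open>E a\<close> is a fine chain representing the product of the hemispheres of dimensions \<open>a i\<close>. The boundary of a
hemisphere consists of two antipodal hemispheres of one dimension less.\<close>

definition small_cell ::
    "(nat \<Rightarrow> 'v::euclidean_space) \<Rightarrow> real \<Rightarrow> (('i::finite \<Rightarrow> nat) \<Rightarrow> ('v ^ 'i) list list) \<Rightarrow> ('i \<Rightarrow> nat) \<Rightarrow> bool" where
  "small_cell b \<epsilon> E a \<longleftrightarrow>
    (\<forall>\<sigma>\<in>set (E a). length \<sigma> = Suc (sum a UNIV) \<and> set \<sigma> \<subseteq> hemisphere_product b a \<and>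
       (\<forall>x\<in>set \<sigma>. \<forall>y\<in>set \<sigma>. dist x y < \<epsilon>)) \<and>
    (if sum a UNIV = 0 then E a = [[\<chi> i. b 0]]
     else (\<forall>\<phi>. chain_sum (\<lambda>\<sigma>. chain_sum \<phi> (faces \<sigma>)) (E a) = boundary_sum \<phi> E a))"

lemma sum_fun_upd_decrement:
  fixes a :: "'i::finite \<Rightarrow> nat"
  assumes "a i \<noteq> 0" shows "Suc (sum (a(i := a i - 1)) UNIV) = sum a UNIV"
proof -
  have "sum (a(i := a i - 1)) (UNIV - {i}) = sum a (UNIV - {i})" by (rule sum.cong) auto
  then show ?thesis using assms by (simp add: sum.remove[of UNIV i])
qed

text \<open>Taking boundaries twice gives a sum over ordered pairs of lowered factors. It is
  symmetric because flips commute, and its diagonal vanishes because a flip is an involution. If the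
  lowered cell is a vertex, its two copies both have the empty simplex as augmented boundary, and
  these cancel.\<close>

lemma boundary_sum_cycle:
  fixes a :: "'i::finite \<Rightarrow> nat" and E :: "('i \<Rightarrow> nat) \<Rightarrow> ('v::euclidean_space ^ 'i) list list"
  assumes "\<And>i. a i \<noteq> 0 \<Longrightarrow> small_cell b \<epsilon> E (a(i := a i - 1))"
  shows "boundary_sum (\<lambda>\<sigma>. chain_sum \<phi> (faces \<sigma>)) E a = 0"
proof -
  define G where "G i j = (if a i = 0 \<or> (a(i := a i - 1)) j = 0 then 0 else
     chain_sum (\<lambda>\<tau>. \<phi> \<tau> + \<phi> (map (flip i) \<tau>) + \<phi> (map (flip j) \<tau>) + \<phi> (map (flip i) (map (flip j) \<tau>)))
       (E ((a(i := a i - 1))(j := (a(i := a i - 1)) j - 1))))" for i j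
  have "(if a i = 0 then 0 else chain_sum (\<lambda>\<tau>. chain_sum \<phi> (faces \<tau>) + chain_sum \<phi> (faces (map (flip i) \<tau>))) (E (a(i := a i - 1))))
      = (\<Sum>j\<in>UNIV. G i j)" for i
  proof (cases "a i = 0")
    case True then show ?thesis by (simp add: G_def)
  next
    case False
    let ?a = "a(i := a i - 1)"
    have g: "small_cell b \<epsilon> E ?a" by (rule assms[OF False])
    have 1: "chain_sum (\<lambda>\<tau>. chain_sum \<phi> (faces \<tau>) + chain_sum \<phi> (faces (map (flip i) \<tau>))) (E ?a)
      = chain_sum (\<lambda>\<tau>. chain_sum (\<lambda>\<rho>. \<phi> \<rho> + \<phi> (map (flip i) \<rho>)) (faces \<tau>)) (E ?a)"
      by (simp add: faces_map chain_sum_add)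
    show ?thesis
    proof (cases "sum ?a UNIV = 0")
      case True
      then have "E ?a = [[\<chi> i. b 0]]" using g by (simp add: small_cell_def)
      moreover have "G i j = 0" for j
        using True by (auto simp: G_def)
      ultimately show ?thesis using 1 False by simp
    next
      case F2: False
      have "chain_sum (\<lambda>\<tau>. chain_sum (\<lambda>\<rho>. \<phi> \<rho> + \<phi> (map (flip i) \<rho>)) (faces \<tau>)) (E ?a) = boundary_sum (\<lambda>\<rho>. \<phi> \<rho> + \<phi> (map (flip i) \<rho>)) E ?a"
        using g F2 by (simp only: small_cell_def if_False)
      also have "\<dots> = (\<Sum>j\<in>UNIV. G i j)"
        unfolding boundary_sum_def G_def using False
        by (intro sum.cong refl) (simp add: add.assoc)
      finally show ?thesis using 1 False by simp
    qed
  qed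
  then have "boundary_sum (\<lambda>\<sigma>. chain_sum \<phi> (faces \<sigma>)) E a = (\<Sum>i\<in>UNIV. \<Sum>j\<in>UNIV. G i j)"
    unfolding boundary_sum_def by simp
  also have "\<dots> = 0"
  proof (rule sum_sym_bit)
    fix i j show "G i j = G j i"
    proof (cases "i = j")
      case False
      then have 1: "(a(i := a i - 1))(j := (a(i := a i - 1)) j - 1) = (a(j := a j - 1))(i := (a(j := a j - 1)) i - 1)"
        by (auto simp: fun_eq_iff)
      have 2: "flip i \<circ> flip j = (flip j \<circ> flip i :: 'v ^ 'i \<Rightarrow> _)"
        by (rule ext) (simp add: flip_commute)
      show ?thesis unfolding G_def 1 using False by (auto simp: 2 ac_simps)
    qed simp
    show "G i i = 0" by (simp add: G_def comp_def add.assoc ac_simps)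
  qed simp
  finally show ?thesis .
qed

lemma small_cellD:
  assumes "small_cell b \<epsilon> E a" "\<sigma> \<in> set (E a)"
  shows "length \<sigma> = Suc (sum a UNIV)" "set \<sigma> \<subseteq> hemisphere_product b a" "\<And>x y. x \<in> set \<sigma> \<Longrightarrow> y \<in> set \<sigma> \<Longrightarrow> dist x y < \<epsilon>"
  using assms unfolding small_cell_def by blast+

lemma small_cell_faces: "small_cell b \<epsilon> E a \<Longrightarrow> sum a UNIV \<noteq> 0 \<Longrightarrow> chain_sum (\<lambda>\<sigma>. chain_sum \<phi> (faces \<sigma>)) (E a) = boundary_sum \<phi> E a"
  by (simp only: small_cell_def if_False)

lemma small_cell_0: "small_cell b \<epsilon> E a \<Longrightarrow> sum a UNIV = 0 \<Longrightarrow> E a = [[\<chi> i. b 0]]"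
  by (simp only: small_cell_def if_True)

lemma small_cellI:
  assumes "\<And>\<sigma>. \<sigma> \<in> set (E a) \<Longrightarrow> length \<sigma> = Suc (sum a UNIV) \<and> set \<sigma> \<subseteq> hemisphere_product b a \<and>
       (\<forall>x\<in>set \<sigma>. \<forall>y\<in>set \<sigma>. dist x y < \<epsilon>)"
    and "sum a UNIV = 0 \<Longrightarrow> E a = [[\<chi> i. b 0]]"
    and "\<And>\<phi>. sum a UNIV \<noteq> 0 \<Longrightarrow> chain_sum (\<lambda>\<sigma>. chain_sum \<phi> (faces \<sigma>)) (E a) = boundary_sum \<phi> E a"
  shows "small_cell b \<epsilon> E a"
  unfolding small_cell_def using assms by presburger

lemma hemisphere_product_zero:
  assumes "orthonormal_upto b D" "0 < D" shows "(\<chi> i. b 0) \<in> hemisphere_product b (\<lambda>i. 0)"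
proof -
  have "b 0 \<bullet> b 0 = 1" using assms by (simp add: orthonormal_upto_def)
  then show ?thesis by (simp add: hemisphere_product_def hemisphere_def coord_sphere_def span_base norm_eq_sqrt_inner)
qed

text \<open>The contraction is cut into \<open>K\<close> time steps shorter than
  \<open>\<delta>\<close>, which keeps the prisms \<open>\<epsilon>\<close>-small. At time 1 all
  vertices have reached the same point \<open>c\<close>, so the cone only adds simplices with every
  vertex equal to \<open>c\<close>.\<close>

lemma small_cycle_filling:
  fixes a :: "'i::finite \<Rightarrow> nat" and z :: "('v::euclidean_space ^ 'i) list list"
  assumes b: "orthonormal_upto b D" "\<And>i. a i < D"
    and d: "\<delta> > 0" "\<forall>s\<in>{0..1}. \<forall>t\<in>{0..1}. \<forall>x\<in>hemisphere_product b a. \<forall>y\<in>hemisphere_product b a.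
       \<bar>s - t\<bar> < \<delta> \<longrightarrow> dist x y < \<delta> \<longrightarrow> dist (contraction b a s x) (contraction b a t y) < \<epsilon>"
    and z: "\<And>\<sigma>. \<sigma> \<in> set z \<Longrightarrow> length \<sigma> = n \<and> set \<sigma> \<subseteq> hemisphere_product b a \<and> (\<forall>x\<in>set \<sigma>. \<forall>y\<in>set \<sigma>. dist x y < \<delta>)"
    and cyc: "\<And>\<phi>. chain_sum (\<lambda>\<sigma>. chain_sum \<phi> (faces \<sigma>)) z = 0"
    and \<epsilon>: "\<epsilon> > 0"
  shows "\<exists>w. (\<forall>\<phi>. chain_sum (\<lambda>\<sigma>. chain_sum \<phi> (faces \<sigma>)) w = chain_sum \<phi> z) \<and>
    (\<forall>\<sigma>\<in>set w. length \<sigma> = Suc n \<and> set \<sigma> \<subseteq> hemisphere_product b a \<and> (\<forall>x\<in>set \<sigma>. \<forall>y\<in>set \<sigma>. dist x y < \<epsilon>))"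
proof (cases "z = []")
  case True then show ?thesis by (intro exI[of _ "[]"]) simp
next
  case nz: False
  obtain K :: nat where K: "K > 0" "1 / K < \<delta>"
    using d(1) by (metis of_nat_0_less_iff reals_Archimedean inverse_eq_divide zero_less_Suc)
  define h where "h k = contraction b a (k / K)" for k :: nat
  have fr: "real k / K \<in> {0..1}" if "k \<le> K" for k using that K by auto
  have hH: "h k x \<in> hemisphere_product b a" if "k \<le> K" "x \<in> hemisphere_product b a" for k x
    unfolding h_def by (rule contraction_in_hemisphere_product[OF b(1)]) (use b(2) fr that in auto)
  have hd: "dist (h k x) (h l y) < \<epsilon>" if "k \<le> K" "l \<le> K" "\<bar>int k - int l\<bar> \<le> 1" "x \<in> hemisphere_product b a" "y \<in> hemisphere_product b a" "dist x y < \<delta>" for k l x y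
  proof -
    have "\<bar>real k / K - real l / K\<bar> = \<bar>real k - real l\<bar> / K" by (simp add: diff_divide_distrib[symmetric])
    also have "\<dots> \<le> 1 / K" using that(3) K by (intro divide_right_mono) auto
    finally have "\<bar>real k / K - real l / K\<bar> < \<delta>" using K by simp
    then show ?thesis unfolding h_def using d(2) fr[OF that(1)] fr[OF that(2)] that by blast
  qed
  define c where "c = contraction b a 1 (\<chi> i. b 0)"
  have hK: "h K x = c" for x using K by (simp add: h_def c_def contraction_1[of b a x])
  define w where "w = concat (map (\<lambda>k. concat (map (prism (h k) (h (Suc k))) z)) [0..<K])
             @ map (\<lambda>\<sigma>. c # map (h K) \<sigma>) z"
  have "chain_sum (\<lambda>\<sigma>. chain_sum \<phi> (faces \<sigma>)) w = chain_sum \<phi> z" for \<phi>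
    unfolding w_def
  proof (rule cycle_filling[OF cyc])
    fix \<sigma> x assume "\<sigma> \<in> set z" "x \<in> set \<sigma>"
    then have "x \<in> hemisphere_product b a" using z by blast
    then show "h 0 x = x" by (simp add: h_def contraction_0)
  qed
  moreover have "length \<rho> = Suc n \<and> set \<rho> \<subseteq> hemisphere_product b a \<and> (\<forall>x\<in>set \<rho>. \<forall>y\<in>set \<rho>. dist x y < \<epsilon>)"
    if "\<rho> \<in> set w" for \<rho>
  proof -
    consider (p) k \<sigma> where "k < K" "\<sigma> \<in> set z" "\<rho> \<in> set (prism (h k) (h (Suc k)) \<sigma>)"
      | (c) \<sigma> where "\<sigma> \<in> set z" "\<rho> = c # map (h K) \<sigma>"
      using \<open>\<rho> \<in> set w\<close> unfolding w_def by auto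
    then show ?thesis
    proof cases
      case p
      note zz = z[OF p(2)]
      have sub: "set \<rho> \<subseteq> h k ` set \<sigma> \<union> h (Suc k) ` set \<sigma>" using set_prism[OF p(3)] .
      have "length \<rho> = Suc n" using length_prism[OF p(3)] zz by simp
      moreover have "set \<rho> \<subseteq> hemisphere_product b a"
      proof
        fix x assume "x \<in> set \<rho>"
        then obtain k1 x' where "x = h k1 x'" "x' \<in> set \<sigma>" "k1 \<le> K" using p(1) sub by fastforce
        then show "x \<in> hemisphere_product b a" using zz hH[of k1 x'] by blast
      qed
      moreover have "dist x y < \<epsilon>" if xy: "x \<in> set \<rho>" "y \<in> set \<rho>" for x y
      proof -
        obtain k1 x' where 1: "x = h k1 x'" "x' \<in> set \<sigma>" "k1 = k \<or> k1 = Suc k" using xy sub by blast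
        obtain k2 y' where 2: "y = h k2 y'" "y' \<in> set \<sigma>" "k2 = k \<or> k2 = Suc k" using xy sub by blast
        have xy': "x' \<in> hemisphere_product b a" "y' \<in> hemisphere_product b a" "dist x' y' < \<delta>" using zz 1(2) 2(2) by blast+
        have "k1 \<le> K" "k2 \<le> K" "\<bar>int k1 - int k2\<bar> \<le> 1" using 1(3) 2(3) p(1) by auto
        then show ?thesis unfolding 1(1) 2(1) using xy' by (rule hd)
      qed
      ultimately show ?thesis by blast
    next
      case c
      note zz = z[OF c(1)]
      have cH: "c \<in> hemisphere_product b a"
      proof -
        have "norm (b (a i)) = 1" for i using b by (simp add: orthonormal_upto_def norm_eq_sqrt_inner)
        moreover have "b (a i) \<bullet> b (a i) \<ge> 0" for i by simp
        ultimately show ?thesis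
          by (simp add: c_def contraction_def hemisphere_product_def hemisphere_def coord_sphere_def sgn_div_norm span_base)
      qed
      then show ?thesis using c zz hK \<epsilon> by auto
    qed
  qed
  ultimately show ?thesis by blast
qed

text \<open>A filling is coarser than the cycle that it fills. Hence the induction on the dimension
  is for all \<open>\<epsilon>\<close>: the lower cells are built with a mesh
  \<open>\<delta>\<close> that suits each of the finitely many contractions for exponents below
  \<open>D\<close>.\<close>

lemma small_cell_family:
  fixes b :: "nat \<Rightarrow> 'v::euclidean_space"
  assumes b: "orthonormal_upto b D" "0 < D"
  shows "\<epsilon> > 0 \<Longrightarrow> \<exists>E. \<forall>a::'i::finite \<Rightarrow> nat. (\<forall>i. a i < D) \<longrightarrow> sum a UNIV \<le> m \<longrightarrow> small_cell b \<epsilon> E a"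
proof (induction m arbitrary: \<epsilon>)
  case 0
  have "small_cell b \<epsilon> (\<lambda>a. [[\<chi> i. b 0]]) a" if "sum a UNIV \<le> 0" for a :: "'i \<Rightarrow> nat"
  proof -
    have "a = (\<lambda>i. 0)" using that by (auto simp: fun_eq_iff)
    then show ?thesis using hemisphere_product_zero[OF b] 0 by (simp add: small_cell_def)
  qed
  then show ?case by blast
next
  case (Suc m)
  let ?A = "{a::'i \<Rightarrow> nat. \<forall>i. a i < D}"
  define Q where "Q a \<delta> \<longleftrightarrow> (\<forall>s\<in>{0..1}. \<forall>t\<in>{0..1}. \<forall>x\<in>hemisphere_product b a. \<forall>y\<in>hemisphere_product b a.
       \<bar>s - t\<bar> < \<delta> \<longrightarrow> dist x y < \<delta> \<longrightarrow> dist (contraction b a s x) (contraction b a t y) < \<epsilon>)" for a :: "'i \<Rightarrow> nat" and \<delta>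
  have "\<exists>\<delta>>0. Q a \<delta>" if "a \<in> ?A" for a
    unfolding Q_def using contraction_uniform[OF b(1) _ Suc.prems, of a] that by blast
  then obtain del where del: "\<And>a. a \<in> ?A \<Longrightarrow> del a > 0 \<and> Q a (del a)" by metis
  have "?A = PiE UNIV (\<lambda>_. {..<D})" by (auto simp: PiE_UNIV_domain)
  then have finA: "finite ?A" by (simp add: finite_PiE)
  have neA: "?A \<noteq> {}" using b(2) by auto
  define \<delta> where "\<delta> = min \<epsilon> (Min (del ` ?A))"
  have \<delta>: "\<delta> > 0" "\<delta> \<le> \<epsilon>" using finA neA del Suc.prems by (auto simp: \<delta>_def)
  have Q: "Q a \<delta>" if "a \<in> ?A" for a
  proof -
    have "\<delta> \<le> del a" using finA that by (simp add: \<delta>_def min.coboundedI2)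
    then show ?thesis using del[OF that] unfolding Q_def by (meson less_le_trans)
  qed
  obtain E where E: "\<And>a::'i \<Rightarrow> nat. (\<forall>i. a i < D) \<Longrightarrow> sum a UNIV \<le> m \<Longrightarrow> small_cell b \<delta> E a"
    using Suc.IH[OF \<delta>(1)] by blast
  obtain en :: "'i list" where en: "set en = UNIV" "distinct en"
    using finite_distinct_list[OF finite_class.finite_UNIV] by blast
  \<comment> \<open>The prescribed boundary of the new cell, assembled from cells of mesh
    \<open>\<delta>\<close>.\<close>
  define z where "z a = concat (map (\<lambda>i. if a i = 0 then [] else E (a(i := a i - 1)) @ map (map (flip i)) (E (a(i := a i - 1)))) en)" for a
  have evz: "chain_sum \<phi> (z a) = boundary_sum \<phi> E a" for \<phi> a
  proof -
    have "chain_sum \<phi> (z a) = (\<Sum>i\<leftarrow>en. if a i = 0 then 0 else chain_sum (\<lambda>\<tau>. \<phi> \<tau> + \<phi> (map (flip i) \<tau>)) (E (a(i := a i - 1))))"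
      unfolding z_def chain_sum_concat chain_sum_map by (simp add: chain_sum_def[of _ en] chain_sum_add if_distrib cong: if_cong)
    then show ?thesis using en by (simp add: boundary_sum_def sum_list_distinct_conv_sum_set)
  qed
  have ex: "\<exists>w. (\<forall>\<phi>. chain_sum (\<lambda>\<sigma>. chain_sum \<phi> (faces \<sigma>)) w = chain_sum \<phi> (z a)) \<and>
    (\<forall>\<sigma>\<in>set w. length \<sigma> = Suc (sum a UNIV) \<and> set \<sigma> \<subseteq> hemisphere_product b a \<and> (\<forall>x\<in>set \<sigma>. \<forall>y\<in>set \<sigma>. dist x y < \<epsilon>))"
    if a: "\<forall>i. a i < D" "sum a UNIV = Suc m" for a
  proof (rule small_cycle_filling[OF b(1) _ \<delta>(1)])
    have g: "small_cell b \<delta> E (a(i := a i - 1))" if "a i \<noteq> 0" for i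
    proof (rule E)
      show "\<forall>j. (a(i := a i - 1)) j < D" using a(1) by (auto intro: less_imp_diff_less)
      show "sum (a(i := a i - 1)) UNIV \<le> m" using sum_fun_upd_decrement[of a i, OF that] a(2) by simp
    qed
    show "a i < D" for i using a by blast
    show "\<forall>s\<in>{0..1}. \<forall>t\<in>{0..1}. \<forall>x\<in>hemisphere_product b a. \<forall>y\<in>hemisphere_product b a.
       \<bar>s - t\<bar> < \<delta> \<longrightarrow> dist x y < \<delta> \<longrightarrow> dist (contraction b a s x) (contraction b a t y) < \<epsilon>"
      using Q[of a] a(1) unfolding Q_def by blast
    show "chain_sum (\<lambda>\<sigma>. chain_sum \<phi> (faces \<sigma>)) (z a) = 0" for \<phi>
      unfolding evz by (rule boundary_sum_cycle[OF g])
    show "\<epsilon> > 0" by fact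
    fix \<sigma> assume "\<sigma> \<in> set (z a)"
    then obtain i \<tau> where i: "a i \<noteq> 0" "\<tau> \<in> set (E (a(i := a i - 1)))" "\<sigma> = \<tau> \<or> \<sigma> = map (flip i) \<tau>"
      by (auto simp: z_def split: if_splits)
    have t: "length \<tau> = sum a UNIV" "set \<tau> \<subseteq> hemisphere_product b (a(i := a i - 1))" "\<forall>x\<in>set \<tau>. \<forall>y\<in>set \<tau>. dist x y < \<delta>"
      using small_cellD(1)[OF g[OF i(1)] i(2)] sum_fun_upd_decrement[of a i, OF i(1)] small_cellD(2)[OF g[OF i(1)] i(2)]
        small_cellD(3)[OF g[OF i(1)] i(2)] by (linarith, blast, blast)
    have "set \<sigma> \<subseteq> hemisphere_product b a"
    proof
      fix x assume "x \<in> set \<sigma>"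
      then obtain x' where x': "x' \<in> set \<tau>" "x = x' \<or> x = flip i x'" using i(3) by auto
      then have "x' \<in> hemisphere_product b (a(i := a i - 1))" using t(2) by blast
      from hemisphere_product_face[OF b(1) _ i(1) this] show "x \<in> hemisphere_product b a" using a(1) x'(2) by blast
    qed
    then show "length \<sigma> = sum a UNIV \<and> set \<sigma> \<subseteq> hemisphere_product b a \<and> (\<forall>x\<in>set \<sigma>. \<forall>y\<in>set \<sigma>. dist x y < \<delta>)"
      using t i(3) by auto
  qed
  define W where "W a = (SOME w. (\<forall>\<phi>. chain_sum (\<lambda>\<sigma>. chain_sum \<phi> (faces \<sigma>)) w = chain_sum \<phi> (z a)) \<and>
    (\<forall>\<sigma>\<in>set w. length \<sigma> = Suc (sum a UNIV) \<and> set \<sigma> \<subseteq> hemisphere_product b a \<and> (\<forall>x\<in>set \<sigma>. \<forall>y\<in>set \<sigma>. dist x y < \<epsilon>)))" for a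
  \<comment> \<open>The lower cells are kept, so the new boundaries refer to the chains that were
    actually used.\<close>
  define E' where "E' a = (if sum a UNIV \<le> m then E a else W a)" for a
  have "small_cell b \<epsilon> E' a" if a: "\<forall>i. a i < D" "sum a UNIV \<le> Suc m" for a :: "'i \<Rightarrow> nat"
  proof -
    have bs: "boundary_sum \<phi> E' a = boundary_sum \<phi> E a" for \<phi>
      unfolding boundary_sum_def
    proof (intro sum.cong refl if_cong)
      fix i assume "a i \<noteq> 0"
      then have "sum (a(i := a i - 1)) UNIV \<le> m" using sum_fun_upd_decrement[of a i] a(2) by simp
      then show "chain_sum (\<lambda>\<tau>. \<phi> \<tau> + \<phi> (map (flip i) \<tau>)) (E' (a(i := a i - 1))) = chain_sum (\<lambda>\<tau>. \<phi> \<tau> + \<phi> (map (flip i) \<tau>)) (E (a(i := a i - 1)))"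
        by (simp add: E'_def)
    qed
    show ?thesis
    proof (cases "sum a UNIV \<le> m")
      case True
      then have "small_cell b \<delta> E a" "E' a = E a" using E a by (auto simp: E'_def)
      then have "small_cell b \<epsilon> E a" using \<delta>(2) unfolding small_cell_def by (meson less_le_trans)
      then show ?thesis using \<open>E' a = E a\<close> unfolding small_cell_def bs by simp
    next
      case False
      then have s: "sum a UNIV = Suc m" "E' a = W a" using a by (auto simp: E'_def)
      note W = someI_ex[OF ex[OF a(1) s(1)], folded W_def]
      show ?thesis
      proof (rule small_cellI)
        show "length \<sigma> = Suc (sum a UNIV) \<and> set \<sigma> \<subseteq> hemisphere_product b a \<and> (\<forall>x\<in>set \<sigma>. \<forall>y\<in>set \<sigma>. dist x y < \<epsilon>)"
          if "\<sigma> \<in> set (E' a)" for \<sigma> using W that unfolding s(2) by blast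
        show "chain_sum (\<lambda>\<sigma>. chain_sum \<phi> (faces \<sigma>)) (E' a) = boundary_sum \<phi> E' a" for \<phi> using W unfolding s(2) bs evz by blast
      qed (use s(1) in simp)
    qed
  qed
  then show ?case by blast
qed

text \<open>The coefficient modulo 2 of \<open>\<Prod>\<^sub>i x\<^sub>i\<^bsup>a i\<^esup>\<close> in the product of the linear forms \<open>\<Sum>{x\<^sub>i | X i}\<close>. The value at
\<^term>\<open>[]\<close> is right only under the homogeneity condition that the \<open>a i\<close> add up to the length of the list.\<close>

fun character_coeff :: "('i::finite \<Rightarrow> bool) list \<Rightarrow> ('i \<Rightarrow> nat) \<Rightarrow> bit" where
  "character_coeff [] a = 1"
| "character_coeff (X # Xs) a = (\<Sum>i\<in>UNIV. if a i \<noteq> 0 \<and> X i then character_coeff Xs (a(i := a i - 1)) else 0)"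

text \<open>Stokes: the primitive from \<open>cup_coboundary\<close> is summed over pairs of
  antipodal faces. On such a pair the values of \<open>s\<close> differ by \<open>X i\<close> while
  \<open>cup ss\<close> agrees, so the face with lowered factor \<open>i\<close> survives exactly if
  \<open>X i\<close>; this is the recursion of \<open>character_coeff\<close>.\<close>

lemma chain_sum_cup:
  fixes E :: "('i::finite \<Rightarrow> nat) \<Rightarrow> ('v::euclidean_space ^ 'i) list list"
  assumes small_cell: "\<And>a. (\<forall>i. a i \<le> d i) \<Longrightarrow> small_cell b \<epsilon> E a"
    and inv: "list_all2 (\<lambda>s X. \<forall>i. \<forall>y\<in>sphere_product b d. s (flip i y) = s y + of_bool (X i)) ss Xs"
    and mono: "\<And>a. (\<forall>i. a i \<le> d i) \<Longrightarrow> hemisphere_product b a \<subseteq> sphere_product b d"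
  shows "(\<forall>i. a i \<le> d i) \<Longrightarrow> sum a UNIV = length ss \<Longrightarrow> chain_sum (cup ss) (E a) = character_coeff Xs a"
  using inv
proof (induction ss Xs arbitrary: a rule: list_all2_induct)
  case Nil
  then have "sum a UNIV = 0" by simp
  then have "E a = [[\<chi> i. b 0]]" using small_cell_0[OF small_cell[OF Nil(1)]] by blast
  then show ?case by simp
next
  case (Cons s ss X Xs)
  have g: "small_cell b \<epsilon> E a" using small_cell Cons by blast
  have len: "length \<sigma> = length ss + 2" if "\<sigma> \<in> set (E a)" for \<sigma>
    using small_cellD(1)[OF g that] Cons.prems by simp
  \<comment> \<open>A flip adds one constant to all values of a cochain, and \<open>cup\<close> sees
    only differences.\<close>
  have cinv: "cup ss (map (flip i) \<tau>) = cup ss \<tau>" if "set \<tau> \<subseteq> sphere_product b d" for i \<tau>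
    using Cons.hyps(2) that
  proof (induction ss Xs arbitrary: \<tau> rule: list_all2_induct)
    case (Cons s' ss' X' Xs')
    show ?case
    proof (cases \<tau>)
      case t: (Cons x xs)
      then show ?thesis
        using Cons.hyps(1) Cons.prems Cons.IH[of xs] by (cases xs) (auto simp: ac_simps)
    qed simp
  qed simp
  define \<phi> where "\<phi> = (\<lambda>\<tau>. s (hd \<tau>) * cup ss \<tau>)"
  have "chain_sum (cup (s # ss)) (E a) = chain_sum (\<lambda>\<sigma>. chain_sum \<phi> (faces \<sigma>)) (E a)"
    unfolding \<phi>_def by (rule chain_sum_cong) (simp add: cup_coboundary len)
  also have "\<dots> = boundary_sum \<phi> E a" by (rule small_cell_faces[OF g]) (use Cons.prems in simp)
  also have "\<dots> = character_coeff (X # Xs) a"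
    unfolding boundary_sum_def character_coeff.simps
  proof (intro sum.cong refl)
    fix i
    show "(if a i = 0 then 0 else chain_sum (\<lambda>\<tau>. \<phi> \<tau> + \<phi> (map (flip i) \<tau>)) (E (a(i := a i - 1)))) =
       (if a i \<noteq> 0 \<and> X i then character_coeff Xs (a(i := a i - 1)) else 0)"
    proof (cases "a i = 0")
      case False
      let ?a = "a(i := a i - 1)"
      have le: "\<forall>j. ?a j \<le> d j" using Cons.prems(1) by (auto intro: le_trans[OF diff_le_self])
      have ga: "small_cell b \<epsilon> E ?a" by (rule small_cell[OF le])
      have sa: "sum ?a UNIV = length ss" using sum_fun_upd_decrement[of a i] False Cons.prems by simp
      have "chain_sum (\<lambda>\<tau>. \<phi> \<tau> + \<phi> (map (flip i) \<tau>)) (E ?a) = chain_sum (\<lambda>\<tau>. of_bool (X i) * cup ss \<tau>) (E ?a)"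
      proof (rule chain_sum_cong)
        fix \<tau> assume tt: "\<tau> \<in> set (E ?a)"
        have t: "length \<tau> = Suc (length ss)" "set \<tau> \<subseteq> sphere_product b d"
          using small_cellD(1)[OF ga tt] sa order_trans[OF small_cellD(2)[OF ga tt] mono[OF le]] by simp_all
        then have h: "hd \<tau> \<in> sphere_product b d" "hd (map (flip i) \<tau>) = flip i (hd \<tau>)" by (cases \<tau>; simp)+
        show "\<phi> \<tau> + \<phi> (map (flip i) \<tau>) = of_bool (X i) * cup ss \<tau>"
          unfolding \<phi>_def h(2) cinv[OF t(2)] using Cons.hyps(1) h(1)
          by (simp add: distrib_right)
      qed
      also have "\<dots> = of_bool (X i) * character_coeff Xs ?a"
        by (simp only: chain_sum_mult Cons.IH[OF le sa])
      finally show ?thesis using False by simp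
    qed simp
  qed
  finally show ?case .
qed

lemma cup_const_zero:
  assumes "s \<in> set ss" "\<forall>x\<in>set \<sigma>. s x = k" "length \<sigma> = Suc (length ss)"
  shows "cup ss \<sigma> = 0"
  using assms
proof (induction ss arbitrary: \<sigma>)
  case (Cons s' ss)
  then obtain x y xs where \<sigma>: "\<sigma> = x # y # xs" by (cases \<sigma>; cases "tl \<sigma>") auto
  show ?case
  proof (cases "s' = s")
    case True
    then show ?thesis using Cons.prems \<sigma> by simp
  next
    case False
    then have "cup ss (y # xs) = 0" using Cons \<sigma> by auto
    then show ?thesis using \<sigma> by simp
  qed
qed simp

text \<open>An arbitrary choice of one vector out of each pair \<open>{v, - v}\<close>; it supplies equivariant signs where a test function vanishes.\<close>

definition antipodal_bit :: "'v::real_vector \<Rightarrow> bit" where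
  "antipodal_bit v = of_bool ((SOME w. w = v \<or> w = - v) = v)"

lemma antipodal_bit_minus: "v \<noteq> 0 \<Longrightarrow> antipodal_bit (- v) = antipodal_bit v + 1"
proof -
  assume v: "v \<noteq> 0"
  let ?w = "SOME w. w = v \<or> w = - v"
  have eq: "(SOME w. w = - v \<or> w = - (- v)) = ?w" by (rule arg_cong[where f = Eps]) auto
  have "?w = v \<or> ?w = - v" by (rule someI[of _ v]) simp
  moreover have "v \<noteq> - v"
  proof
    assume "v = - v"
    then have "2 *\<^sub>R v = 0" by (metis add.right_inverse scaleR_2)
    then show False using v by simp
  qed
  ultimately show ?thesis unfolding antipodal_bit_def eq by auto
qed

text \<open>Without a common zero, every sufficiently small simplex has one of the functions of constant sign on it, so
the cup product of the sign cochains vanishes on all of them; but on the top cell it evaluates to the coefficient.\<close>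

theorem borsuk_ulam_spheres:
  fixes b :: "nat \<Rightarrow> 'v::euclidean_space" and d :: "'i::finite \<Rightarrow> nat"
    and fs :: "('v ^ 'i \<Rightarrow> real) list"
  assumes b: "orthonormal_upto b D" and d: "\<And>i. d i < D"
    and fs: "list_all2 (\<lambda>f X. continuous_on (sphere_product b d) f \<and>
        (\<forall>i. \<forall>y\<in>sphere_product b d. f (flip i y) = (if X i then - f y else f y))) fs Xs"
    and len: "length fs = sum d UNIV" and character_coeff: "character_coeff Xs d = 1"
  shows "\<exists>y\<in>sphere_product b d. \<forall>f\<in>set fs. f y = 0"
proof (rule ccontr)
  assume "\<not> ?thesis"
  then have nz: "\<And>y. y \<in> sphere_product b d \<Longrightarrow> \<exists>f\<in>set fs. f y \<noteq> 0" by blast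
  let ?K = "sphere_product b d"
  \<comment> \<open>A Lebesgue number of this cover becomes the mesh of the cell.\<close>
  define \<G> where "\<G> = {T. open T \<and> (\<exists>f\<in>set fs. (\<forall>y\<in>?K \<inter> T. f y > 0) \<or> (\<forall>y\<in>?K \<inter> T. f y < 0))}"
  have cont: "continuous_on ?K f" if "f \<in> set fs" for f
    using fs that by (auto simp: list_all2_conv_all_nth in_set_conv_nth)
  have "?K \<subseteq> \<Union>\<G>"
  proof
    fix y assume y: "y \<in> ?K"
    then obtain f where f: "f \<in> set fs" "f y \<noteq> 0" using nz by blast
    have ex: "\<exists>T. open T \<and> ?K \<inter> T = ?K \<inter> f -` U" if "open U" for U
      using continuous_openin_preimage_gen[OF cont[OF f(1)] that] unfolding openin_open by metis
    obtain T1 T2 where T: "open T1" "?K \<inter> T1 = ?K \<inter> f -` {0<..}" "open T2" "?K \<inter> T2 = ?K \<inter> f -` {..<0}"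
      using ex[of "{0<..}"] ex[of "{..<0}"] by auto
    have "T1 \<in> \<G>" "T2 \<in> \<G>" using T f(1) unfolding \<G>_def by fastforce+
    moreover have "y \<in> T1 \<or> y \<in> T2" using T(2,4) f(2) y by (cases "f y > 0") auto
    ultimately show "y \<in> \<Union>\<G>" by blast
  qed
  then obtain \<epsilon> where \<epsilon>: "\<epsilon> > 0" "\<And>x. x \<in> ?K \<Longrightarrow> \<exists>G\<in>\<G>. ball x \<epsilon> \<subseteq> G"
    using Heine_Borel_lemma[OF compact_sphere_product[of b d]] unfolding \<G>_def by (metis (mono_tags, lifting) mem_Collect_eq)
  \<comment> \<open>At a zero of \<open>f\<close>, the sum of the bits of the coordinates selected
    by \<open>X\<close> changes under exactly those flips in which \<open>f\<close> is odd.\<close>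
  define S where "S f X y = (if f y > (0::real) then 1 else if f y < 0 then 0 else
     (\<Sum>i\<in>UNIV. of_bool (X i) * antipodal_bit (y $ i)))" for f X and y :: "'v ^ 'i"
  have Sflip: "S f X (flip i y) = S f X y + of_bool (X i)"
    if "f (flip i y) = (if X i then - f y else f y)" "y \<in> ?K" for f X i y
  proof (cases "f y = 0")
    case True
    have "norm (y $ i) = 1" using that(2) by (auto simp: sphere_product_def coord_sphere_def)
    then have yi: "y $ i \<noteq> 0" by auto
    have "(\<Sum>j\<in>UNIV. of_bool (X j) * antipodal_bit (flip i y $ j))
        = (\<Sum>j\<in>UNIV. of_bool (X j) * antipodal_bit (y $ j) + (if j = i then of_bool (X j) else 0))"
      by (rule sum.cong) (auto simp: flip_def antipodal_bit_minus[OF yi] distrib_left)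
    then show ?thesis using True that(1) by (simp add: S_def sum.distrib)
  qed (use that(1) in \<open>auto simp: S_def\<close>)
  define ss where "ss = map2 S fs Xs"
  have lenX: "length Xs = length fs" using fs by (simp add: list_all2_lengthD)
  have inv: "list_all2 (\<lambda>s X. \<forall>i. \<forall>y\<in>?K. s (flip i y) = s y + of_bool (X i)) ss Xs"
    unfolding list_all2_conv_all_nth ss_def
  proof (intro conjI allI impI ballI)
    fix n i y assume n: "n < length (map2 S fs Xs)" and y: "y \<in> ?K"
    then have n': "n < length fs" "n < length Xs" by auto
    have "(fs ! n) (flip i y) = (if (Xs ! n) i then - (fs ! n) y else (fs ! n) y)"
      using fs n' y by (auto simp: list_all2_conv_all_nth)
    from Sflip[where f = "fs ! n" and X = "Xs ! n", OF this y] show "(map2 S fs Xs ! n) (flip i y) = (map2 S fs Xs ! n) y + of_bool ((Xs ! n) i)"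
      using n' by simp
  qed (simp add: lenX)
  have D: "0 < D" using d by (metis gr_zeroI less_zeroE)
  obtain E where E: "\<And>a::'i \<Rightarrow> nat. (\<forall>i. a i < D) \<Longrightarrow> sum a UNIV \<le> sum d UNIV \<Longrightarrow> small_cell b \<epsilon> E a"
    using small_cell_family[OF b D \<epsilon>(1), of "sum d UNIV"] by blast
  have small_cell: "small_cell b \<epsilon> E a" if "\<forall>i. a i \<le> d i" for a
  proof (rule E)
    show "\<forall>i. a i < D" using that d le_less_trans by metis
  qed (use that in \<open>auto intro: sum_mono\<close>)
  have mono: "hemisphere_product b a \<subseteq> ?K" if "\<forall>i. a i \<le> d i" for a
  proof -
    have "span (b ` {..a i}) \<subseteq> span (b ` {..d i})" for i
      using that by (intro span_mono image_mono) auto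
    then show ?thesis by (auto simp: hemisphere_product_def hemisphere_def sphere_product_def coord_sphere_def)
  qed
  have lenss: "length ss = sum d UNIV" using len lenX by (simp add: ss_def)
  have "chain_sum (cup ss) (E d) = character_coeff Xs d"
    using chain_sum_cup[OF small_cell inv mono] lenss by simp
  moreover have "chain_sum (cup ss) (E d) = chain_sum (\<lambda>_. 0) (E d)"
  proof (rule chain_sum_cong)
    fix \<sigma> assume \<sigma>: "\<sigma> \<in> set (E d)"
    have g: "small_cell b \<epsilon> E d" by (rule small_cell) simp
    note gd = small_cellD[OF g \<sigma>]
    have hd: "hd \<sigma> \<in> set \<sigma>" using gd(1) by (cases \<sigma>) auto
    have K: "set \<sigma> \<subseteq> ?K" using gd(2) mono[of d] by auto
    then obtain T where T: "T \<in> \<G>" "ball (hd \<sigma>) \<epsilon> \<subseteq> T" using \<epsilon>(2) hd by blast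
    have "set \<sigma> \<subseteq> T" using gd(3)[OF hd] T(2) by (auto simp: subset_iff)
    then obtain f where f: "f \<in> set fs" "(\<forall>y\<in>set \<sigma>. f y > 0) \<or> (\<forall>y\<in>set \<sigma>. f y < 0)"
      using T(1) K unfolding \<G>_def by blast
    then obtain n where n: "n < length fs" "f = fs ! n" by (auto simp: in_set_conv_nth)
    have "S f (Xs ! n) \<in> set ss" using n lenX by (auto simp: ss_def set_zip)
    moreover have "\<exists>k. \<forall>y\<in>set \<sigma>. S f (Xs ! n) y = k"
      using f(2) by (intro exI[of _ "if \<forall>y\<in>set \<sigma>. f y > 0 then 1 else 0"]) (force simp: S_def)
    ultimately show "cup ss \<sigma> = 0" using cup_const_zero gd(1) lenss by metis
  qed
  ultimately show False using character_coeff by simp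
qed

section \<open>The coefficient\<close>

text \<open>A list entry \<open>(p, q)\<close> stands for the factor \<open>x\<^sub>p + x\<^sub>q\<close>.\<close>

fun pair_coeff :: "('a \<times> 'a) list \<Rightarrow> ('a \<Rightarrow> nat) \<Rightarrow> bit" where
  "pair_coeff [] a = of_bool (\<forall>p. a p = 0)"
| "pair_coeff ((p, q) # L) a = (if a p \<noteq> 0 then pair_coeff L (a(p := a p - 1)) else 0) + (if a q \<noteq> 0 then pair_coeff L (a(q := a q - 1)) else 0)"

definition occurrences :: "'a \<Rightarrow> ('a \<times> 'a) list \<Rightarrow> nat" where
  "occurrences p L = length (filter (\<lambda>(q, r). p = q \<or> p = r) L)"

lemma occurrences_simps [simp]: "occurrences p [] = 0" "occurrences p ((q, r) # L) = (if p = q \<or> p = r then 1 else 0) + occurrences p L"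
  "occurrences p (L @ L') = occurrences p L + occurrences p L'"
  by (auto simp: occurrences_def)

lemma pair_coeff_exceed: "occurrences p L < a p \<Longrightarrow> pair_coeff L a = 0"
proof (induction L a rule: pair_coeff.induct)
  case (2 q r L a)
  have "pair_coeff L (a(q := a q - 1)) = 0" if "a q \<noteq> 0"
    using 2(1)[OF that] 2(3) by (cases "p = q") (auto simp: fun_upd_def)
  moreover have "pair_coeff L (a(r := a r - 1)) = 0" if "a r \<noteq> 0"
    using 2(2)[OF that] 2(3) by (cases "p = r") (auto simp: fun_upd_def split: if_splits)
  ultimately show ?case by simp
qed auto

lemma pair_coeff_forced_Cons:
  assumes "a p = Suc (occurrences p L)" "p \<noteq> q"
  shows "pair_coeff ((p, q) # L) a = pair_coeff L (a(p := occurrences p L))" "pair_coeff ((q, p) # L) a = pair_coeff L (a(p := occurrences p L))"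
proof -
  have "pair_coeff L (a(q := a q - 1)) = 0" using assms by (intro pair_coeff_exceed[of p]) auto
  then show "pair_coeff ((p, q) # L) a = pair_coeff L (a(p := occurrences p L))" "pair_coeff ((q, p) # L) a = pair_coeff L (a(p := occurrences p L))"
    using assms by simp_all
qed

text \<open>The exponent \<open>m\<close> of the variable \<open>p\<close> is the number of factors
  containing it, so \<open>p\<close> must be chosen from each of them, and these factors disappear
  together with \<open>p\<close>.\<close>

lemma pair_coeff_forced:
  assumes "occurrences p L = 0" "\<And>i. i < m \<Longrightarrow> q i \<noteq> p" "a p = m"
  shows "pair_coeff (map (\<lambda>i. (p, q i)) [0..<m] @ L) a = pair_coeff L (a(p := 0))"
    "pair_coeff (map (\<lambda>i. (q i, p)) [0..<m] @ L) a = pair_coeff L (a(p := 0))"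
proof -
  have occ1: "occurrences p (map (\<lambda>i. (p, q i)) is @ L) = length is" "occurrences p (map (\<lambda>i. (q i, p)) is @ L) = length is" for "is"
    using assms(1) by (induction "is") auto
  have "pair_coeff (map (\<lambda>i. (p, q i)) is @ L) a = pair_coeff L (a(p := 0)) \<and> pair_coeff (map (\<lambda>i. (q i, p)) is @ L) a = pair_coeff L (a(p := 0))"
    if "\<forall>i\<in>set is. q i \<noteq> p" "a p = length is" for "is" a
    using that
  proof (induction "is" arbitrary: a)
    case Nil
    then have "a(p := 0) = a" by auto
    then show ?case by simp
  next
    case (Cons i "is")
    have ap: "a p = Suc (occurrences p (map (\<lambda>i. (p, q i)) is @ L))" "a p = Suc (occurrences p (map (\<lambda>i. (q i, p)) is @ L))" and ne: "p \<noteq> q i"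
      using Cons.prems by (simp_all only: occ1) auto
    have "pair_coeff (map (\<lambda>i. (p, q i)) (i # is) @ L) a = pair_coeff (map (\<lambda>i. (p, q i)) is @ L) (a(p := length is))"
      "pair_coeff (map (\<lambda>i. (q i, p)) (i # is) @ L) a = pair_coeff (map (\<lambda>i. (q i, p)) is @ L) (a(p := length is))"
      using pair_coeff_forced_Cons(1)[where a = a and p = p, OF ap(1) ne] pair_coeff_forced_Cons(2)[where a = a and p = p, OF ap(2) ne]
      by (simp_all only: occ1 list.map append.simps)
    moreover have "\<forall>i\<in>set is. q i \<noteq> p" "(a(p := length is)) p = length is" using Cons.prems by simp_all
    note Cons.IH[where a = "a(p := length is)", OF this, unfolded fun_upd_upd]
    ultimately show ?case by presburger
  qed
  from this[of "[0..<m]" a] assms show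
    "pair_coeff (map (\<lambda>i. (p, q i)) [0..<m] @ L) a = pair_coeff L (a(p := 0))"
    "pair_coeff (map (\<lambda>i. (q i, p)) [0..<m] @ L) a = pair_coeff L (a(p := 0))"
    by auto
qed

text \<open>The factors of \<Prod>_{j,k<n} (x_j + y_k), with \<open>Inl j\<close> for
  \<open>x_j\<close> and \<open>Inr k\<close> for \<open>y_k\<close>. The last row and the last
  column stand in front, where the induction in \<open>pair_coeff_grid\<close> removes them.\<close>

fun grid_pairs :: "nat \<Rightarrow> ((nat + nat) \<times> (nat + nat)) list" where
  "grid_pairs 0 = []"
| "grid_pairs (Suc n) = map (\<lambda>k. (Inl n, Inr k)) [0..<Suc n] @ map (\<lambda>j. (Inl j, Inr n)) [0..<n] @ grid_pairs n"

lemma occurrences_eq_0: "(\<And>q r. (q, r) \<in> set L \<Longrightarrow> p \<noteq> q \<and> p \<noteq> r) \<Longrightarrow> occurrences p L = 0"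
  by (force simp: occurrences_def filter_empty_conv)

lemma grid_pairs_bound: "(q, r) \<in> set (grid_pairs n) \<Longrightarrow> (\<exists>j<n. q = Inl j) \<and> (\<exists>k<n. r = Inr k)"
  by (induction n) (auto simp: less_Suc_eq)

lemma occurrences_grid_pairs: "j < n \<Longrightarrow> occurrences (Inl j) (grid_pairs n) = n"
proof (induction n)
  case (Suc n)
  have 1: "occurrences (Inl j) (map (\<lambda>k. (Inl n, Inr k)) is) = (if j = n then length is else 0)" for "is" :: "nat list"
    by (induction "is") auto
  have 2: "occurrences (Inl j) (map (\<lambda>i. (Inl i, Inr n)) is) = length (filter (\<lambda>i. i = j) is)" for "is"
    by (induction "is") auto
  have 3: "length (filter (\<lambda>i. i = j) [0..<m]) = (if j < m then 1 else 0)" for m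
    by (induction m) auto
  show ?case
  proof (cases "j = n")
    case True
    have "occurrences (Inl j) (grid_pairs n) = 0" using grid_pairs_bound[of _ _ n] True by (intro occurrences_eq_0) auto
    then show ?thesis by (simp only: grid_pairs.simps occurrences_simps 1 2 3) (simp add: True)
  next
    case False
    then show ?thesis using Suc by (simp only: grid_pairs.simps occurrences_simps 1 2 3) (simp del: upt_Suc)
  qed
qed simp

text \<open>The row \<open>p\<close> with \<open>\<pi> p = 0\<close> has to be chosen \<open>2n - 1 - p\<close> times out of \<open>n\<close>, which forces \<open>p = n - 1\<close>; then the last row and
the last column are determined and can be removed.\<close>

lemma pair_coeff_grid:
  assumes "\<pi> permutes {..<n}" "\<And>j. j < n \<Longrightarrow> a (Inl j) + 2 * \<pi> j = 2 * n - 1 - j" "\<And>k. k < n \<Longrightarrow> a (Inr k) = k"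
    "\<And>j. j \<ge> n \<Longrightarrow> a (Inl j) = 0" "\<And>k. k \<ge> n \<Longrightarrow> a (Inr k) = 0"
  shows "pair_coeff (grid_pairs n) a = of_bool (\<forall>j<n. \<pi> j = n - 1 - j)"
  using assms
proof (induction n arbitrary: \<pi> a)
  case 0
  then have "a p = 0" for p by (cases p) auto
  then show ?case by simp
next
  case (Suc n)
  obtain p where p: "p < Suc n" "\<pi> p = 0"
    using permutes_image[OF Suc.prems(1)] by (metis imageE lessThan_iff zero_less_Suc)
  have ap: "a (Inl p) = 2 * n + 1 - p" using Suc.prems(2)[OF p(1)] p(2) by simp
  show ?case
  proof (cases "p = n")
    case False
    then have "pair_coeff (grid_pairs (Suc n)) a = 0" using p ap occurrences_grid_pairs[OF p(1)] by (intro pair_coeff_exceed[of "Inl p"]) (simp del: grid_pairs.simps)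
    moreover have "\<pi> p \<noteq> Suc n - 1 - p" using p False by simp
    ultimately show ?thesis using p(1) by auto
  next
    case True
    have o1: "occurrences (Inl n) (map (\<lambda>j. (Inl j, Inr n)) [0..<n] @ grid_pairs n) = 0"
      by (rule occurrences_eq_0) (auto dest: grid_pairs_bound)
    have o2: "occurrences (Inr n) (grid_pairs n) = 0"
      by (rule occurrences_eq_0) (auto dest: grid_pairs_bound)
    let ?a = "a(Inl n := 0)"
    let ?b = "?a(Inr n := 0)"
    \<comment> \<open>The exponent of \<open>Inl n\<close> is \<open>n + 1\<close>, the length of
      its row; that of \<open>Inr n\<close> is \<open>n\<close>, the length of its column without
      the entry already removed with the row.\<close>
    have "pair_coeff (grid_pairs (Suc n)) a = pair_coeff (map (\<lambda>j. (Inl j, Inr n)) [0..<n] @ grid_pairs n) ?a"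
      unfolding grid_pairs.simps using ap True by (intro pair_coeff_forced(1) o1) auto
    also have "\<dots> = pair_coeff (grid_pairs n) ?b"
      using Suc.prems(3)[of n] by (intro pair_coeff_forced(2) o2) auto
    also have "\<dots> = of_bool (\<forall>j<n. \<pi> j - 1 = n - 1 - j)"
    proof -
      \<comment> \<open>With the index \<open>n\<close> and its value 0 gone, all other values drop
        by one; this accounts for the change from \<open>2 * Suc n - 1 - j\<close> to
        \<open>2 * n - 1 - j\<close>, while the exponents of the remaining variables stay.\<close>
      define \<pi>' where "\<pi>' j = (if j < n then \<pi> j - 1 else j)" for j
      have inj: "inj \<pi>" using Suc.prems(1) by (rule permutes_inj)
      have pos: "\<pi> j \<ge> 1" "\<pi> j \<le> n" if "j < n" for j
      proof -
        show "\<pi> j \<ge> 1" using inj_eq[OF inj, of j p] p True that by (cases "\<pi> j") auto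
        show "\<pi> j \<le> n" using permutes_in_image[OF Suc.prems(1), of j] that by auto
      qed
      have "inj_on \<pi>' {..<n}"
      proof (rule inj_onI)
        fix i j assume "i \<in> {..<n}" "j \<in> {..<n}" "\<pi>' i = \<pi>' j"
        then have "\<pi> i = \<pi> j" using pos[of i] pos[of j] by (simp add: \<pi>'_def)
        then show "i = j" using inj_eq[OF inj] by simp
      qed
      moreover have "\<pi>' ` {..<n} \<subseteq> {..<n}" using pos by (fastforce simp: \<pi>'_def)
      ultimately have "bij_betw \<pi>' {..<n} {..<n}" by (simp add: bij_betw_def endo_inj_surj)
      then have perm: "\<pi>' permutes {..<n}" by (rule bij_imp_permutes) (simp add: \<pi>'_def)
      have "pair_coeff (grid_pairs n) ?b = of_bool (\<forall>j<n. \<pi>' j = n - 1 - j)"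
      proof (rule Suc.IH[OF perm])
        fix j assume "j < n"
        then show "?b (Inl j) + 2 * \<pi>' j = 2 * n - 1 - j"
          using Suc.prems(2)[of j] pos[of j] by (simp add: \<pi>'_def)
      next
        fix k assume "k < n" then show "?b (Inr k) = k" using Suc.prems(3)[of k] by simp
      next
        fix j assume "n \<le> j" then show "?b (Inl j) = 0" using Suc.prems(4)[of j] by simp
      next
        fix j assume "n \<le> j" then show "?b (Inr j) = 0" using Suc.prems(5)[of j] by simp
      qed
      then show ?thesis by (simp add: \<pi>'_def)
    qed
    also have "(\<forall>j<n. \<pi> j - 1 = n - 1 - j) \<longleftrightarrow> (\<forall>j<Suc n. \<pi> j = Suc n - 1 - j)"
    proof -
      have "\<pi> j - 1 = n - 1 - j \<longleftrightarrow> \<pi> j = n - j" if "j < n" for j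
      proof -
        have "\<pi> j \<noteq> 0" using inj_eq[OF permutes_inj[OF Suc.prems(1)], of j p] p True that by auto
        then show ?thesis using that by auto
      qed
      then show ?thesis using p True by (auto simp: less_Suc_eq)
    qed
    finally show ?thesis .
  qed
qed

text \<open>If \<open>F\<close> gives the coefficients of a polynomial, this gives those of its
  product with the monomial of exponent \<open>e\<close>.\<close>

definition exponent_shift :: "('a \<Rightarrow> nat) \<Rightarrow> (('a \<Rightarrow> nat) \<Rightarrow> bit) \<Rightarrow> ('a \<Rightarrow> nat) \<Rightarrow> bit" where
  "exponent_shift e F a = (if \<forall>p. e p \<le> a p then F (\<lambda>p. a p - e p) else 0)"

lemma exponent_shift_shift: "exponent_shift e (exponent_shift e' F) a = exponent_shift (\<lambda>p. e p + e' p) F a"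
proof -
  have "(\<forall>p. e p \<le> a p) \<and> (\<forall>p. e' p \<le> a p - e p) \<longleftrightarrow> (\<forall>p. e p + e' p \<le> a p)"
    by (auto simp: all_conj_distrib[symmetric] le_diff_conv2 add.commute intro: order_trans[OF le_add1])
      (metis add.commute add_leE le_diff_conv2)+
  then show ?thesis by (auto simp: exponent_shift_def)
qed

lemma exponent_shift_sum: "exponent_shift e (\<lambda>a. \<Sum>i\<in>A. F i a) a = (\<Sum>i\<in>A. exponent_shift e (F i) a)"
  by (cases "\<forall>p. e p \<le> a p") (simp_all only: exponent_shift_def if_True if_False sum.neutral_const simp_thms)

lemma exponent_shift_add: "exponent_shift e (\<lambda>a. F a + F' a) a = exponent_shift e F a + exponent_shift e F' a"
  by (simp add: exponent_shift_def)

lemma exponent_shift_single: "exponent_shift (\<lambda>q. if q = p then k else 0) F a = (if k \<le> a p then F (a(p := a p - k)) else 0)"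
proof -
  have "(\<lambda>q. a q - (if q = p then k else 0)) = a(p := a p - k)" by auto
  then show ?thesis by (auto simp: exponent_shift_def)
qed

text \<open>In characteristic 2 the square of \<open>x_p + x_q\<close> is
  \<open>x_p^2 + x_q^2\<close>.\<close>

lemma pair_coeff_square:
  assumes "p \<noteq> q"
  shows "pair_coeff ((p, q) # (p, q) # L) a = exponent_shift (\<lambda>r. if r = p then 2 else 0) (pair_coeff L) a + exponent_shift (\<lambda>r. if r = q then 2 else 0) (pair_coeff L) a"
  unfolding exponent_shift_single using assms by (auto simp: fun_upd_twist Suc_le_eq numeral_2_eq_2)

definition square_row :: "nat \<Rightarrow> nat \<Rightarrow> ((nat + nat) \<times> (nat + nat)) list" where
  "square_row k n = concat (map (\<lambda>i. [(Inl i, Inl n), (Inl i, Inl n)]) [0..<k])"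

text \<open>The exponent of the term of \<Prod>_{i<k} (x_i^2 + x_n^2) in which \<open>x_i^2\<close>
  is chosen for \<open>i\<close> in \<open>S\<close> and \<open>x_n^2\<close> otherwise.\<close>

definition row_exponent :: "nat \<Rightarrow> nat \<Rightarrow> nat set \<Rightarrow> nat + nat \<Rightarrow> nat" where
  "row_exponent k n S = case_sum (\<lambda>i. (if i \<in> S then 2 else 0) + (if i = n then 2 * (k - card S) else 0)) (\<lambda>_. 0)"

lemma pair_coeff_row:
  "k \<le> n \<Longrightarrow> pair_coeff (square_row k n @ L) a = (\<Sum>S\<in>Pow {..<k}. exponent_shift (row_exponent k n S) (pair_coeff L) a)"
proof (induction k arbitrary: L)
  case 0
  have "row_exponent 0 n {} = (\<lambda>_. 0)" by (auto simp: row_exponent_def fun_eq_iff split: sum.split)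
  then show ?case by (simp add: square_row_def exponent_shift_def)
next
  case (Suc k)
  let ?s = "\<lambda>i::nat. \<lambda>r::nat + nat. if r = Inl i then 2 else (0::nat)"
  have square_row: "square_row (Suc k) n = square_row k n @ [(Inl k, Inl n), (Inl k, Inl n)]" by (simp add: square_row_def)
  have "pair_coeff (square_row (Suc k) n @ L) a = (\<Sum>S\<in>Pow {..<k}. exponent_shift (row_exponent k n S) (pair_coeff ((Inl k, Inl n) # (Inl k, Inl n) # L)) a)"
    unfolding square_row using Suc by simp
  also have "\<dots> = (\<Sum>S\<in>Pow {..<k}. exponent_shift (row_exponent k n S) (\<lambda>a. exponent_shift (?s k) (pair_coeff L) a + exponent_shift (?s n) (pair_coeff L) a) a)"
  proof -
    have "pair_coeff ((Inl k, Inl n) # (Inl k, Inl n) # L) = (\<lambda>a. exponent_shift (?s k) (pair_coeff L) a + exponent_shift (?s n) (pair_coeff L) a)"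
      by (rule ext, rule pair_coeff_square) (use Suc.prems in simp)
    then show ?thesis by simp
  qed
  also have "\<dots> = (\<Sum>S\<in>Pow {..<k}. exponent_shift (row_exponent (Suc k) n (insert k S)) (pair_coeff L) a + exponent_shift (row_exponent (Suc k) n S) (pair_coeff L) a)"
  proof (rule sum.cong[OF refl])
    fix S assume S: "S \<in> Pow {..<k}"
    then have fin: "finite S" and k: "k \<notin> S" by (auto intro: finite_subset)
    have "card S \<le> k" using card_mono[of "{..<k}" S] S by auto
    then have "(\<lambda>p. row_exponent k n S p + ?s k p) = row_exponent (Suc k) n (insert k S)" "(\<lambda>p. row_exponent k n S p + ?s n p) = row_exponent (Suc k) n S"
      using Suc.prems fin k by (auto simp: row_exponent_def fun_eq_iff Suc_diff_le split: sum.split)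
    then show "exponent_shift (row_exponent k n S) (\<lambda>a. exponent_shift (?s k) (pair_coeff L) a + exponent_shift (?s n) (pair_coeff L) a) a =
      exponent_shift (row_exponent (Suc k) n (insert k S)) (pair_coeff L) a + exponent_shift (row_exponent (Suc k) n S) (pair_coeff L) a"
      by (simp add: exponent_shift_add exponent_shift_shift)
  qed
  also have "\<dots> = (\<Sum>S\<in>Pow {..<Suc k}. exponent_shift (row_exponent (Suc k) n S) (pair_coeff L) a)"
  proof -
    have "Pow {..<Suc k} = Pow {..<k} \<union> insert k ` Pow {..<k}" by (simp add: lessThan_Suc Pow_insert)
    moreover have "Pow {..<k} \<inter> insert k ` Pow {..<k} = {}" by auto
    moreover have "inj_on (insert k) (Pow {..<k})" by (rule inj_onI) (auto dest: insert_ident[THEN iffD1, rotated 2])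
    ultimately show ?thesis by (simp add: sum.union_disjoint sum.reindex sum.distrib add.commute)
  qed
  finally show ?case .
qed

lemma sum_involution:
  fixes g :: "'a \<Rightarrow> bit"
  assumes "finite A" "\<And>x. x \<in> A \<Longrightarrow> \<tau> x \<in> A \<and> \<tau> (\<tau> x) = x \<and> \<tau> x \<noteq> x \<and> g (\<tau> x) = g x"
  shows "sum g A = 0"
  using assms
proof (induction "card A" arbitrary: A rule: less_induct)
  case less
  show ?case
  proof (cases "A = {}")
    case False
    then obtain x where x: "x \<in> A" by blast
    note tx = less.prems(2)[OF x]
    let ?B = "A - {x, \<tau> x}"
    have "sum g ?B = 0"
    proof (rule less.hyps)
      show "card ?B < card A" using x less.prems(1) by (intro psubset_card_mono) auto
      fix y assume "y \<in> ?B"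
      then show "\<tau> y \<in> ?B \<and> \<tau> (\<tau> y) = y \<and> \<tau> y \<noteq> y \<and> g (\<tau> y) = g y"
        using less.prems(2)[of y] tx by auto
    qed (use less.prems(1) in auto)
    moreover have "sum g A = sum g ?B + sum g {x, \<tau> x}"
      using x tx less.prems(1) by (intro sum.subset_diff) auto
    moreover have "sum g {x, \<tau> x} = 0" using tx by (subst sum.insert) auto
    ultimately show ?thesis by simp
  qed simp
qed

abbreviation "perms n \<equiv> {\<pi>. \<pi> permutes {..<n::nat}}"

text \<open>Induction step for \<open>\<Prod>\<^sub>i\<^sub><\<^sub>j (z\<^sub>i + z\<^sub>j) = \<Sum>\<^sub>\<sigma> \<Prod>\<^sub>i z\<^sub>i\<^bsup>\<sigma> i\<^esup>\<close> modulo 2, with \<open>S\<close> the set of \<open>i\<close> such that \<open>z\<^sub>i\<close> is chosen from \<open>z\<^sub>i + z\<^sub>n\<close>.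
With \<open>V = \<pi> ` S\<close> fixed, exchanging the values \<open>m \<in> V\<close> and \<open>m + 1 \<notin> V\<close> cancels the terms in pairs, unless \<open>V\<close> is a final segment.\<close>

lemma vandermonde_step:
  fixes G :: "(nat \<Rightarrow> nat) \<Rightarrow> bit"
  assumes G: "\<And>e e'. (\<And>i. i \<le> n \<Longrightarrow> e i = e' i) \<Longrightarrow> G e = G e'"
  shows "(\<Sum>S\<in>Pow {..<n}. \<Sum>\<pi>\<in>perms n. G (\<lambda>i. if i < n then \<pi> i + of_bool (i \<in> S) else n - card S)) = sum G (perms (Suc n))"
proof -
  define H where "H V \<pi> = G (\<lambda>i. if i < n then \<pi> i + of_bool (\<pi> i \<in> V) else n - card V)" for V :: "nat set" and \<pi> :: "nat \<Rightarrow> nat"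
  have finP: "finite (perms k)" for k by (simp add: finite_permutations)
  have "(\<Sum>S\<in>Pow {..<n}. \<Sum>\<pi>\<in>perms n. G (\<lambda>i. if i < n then \<pi> i + of_bool (i \<in> S) else n - card S))
      = (\<Sum>\<pi>\<in>perms n. \<Sum>S\<in>Pow {..<n}. G (\<lambda>i. if i < n then \<pi> i + of_bool (i \<in> S) else n - card S))"
    by (rule sum.swap)
  also have "\<dots> = (\<Sum>\<pi>\<in>perms n. \<Sum>V\<in>Pow {..<n}. H V \<pi>)"
  proof (rule sum.cong[OF refl])
    fix \<pi> assume "\<pi> \<in> perms n"
    then have \<pi>: "\<pi> permutes {..<n}" by simp
    have inj: "inj \<pi>" by (rule permutes_inj[OF \<pi>])
    have bij: "bij_betw ((`) \<pi>) (Pow {..<n}) (Pow {..<n})"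
      using permutes_imp_bij[OF \<pi>] by (rule bij_betw_Pow)
    have "(\<Sum>V\<in>Pow {..<n}. H V \<pi>) = (\<Sum>S\<in>Pow {..<n}. H (\<pi> ` S) \<pi>)"
      using sum.reindex_bij_betw[OF bij, of "\<lambda>V. H V \<pi>"] by simp
    also have "\<dots> = (\<Sum>S\<in>Pow {..<n}. G (\<lambda>i. if i < n then \<pi> i + of_bool (i \<in> S) else n - card S))"
      by (simp add: H_def inj_image_mem_iff[OF inj] card_image[OF inj_on_subset[OF inj]] cong: if_cong)
    finally show "(\<Sum>S\<in>Pow {..<n}. G (\<lambda>i. if i < n then \<pi> i + of_bool (i \<in> S) else n - card S)) = (\<Sum>V\<in>Pow {..<n}. H V \<pi>)" ..
  qed
  also have "\<dots> = (\<Sum>V\<in>Pow {..<n}. \<Sum>\<pi>\<in>perms n. H V \<pi>)" by (rule sum.swap)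
  also have "\<dots> = (\<Sum>V\<in>(\<lambda>m. {m..<n}) ` {..n}. \<Sum>\<pi>\<in>perms n. H V \<pi>)"
  proof (rule sum.mono_neutral_right)
    show "\<forall>V\<in>Pow {..<n} - (\<lambda>m. {m..<n}) ` {..n}. (\<Sum>\<pi>\<in>perms n. H V \<pi>) = 0"
    proof
      fix V assume V: "V \<in> Pow {..<n} - (\<lambda>m. {m..<n}) ` {..n}"
      have "\<exists>m. m \<in> V \<and> Suc m < n \<and> Suc m \<notin> V"
      proof (rule ccontr)
        assume no: "\<not> ?thesis"
        show False
        proof (cases "V = {}")
          case True then show False using V by (force simp: image_iff)
        next
          case False
          define m where "m = (LEAST m. m \<in> V)"
          have m: "m \<in> V" "\<And>k. k \<in> V \<Longrightarrow> m \<le> k" using False LeastI_ex[of "\<lambda>m. m \<in> V"] by (auto simp: m_def intro: Least_le)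
          have up: "m + k < n \<Longrightarrow> m + k \<in> V" for k by (induction k) (use m no in auto)
          have "V = {m..<n}"
          proof (intro equalityI subsetI)
            fix k assume "k \<in> {m..<n}" then show "k \<in> V" using up[of "k - m"] by auto
          qed (use V m in auto)
          moreover have "m \<le> n" using m V by auto
          ultimately show False using V by auto
        qed
      qed
      then obtain m where m: "m \<in> V" "Suc m < n" "Suc m \<notin> V" by blast
      let ?t = "Transposition.transpose m (Suc m)"
      have t: "?t permutes {..<n}" using m by (intro permutes_swap_id) auto
      show "(\<Sum>\<pi>\<in>perms n. H V \<pi>) = 0"
      proof (rule sum_involution[where \<tau> = "\<lambda>\<pi>. ?t \<circ> \<pi>"])
        fix \<pi> assume "\<pi> \<in> perms n"
        then have \<pi>: "\<pi> permutes {..<n}" by simp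
        have 1: "?t \<circ> \<pi> \<in> perms n" using permutes_compose[OF \<pi> t] by simp
        have 2: "?t \<circ> (?t \<circ> \<pi>) = \<pi>" by (simp add: fun_eq_iff)
        have 3: "?t \<circ> \<pi> \<noteq> \<pi>"
        proof
          assume eq: "?t \<circ> \<pi> = \<pi>"
          obtain i where "\<pi> i = m" using permutes_surj[OF \<pi>] by (metis surjD)
          then show False using fun_cong[OF eq, of i] by simp
        qed
        \<comment> \<open>The value \<open>m\<close> in \<open>V\<close> and the value
          \<open>Suc m\<close> outside \<open>V\<close> both yield the exponent
          \<open>Suc m\<close>, so exchanging them leaves all exponents unchanged.\<close>
        have "?t k + of_bool (?t k \<in> V) = k + of_bool (k \<in> V)" for k
          using m by (cases "k = m"; cases "k = Suc m") (auto simp: Transposition.transpose_def)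
        then have 4: "H V (?t \<circ> \<pi>) = H V \<pi>" by (simp only: H_def comp_apply)
        show "?t \<circ> \<pi> \<in> perms n \<and> ?t \<circ> (?t \<circ> \<pi>) = \<pi> \<and> ?t \<circ> \<pi> \<noteq> \<pi> \<and> H V (?t \<circ> \<pi>) = H V \<pi>"
          using 1 2 3 4 by blast
      qed (rule finP)
    qed
  qed auto
  also have "\<dots> = (\<Sum>m\<le>n. \<Sum>\<pi>\<in>perms n. H {m..<n} \<pi>)"
  proof (subst sum.reindex)
    show "inj_on (\<lambda>m. {m..<n}) {..n}"
    proof (rule inj_onI)
      fix x y assume "x \<in> {..n}" "y \<in> {..n}" "{x..<n} = {y..<n}"
      then have "card {x..<n} = card {y..<n}" "x \<le> n" "y \<le> n" by auto
      then show "x = y" by simp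
    qed
  qed (simp add: atMost_def lessThan_def)
  also have "\<dots> = (\<Sum>(m, \<pi>)\<in>{..n} \<times> perms n. H {m..<n} \<pi>)" by (rule sum.cartesian_product)
  also have "\<dots> = sum G (perms (Suc n))"
  proof -
    \<comment> \<open>A permutation of \<open>n + 1\<close> numbers is given by its value
      \<open>m\<close> at \<open>n\<close> and the order of the others: the values from
      \<open>m\<close> on move up to make room. The final segment from \<open>m\<close> has
      \<open>n - m\<close> elements, so \<open>H\<close> also puts the exponent \<open>m\<close> at
      \<open>n\<close>.\<close>
    define \<Phi> where "\<Phi> = (\<lambda>(m, \<pi>) i. if i < n then \<pi> i + of_bool (m \<le> \<pi> i) else if i = n then m else i)"
    have inj: "inj_on \<Phi> ({..n} \<times> perms n)"
    proof (rule inj_onI, clarify)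
      fix m \<pi> m' \<pi>' assume *: "\<pi> permutes {..<n}" "\<pi>' permutes {..<n}" "\<Phi> (m, \<pi>) = \<Phi> (m', \<pi>')"
      have m: "m = m'" using fun_cong[OF *(3), of n] by (simp add: \<Phi>_def)
      have "\<pi> i = \<pi>' i" for i
      proof (cases "i < n")
        case True
        then have "\<pi> i + of_bool (m \<le> \<pi> i) = \<pi>' i + of_bool (m \<le> \<pi>' i)"
          using fun_cong[OF *(3), of i] m by (simp add: \<Phi>_def)
        then show ?thesis by (cases "m \<le> \<pi> i"; cases "m \<le> \<pi>' i") auto
      next
        case False
        then show ?thesis using *(1,2) by (simp add: permutes_def)
      qed
      then show "m = m' \<and> \<pi> = \<pi>'" using m by auto
    qed
    have sub: "\<Phi> ` ({..n} \<times> perms n) \<subseteq> perms (Suc n)"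
    proof (clarify, simp)
      fix m \<pi> assume *: "m \<le> n" "\<pi> permutes {..<n}"
      have lt: "\<pi> i < n" if "i < n" for i using permutes_in_image[OF *(2), of i] that by simp
      have "inj_on (\<Phi> (m, \<pi>)) {..<Suc n}"
      proof (rule inj_onI)
        fix i j assume ij: "i \<in> {..<Suc n}" "j \<in> {..<Suc n}" "\<Phi> (m, \<pi>) i = \<Phi> (m, \<pi>) j"
        show "i = j"
          using ij inj_eq[OF permutes_inj[OF *(2)], of i j]
          by (cases "i < n"; cases "j < n"; cases "m \<le> \<pi> i"; cases "m \<le> \<pi> j") (auto simp: \<Phi>_def)
      qed
      moreover have "\<Phi> (m, \<pi>) ` {..<Suc n} \<subseteq> {..<Suc n}"
        using *(1) lt by (fastforce simp: \<Phi>_def less_Suc_eq)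
      ultimately have "bij_betw (\<Phi> (m, \<pi>)) {..<Suc n} {..<Suc n}" by (simp add: bij_betw_def endo_inj_surj)
      then show "\<Phi> (m, \<pi>) permutes {..<Suc n}" by (rule bij_imp_permutes) (simp add: \<Phi>_def)
    qed
    \<comment> \<open>Surjectivity of \<open>\<Phi>\<close> by counting: both sides have (n + 1)!
      elements.\<close>
    have "card (perms (Suc n)) = card (\<Phi> ` ({..n} \<times> perms n))"
      by (simp add: card_image[OF inj] card_cartesian_product card_permutations)
    then have "perms (Suc n) = \<Phi> ` ({..n} \<times> perms n)" using card_subset_eq[OF finP sub] by simp
    then have "sum G (perms (Suc n)) = (\<Sum>x\<in>{..n} \<times> perms n. G (\<Phi> x))" by (simp add: sum.reindex[OF inj])
    also have "\<dots> = (\<Sum>(m, \<pi>)\<in>{..n} \<times> perms n. H {m..<n} \<pi>)"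
    proof (rule sum.cong[OF refl])
      fix x assume "x \<in> {..n} \<times> perms n"
      then obtain m \<pi> where *: "m \<le> n" "\<pi> permutes {..<n}" and x: "x = (m, \<pi>)" by auto
      have lt: "\<pi> i < n" if "i < n" for i using permutes_in_image[OF *(2), of i] that by simp
      have "G (\<Phi> (m, \<pi>)) = H {m..<n} \<pi>"
        unfolding H_def by (rule G) (use * lt in \<open>auto simp: \<Phi>_def\<close>)
      then show "G (\<Phi> x) = (case x of (m, \<pi>) \<Rightarrow> H {m..<n} \<pi>)" by (simp add: x)
    qed
    finally show ?thesis ..
  qed
  finally show ?thesis .
qed

fun square_pairs :: "nat \<Rightarrow> ((nat + nat) \<times> (nat + nat)) list" where
  "square_pairs 0 = []"
| "square_pairs (Suc n) = square_row n n @ square_pairs n"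

definition doubled :: "nat \<Rightarrow> (nat \<Rightarrow> nat) \<Rightarrow> nat + nat \<Rightarrow> nat" where
  "doubled n e = case_sum (\<lambda>i. if i < n then 2 * e i else 0) (\<lambda>_. 0)"

text \<open>The Vandermonde determinant in the variables \<open>x_i^2\<close>, whose signs disappear
  modulo 2.\<close>

lemma pair_coeff_square_pairs: "pair_coeff (square_pairs n @ L) a = (\<Sum>\<pi>\<in>perms n. exponent_shift (doubled n \<pi>) (pair_coeff L) a)"
proof (induction n arbitrary: a)
  case 0
  have "perms 0 = {id}" by (auto simp: permutes_empty)
  moreover have "doubled 0 e = (\<lambda>_. 0)" for e by (auto simp: doubled_def fun_eq_iff split: sum.split)
  ultimately show ?case by (simp add: exponent_shift_def)
next
  case (Suc n)
  define G where "G e = exponent_shift (doubled (Suc n) e) (pair_coeff L) a" for e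
  have "pair_coeff (square_pairs (Suc n) @ L) a = (\<Sum>S\<in>Pow {..<n}. exponent_shift (row_exponent n n S) (pair_coeff (square_pairs n @ L)) a)"
    using pair_coeff_row[of n n "square_pairs n @ L" a] by simp
  also have "\<dots> = (\<Sum>S\<in>Pow {..<n}. \<Sum>\<pi>\<in>perms n. exponent_shift (\<lambda>p. row_exponent n n S p + doubled n \<pi> p) (pair_coeff L) a)"
    by (simp add: Suc.IH[abs_def] exponent_shift_sum exponent_shift_shift)
  also have "\<dots> = (\<Sum>S\<in>Pow {..<n}. \<Sum>\<pi>\<in>perms n. G (\<lambda>i. if i < n then \<pi> i + of_bool (i \<in> S) else n - card S))"
  proof (intro sum.cong refl)
    fix S \<pi> assume "S \<in> Pow {..<n}"
    then have "(\<lambda>p. row_exponent n n S p + doubled n \<pi> p) = doubled (Suc n) (\<lambda>i. if i < n then \<pi> i + of_bool (i \<in> S) else n - card S)"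
      by (auto simp: row_exponent_def doubled_def fun_eq_iff split: sum.split)
    then show "exponent_shift (\<lambda>p. row_exponent n n S p + doubled n \<pi> p) (pair_coeff L) a = G (\<lambda>i. if i < n then \<pi> i + of_bool (i \<in> S) else n - card S)"
      by (simp add: G_def)
  qed
  also have "\<dots> = sum G (perms (Suc n))"
  proof (rule vandermonde_step)
    fix e e' :: "nat \<Rightarrow> nat" assume "\<And>i. i \<le> n \<Longrightarrow> e i = e' i"
    then have "doubled (Suc n) e = doubled (Suc n) e'" by (auto simp: doubled_def fun_eq_iff split: sum.split)
    then show "G e = G e'" by (simp add: G_def)
  qed
  finally show ?case by (simp add: G_def)
qed

text \<open>Only the reversal contributes: it takes \<open>2 * (n - 1 - j)\<close> from the exponent
  of \<open>x_j\<close> and leaves \<open>j + 1\<close> for the grid, where the coefficient is 1 by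
  \<open>pair_coeff_grid\<close>.\<close>

lemma pair_coeff_square_grid:
  "pair_coeff (square_pairs n @ grid_pairs n) (case_sum (\<lambda>j. if j < n then 2 * n - 1 - j else 0) (\<lambda>k. if k < n then k else 0)) = 1"
proof -
  let ?a = "case_sum (\<lambda>j. if j < n then 2 * n - 1 - j else 0) (\<lambda>k. if k < n then k else 0) :: nat + nat \<Rightarrow> nat"
  define r where "r j = (if j < n then n - 1 - j else j)" for j
  have "inj_on r {..<n}" by (rule inj_onI) (auto simp: r_def)
  moreover have "r ` {..<n} \<subseteq> {..<n}" by (auto simp: r_def)
  ultimately have "bij_betw r {..<n} {..<n}" by (simp add: bij_betw_def endo_inj_surj)
  then have r: "r permutes {..<n}" by (rule bij_imp_permutes) (simp add: r_def)
  have "exponent_shift (doubled n \<pi>) (pair_coeff (grid_pairs n)) ?a = (if \<pi> = r then 1 else 0)" if "\<pi> \<in> perms n" for \<pi>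
  proof -
    have \<pi>: "\<pi> permutes {..<n}" using that by simp
    have eq: "\<pi> = r \<longleftrightarrow> (\<forall>j<n. \<pi> j = n - 1 - j)"
    proof
      assume *: "\<forall>j<n. \<pi> j = n - 1 - j"
      show "\<pi> = r"
      proof
        fix j show "\<pi> j = r j" using * \<pi> by (cases "j < n") (auto simp: r_def permutes_def)
      qed
    qed (simp add: r_def)
    show ?thesis
    proof (cases "\<forall>p. doubled n \<pi> p \<le> ?a p")
      case True
      have "pair_coeff (grid_pairs n) (\<lambda>p. ?a p - doubled n \<pi> p) = of_bool (\<forall>j<n. \<pi> j = n - 1 - j)"
      proof (rule pair_coeff_grid[OF \<pi>])
        fix j assume "j < n"
        then show "?a (Inl j) - doubled n \<pi> (Inl j) + 2 * \<pi> j = 2 * n - 1 - j"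
          using True[rule_format, of "Inl j"] by (simp add: doubled_def)
      qed (auto simp: doubled_def)
      then show ?thesis using True eq by (simp add: exponent_shift_def)
    next
      case False
      then obtain p where p: "\<not> doubled n \<pi> p \<le> ?a p" by blast
      have "\<pi> \<noteq> r"
      proof
        assume "\<pi> = r"
        then show False using p by (cases p) (auto simp: doubled_def r_def split: if_splits)
      qed
      then show ?thesis using False by (simp only: exponent_shift_def if_False)
    qed
  qed
  then have "pair_coeff (square_pairs n @ grid_pairs n) ?a = (\<Sum>\<pi>\<in>perms n. if \<pi> = r then 1 else 0)"
    unfolding pair_coeff_square_pairs by (intro sum.cong) auto
  also have "\<dots> = 1" using r by (simp add: finite_permutations sum.delta)
  finally show ?thesis .
qed

text \<open>Variables named by numbers permit an induction on \<open>n\<close>, whereas the spheres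
  are indexed by a fixed finite type; \<open>v\<close> translates. The condition on the sum of
  \<open>a\<close> makes the two values for the empty list agree.\<close>

lemma character_coeff_pair_coeff:
  fixes v :: "'a \<Rightarrow> 'i::finite"
  assumes "inj_on v U" "\<And>p q. (p, q) \<in> set L \<Longrightarrow> p \<in> U \<and> q \<in> U \<and> p \<noteq> q"
    "\<And>p. p \<in> U \<Longrightarrow> c p = a (v p)" "\<And>p. p \<notin> U \<Longrightarrow> c p = 0" "sum a UNIV = length L"
  shows "character_coeff (map (\<lambda>(p, q) i. i = v p \<or> i = v q) L) a = pair_coeff L c"
  using assms(2-)
proof (induction L arbitrary: a c)
  case Nil
  then have "c p = 0" for p by (cases "p \<in> U") auto
  then show ?case by simp
next
  case (Cons pq L)
  obtain p q where pq: "pq = (p, q)" by (cases pq)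
  have U: "p \<in> U" "q \<in> U" "p \<noteq> q" using Cons.prems(1) pq by auto
  then have vn: "v p \<noteq> v q" using assms(1) by (auto dest: inj_onD)
  let ?M = "map (\<lambda>(p, q) i. i = v p \<or> i = v q) L"
  have step: "character_coeff ?M (a(v r := a (v r) - 1)) = pair_coeff L (c(r := c r - 1))" if r: "r \<in> U" "a (v r) \<noteq> 0" for r
  proof (rule Cons.IH)
    show "sum (a(v r := a (v r) - 1)) UNIV = length L" using sum_fun_upd_decrement[of a "v r"] r(2) Cons.prems(4) by simp
    show "(c(r := c r - 1)) s = (a(v r := a (v r) - 1)) (v s)" if "s \<in> U" for s
      using that r Cons.prems(2) assms(1) by (auto dest: inj_onD)
    show "(c(r := c r - 1)) s = 0" if "s \<notin> U" for s using that r Cons.prems(3) by auto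
  qed (use Cons.prems(1) in auto)
  have "character_coeff (map (\<lambda>(p, q) i. i = v p \<or> i = v q) (pq # L)) a
    = (\<Sum>i\<in>{v p, v q}. if a i \<noteq> 0 then character_coeff ?M (a(i := a i - 1)) else 0)"
    by (simp only: list.map pq prod.case character_coeff.simps) (rule sum.mono_neutral_cong_right; auto)
  also have "\<dots> = pair_coeff (pq # L) c"
    using vn step[of p] step[of q] U Cons.prems(2) by (simp add: pq)
  finally show ?case .
qed

section \<open>Trivialisations over categorical sets\<close>

text \<open>This and \<open>grid_list\<close> enumerate in the order of \<open>square_pairs\<close>
  and \<open>grid_pairs\<close> but with arbitrary entries, so that test functions and their
  parities match position by position.\<close>

fun triangle_list :: "(nat \<Rightarrow> nat \<Rightarrow> 'b) \<Rightarrow> (nat \<Rightarrow> nat \<Rightarrow> 'b) \<Rightarrow> nat \<Rightarrow> 'b list" where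
  "triangle_list r s 0 = []"
| "triangle_list r s (Suc n) = concat (map (\<lambda>i. [r i n, s i n]) [0..<n]) @ triangle_list r s n"

fun grid_list :: "(nat \<Rightarrow> nat \<Rightarrow> 'b) \<Rightarrow> nat \<Rightarrow> 'b list" where
  "grid_list g 0 = []"
| "grid_list g (Suc n) = map (\<lambda>k. g n k) [0..<Suc n] @ map (\<lambda>j. g j n) [0..<n] @ grid_list g n"

lemma square_pairs_eq: "square_pairs n = triangle_list (\<lambda>i m. (Inl i, Inl m)) (\<lambda>i m. (Inl i, Inl m)) n"
  by (induction n) (simp_all add: square_row_def)

lemma square_pairs_bound: "(p, q) \<in> set (square_pairs n) \<Longrightarrow> \<exists>i m. i < m \<and> m < n \<and> p = Inl i \<and> q = Inl m"
  by (induction n) (auto simp: square_row_def less_Suc_eq)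

lemma grid_pairs_eq: "grid_pairs n = grid_list (\<lambda>j k. (Inl j, Inr k)) n"
  by (induction n) simp_all

lemma map_triangle_list: "map f (triangle_list r s n) = triangle_list (\<lambda>i m. f (r i m)) (\<lambda>i m. f (s i m)) n"
  by (induction n) (simp_all add: map_concat comp_def)

lemma map_grid_list: "map f (grid_list g n) = grid_list (\<lambda>j k. f (g j k)) n"
  by (induction n) (simp_all add: comp_def)

lemma list_all2_triangle_list:
  assumes "\<And>i m. i < m \<Longrightarrow> m < n \<Longrightarrow> P (r i m) (r' i m) \<and> P (s i m) (s' i m)"
  shows "list_all2 P (triangle_list r s n) (triangle_list r' s' n)"
  using assms
proof (induction n)
  case (Suc n)
  have "list_all2 P (concat (map (\<lambda>i. [r i n, s i n]) [0..<k])) (concat (map (\<lambda>i. [r' i n, s' i n]) [0..<k]))" if "k \<le> n" for k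
    using that by (induction k) (use Suc.prems in \<open>auto intro!: list_all2_appendI\<close>)
  then show ?case using Suc by (auto intro!: list_all2_appendI)
qed simp

lemma list_all2_grid_list:
  assumes "\<And>j k. j < n \<Longrightarrow> k < n \<Longrightarrow> P (g j k) (g' j k)"
  shows "list_all2 P (grid_list g n) (grid_list g' n)"
  using assms
proof (induction n)
  case (Suc n)
  have "list_all2 P (map (\<lambda>k. g n k) [0..<Suc n]) (map (\<lambda>k. g' n k) [0..<Suc n])"
    "list_all2 P (map (\<lambda>k. g k n) [0..<n]) (map (\<lambda>k. g' k n) [0..<n])"
    using Suc.prems by (auto simp: list_all2_conv_all_nth simp del: upt_Suc)
  then show ?case using Suc unfolding grid_list.simps by (intro list_all2_appendI) auto
qed simp

lemma set_triangle_list: "i < m \<Longrightarrow> m < n \<Longrightarrow> r i m \<in> set (triangle_list r s n) \<and> s i m \<in> set (triangle_list r s n)"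
  by (induction n) (auto simp: less_Suc_eq)

lemma set_grid_list: "j < n \<Longrightarrow> k < n \<Longrightarrow> g j k \<in> set (grid_list g n)"
  by (induction n) (auto simp: less_Suc_eq)

lemma length_triangle_list: "length (triangle_list r s n) = n * (n - 1)"
proof (induction n)
  case (Suc n)
  have "length (concat (map (\<lambda>i. [r i n, s i n]) [0..<k])) = 2 * k" for k by (induction k) auto
  then show ?case using Suc by (cases n) auto
qed simp

lemma length_grid_list: "length (grid_list g n) = n * n"
  by (induction n) auto

definition negate_column :: "'n::finite \<Rightarrow> 'a::ab_group_add ^ 'n ^ 'm \<Rightarrow> 'a ^ 'n ^ 'm" where
  "negate_column j A = (\<chi> r c. if c = j then - A $ r $ c else A $ r $ c)"

lemma no_equivariant_frames:
  fixes G :: "'n::finite \<Rightarrow> complex ^ 'n ^ 'n \<Rightarrow> real ^ 'n ^ 'n"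
  assumes cont: "\<And>k. continuous_on UNIV (G k)"
    and equi: "\<And>k j A. G k (negate_column j A) = negate_column j (G k A)"
    and inv: "\<And>A. A \<in> unitary_matrices \<Longrightarrow> \<exists>k. invertible (G k A)"
  shows False
proof -
  define n where "n = CARD('n)"
  have n: "0 < n" by (simp add: n_def)
  obtain w :: "nat \<Rightarrow> 'n" where w: "bij_betw w {0..<n} UNIV"
    using ex_bij_betw_nat_finite[of "UNIV :: 'n set"] unfolding n_def by auto
  define rk where "rk = inv_into {0..<n} w"
  have rk: "rk c < n" "w (rk c) = c" for c
    using bij_betw_inv_into[OF w] w bij_betw_inv_into_right[OF w, of c] unfolding rk_def bij_betw_def by auto
  have rkw: "rk (w i) = i" if "i < n" for i
    using bij_betw_inv_into_left[OF w, of i] that unfolding rk_def by simp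
  have bijrk: "bij_betw rk UNIV {0..<n}" unfolding rk_def by (rule bij_betw_inv_into[OF w])
  define D where "D = DIM(complex ^ 'n)"
  have D: "D = 2 * n" by (simp add: D_def n_def)
  obtain b :: "nat \<Rightarrow> complex ^ 'n" where bb: "bij_betw b {0..<D} Basis"
    using ex_bij_betw_nat_finite[of "Basis :: (complex ^ 'n) set"] unfolding D_def by auto
  have orthonormal_upto: "orthonormal_upto b D"
    unfolding orthonormal_upto_def
  proof (intro allI impI)
    fix i j assume ij: "i < D" "j < D"
    then have "b i \<in> Basis" "b j \<in> Basis" using bb by (auto simp: bij_betw_def)
    moreover have "b i = b j \<longleftrightarrow> i = j" using bb ij by (auto simp: bij_betw_def inj_on_def)
    ultimately show "b i \<bullet> b j = (if i = j then 1 else 0)" by (simp add: inner_Basis)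
  qed
  \<comment> \<open>The numbering \<open>rk\<close> breaks the symmetry between the indices. The
    vectors \<open>v_k\<close> are placed in complex space too, because all factors of a sphere
    product share one type.\<close>
  define d :: "'n + 'n \<Rightarrow> nat" where "d = case_sum (\<lambda>j. 2 * n - 1 - rk j) rk"
  have dD: "d i < D" for i using n D rk(1) by (cases i) (auto simp: d_def intro: less_le_trans[OF rk(1)])
  have sumd: "sum d UNIV = n * (n - 1) + n * n"
  proof -
    have "sum d UNIV = (\<Sum>j\<in>UNIV. 2 * n - 1 - rk j) + (\<Sum>j\<in>UNIV. rk j)"
      by (simp add: d_def UNIV_Plus_UNIV[symmetric] sum.Plus del: UNIV_Plus_UNIV)
    also have "\<dots> = (\<Sum>j\<in>(UNIV :: 'n set). 2 * n - 1)"
      unfolding sum.distrib[symmetric]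
    proof (intro sum.cong refl)
      fix x show "2 * n - 1 - rk x + rk x = 2 * n - 1" using rk(1)[of x] by linarith
    qed
    also have "\<dots> = n * (2 * n - 1)" by (simp add: n_def)
    finally show ?thesis by (cases n) (auto simp: algebra_simps)
  qed
  define Am where "Am y = (\<chi> r c. y $ Inl c $ r)" for y :: "(complex ^ 'n) ^ ('n + 'n)"
  define h where "h i m y = (\<Sum>r\<in>UNIV. cnj (y $ Inl (w i) $ r) * y $ Inl (w m) $ r)" for i m and y :: "(complex ^ 'n) ^ ('n + 'n)"
  \<comment> \<open>Entry \<open>j\<close> of the row vector \<open>v_k\<close> times
    \<open>G_k\<close>. Since \<open>v_k\<close> lies in the span of
    \<open>b 0, ..., b (n - 1)\<close>, its coordinates can be indexed by \<open>'n\<close> through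
    \<open>rk\<close>.\<close>
  define g where "g j k y = (\<Sum>c\<in>UNIV. (y $ Inr (w k) \<bullet> b (rk c)) * G (w k) (Am y) $ c $ w j)" for j k and y :: "(complex ^ 'n) ^ ('n + 'n)"
  define fs where "fs = triangle_list (\<lambda>i m y. Re (h i m y)) (\<lambda>i m y. Im (h i m y)) n @ grid_list g n"
  define v :: "nat + nat \<Rightarrow> 'n + 'n" where "v = map_sum w w"
  define Xs where "Xs = map (\<lambda>(p, q) i. i = v p \<or> i = v q) (square_pairs n @ grid_pairs n)"
  have Xs: "Xs = triangle_list (\<lambda>i m a. a = Inl (w i) \<or> a = Inl (w m)) (\<lambda>i m a. a = Inl (w i) \<or> a = Inl (w m)) n
     @ grid_list (\<lambda>j k a. a = Inl (w j) \<or> a = Inr (w k)) n"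
    by (simp add: Xs_def square_pairs_eq grid_pairs_eq map_triangle_list map_grid_list v_def)
  define U where "U = Inl ` {..<n} \<union> Inr ` {..<n}"
  have winj: "w i = w j \<longleftrightarrow> i = j" if "i < n" "j < n" for i j using rkw that by metis
  have character_coeff: "character_coeff Xs d = 1"
  proof -
    have "character_coeff Xs d = pair_coeff (square_pairs n @ grid_pairs n) (case_sum (\<lambda>j. if j < n then 2 * n - 1 - j else 0) (\<lambda>k. if k < n then k else 0))"
      unfolding Xs_def
    proof (rule character_coeff_pair_coeff[where U = U])
      show "inj_on v U" by (rule inj_onI) (auto simp: U_def v_def winj)
      show "p \<in> U \<and> q \<in> U \<and> p \<noteq> q" if pq: "(p, q) \<in> set (square_pairs n @ grid_pairs n)" for p q
      proof (cases "(p, q) \<in> set (square_pairs n)")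
        case True
        then show ?thesis using square_pairs_bound[OF True] by (auto simp: U_def)
      next
        case False
        then have "(p, q) \<in> set (grid_pairs n)" using pq by simp
        from grid_pairs_bound[OF this] show ?thesis by (auto simp: U_def)
      qed
      show "sum d UNIV = length (square_pairs n @ grid_pairs n)" by (simp add: sumd square_pairs_eq grid_pairs_eq length_triangle_list length_grid_list)
    qed (auto simp: U_def v_def d_def rkw split: sum.splits)
    then show ?thesis by (simp add: pair_coeff_square_grid)
  qed
  have Am_flip: "Am (flip (Inl c) y) = negate_column c (Am y)" "Am (flip (Inr k) y) = Am y" for c k y
    by (auto simp: Am_def flip_def negate_column_def vec_eq_iff)
  have contAm: "continuous_on S Am" for S
    unfolding Am_def by (intro continuous_on_vec_lambda continuous_intros)
  have all2: "list_all2 (\<lambda>f X. continuous_on (sphere_product b d) f \<and>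
        (\<forall>i. \<forall>y\<in>sphere_product b d. f (flip i y) = (if X i then - f y else f y))) fs Xs"
    unfolding fs_def Xs
  proof (intro list_all2_appendI list_all2_triangle_list list_all2_grid_list)
    fix i m assume im: "i < m" "m < n"
    then have ne: "w i \<noteq> w m" by (simp add: winj)
    have hf: "h i m (flip a y) = (if a = Inl (w i) \<or> a = Inl (w m) then - h i m y else h i m y)" for a y
      using ne by (cases a) (auto simp: h_def flip_def sum_negf)
    have hc: "continuous_on (sphere_product b d) (h i m)" unfolding h_def by (intro continuous_intros)
    show "(continuous_on (sphere_product b d) (\<lambda>y. Re (h i m y)) \<and>
        (\<forall>a. \<forall>y\<in>sphere_product b d. Re (h i m (flip a y)) = (if a = Inl (w i) \<or> a = Inl (w m) then - Re (h i m y) else Re (h i m y)))) \<and>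
      (continuous_on (sphere_product b d) (\<lambda>y. Im (h i m y)) \<and>
        (\<forall>a. \<forall>y\<in>sphere_product b d. Im (h i m (flip a y)) = (if a = Inl (w i) \<or> a = Inl (w m) then - Im (h i m y) else Im (h i m y))))"
      by (auto simp: hf intro!: continuous_intros hc)
  next
    fix j k assume "j < n" "k < n"
    have "continuous_on (sphere_product b d) (\<lambda>y. G (w k) (Am y))"
      by (rule continuous_on_compose2[OF cont contAm]) auto
    then have "continuous_on (sphere_product b d) (g j k)" unfolding g_def by (intro continuous_intros)
    moreover have "g j k (flip a y) = (if a = Inl (w j) \<or> a = Inr (w k) then - g j k y else g j k y)" for a y
      by (cases a) (auto simp: g_def Am_flip equi, auto simp: flip_def negate_column_def sum_negf)
    ultimately show "continuous_on (sphere_product b d) (g j k) \<and>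
        (\<forall>a. \<forall>y\<in>sphere_product b d. g j k (flip a y) = (if a = Inl (w j) \<or> a = Inr (w k) then - g j k y else g j k y))"
      by blast
  qed
  \<comment> \<open>At a common zero the columns are orthonormal, so some \<open>G k\<close> is
    invertible there, and yet it annihilates a nonzero row vector.\<close>
  obtain y where y: "y \<in> sphere_product b d" "\<And>f. f \<in> set fs \<Longrightarrow> f y = 0"
    using borsuk_ulam_spheres[OF orthonormal_upto dD all2 _ character_coeff] sumd by (auto simp: fs_def length_triangle_list length_grid_list)
  have h0: "h i m y = 0" if "i < m" "m < n" for i m
  proof -
    have "Re (h i m y) = 0" "Im (h i m y) = 0"
      using y(2)[of "\<lambda>y. Re (h i m y)"] y(2)[of "\<lambda>y. Im (h i m y)"] set_triangle_list[OF that, of "\<lambda>i m y. Re (h i m y)" "\<lambda>i m y. Im (h i m y)"]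
      by (auto simp: fs_def)
    then show ?thesis by (simp add: complex_eq_iff)
  qed
  have g0: "g j k y = 0" if "j < n" "k < n" for j k
    using y(2)[of "g j k"] set_grid_list[OF that, of g] by (simp add: fs_def)
  have unit: "norm (y $ i) = 1" "y $ i \<in> span (b ` {..d i})" for i
    using y(1) by (auto simp: sphere_product_def coord_sphere_def)
  have "conj_transpose (Am y) ** Am y = mat 1"
  proof -
    have "(\<Sum>r\<in>UNIV. cnj (y $ Inl c $ r) * y $ Inl c' $ r) = (if c = c' then 1 else 0)" for c c'
    proof -
      consider "c = c'" | "rk c < rk c'" | "rk c' < rk c" using rk(2) by (metis linorder_neqE_nat)
      then show ?thesis
      proof cases
        case 1
        have "(\<Sum>r\<in>UNIV. cnj (y $ Inl c $ r) * y $ Inl c $ r) = of_real ((norm (y $ Inl c))\<^sup>2)"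
          by (simp add: norm_vec_def L2_set_def sum_nonneg complex_norm_square[symmetric] mult.commute)
        then show ?thesis using 1 unit by simp
      next
        case 2
        then show ?thesis using h0[OF 2 rk(1)] rk(2) by (auto simp: h_def)
      next
        case 3
        have "cnj (\<Sum>r\<in>UNIV. cnj (y $ Inl c' $ r) * y $ Inl c $ r) = 0"
          using h0[OF 3 rk(1)] rk(2) by (simp add: h_def)
        then show ?thesis using 3 by (auto simp: mult.commute)
      qed
    qed
    then show ?thesis
      by (simp add: vec_eq_iff matrix_matrix_mult_def conj_transpose_def transpose_def Am_def mat_def)
  qed
  then have "Am y \<in> unitary_matrices" by (simp add: unitary_matrices_def matrix_left_right_inverse)
  then obtain k where k: "invertible (G k (Am y))" using inv by blast
  define u :: "real ^ 'n" where "u = (\<chi> c. y $ Inr k \<bullet> b (rk c))"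
  have "u v* G k (Am y) = 0"
  proof -
    have "(\<Sum>c\<in>UNIV. (y $ Inr k \<bullet> b (rk c)) * G k (Am y) $ c $ j) = 0" for j
      using g0[OF rk(1) rk(1), of j k] by (simp add: g_def rk(2))
    then show ?thesis by (simp add: vec_eq_iff vector_matrix_mult_def u_def mult.commute)
  qed
  then have "(u v* G k (Am y)) v* B = 0" for B :: "real ^ 'n ^ 'n" by simp
  then have "u v* (G k (Am y) ** B) = 0" for B :: "real ^ 'n ^ 'n" by (simp add: vector_matrix_mul_assoc)
  then have "u = 0" using k unfolding invertible_def by (metis vector_matrix_mul_rid)
  then have "y $ Inr k \<bullet> b (rk c) = 0" for c by (simp add: u_def vec_eq_iff)
  then have z: "y $ Inr k \<bullet> b m = 0" if "m \<le> rk k" for m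
    using rkw[of m] rk(1)[of k] that by (metis le_less_trans)
  have "y $ Inr k \<bullet> x = 0" if "x \<in> span (b ` {..rk k})" for x
    using that
  proof (induction rule: span_induct)
    case base
    show ?case by (simp add: subspace_def inner_add_right)
  qed (use z in auto)
  then have "y $ Inr k \<bullet> y $ Inr k = 0" using unit(2)[of "Inr k"] by (simp add: d_def)
  then show False using unit(1)[of "Inr k"] by simp
qed

section \<open>Symmetric unitary matrices and their real structures\<close>

abbreviation cnjm :: "complex ^ 'n ^ 'm \<Rightarrow> complex ^ 'n ^ 'm" where "cnjm \<equiv> map_matrix cnj"

definition symmetric_unitary :: "(complex ^ 'n ^ 'n) set" where
  "symmetric_unitary = {S \<in> unitary_matrices. transpose S = S}"

lemma cnjm_mult: "cnjm (A ** B) = cnjm A ** cnjm B"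
  by (simp add: vec_eq_iff matrix_matrix_mult_def)

lemma cnjm_cnjm [simp]: "cnjm (cnjm A) = A"
  by (simp add: vec_eq_iff)

lemma cnjm_mat1 [simp]: "cnjm (mat 1) = mat 1"
  by (simp add: vec_eq_iff mat_def)

lemma cnjm_add: "cnjm (A + B) = cnjm A + cnjm B"
  by (simp add: vec_eq_iff)

lemma cnjm_transpose: "cnjm (transpose A) = transpose (cnjm A)"
  by (simp add: vec_eq_iff transpose_def)

lemma matrix_add_mult: "(B + C) ** A = B ** A + C ** (A :: 'a::semiring_1 ^ 'n ^ 'm)"
  by (simp add: vec_eq_iff matrix_matrix_mult_def distrib_right sum.distrib)

lemma unitary_iff: "A \<in> unitary_matrices \<longleftrightarrow> conj_transpose A ** A = mat 1"
  by (auto simp: unitary_matrices_def matrix_left_right_inverse)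

lemma unitary_conj:
  assumes "A \<in> unitary_matrices"
  shows "transpose A ** cnjm A = mat 1" "cnjm A ** transpose A = mat 1"
    "transpose (cnjm A) ** A = mat 1" "A ** transpose (cnjm A) = mat 1"
proof -
  show 1: "transpose (cnjm A) ** A = mat 1" "A ** transpose (cnjm A) = mat 1"
    using assms by (simp_all add: unitary_matrices_def conj_transpose_def cnjm_transpose)
  have "cnjm (transpose (cnjm A) ** A) = mat 1" "cnjm (A ** transpose (cnjm A)) = mat 1" by (simp_all only: 1 cnjm_mat1)
  then show "transpose A ** cnjm A = mat 1" "cnjm A ** transpose A = mat 1"
    by (simp_all add: cnjm_mult cnjm_transpose)
qed

lemma symmetric_unitary_cnjm: "S \<in> symmetric_unitary \<Longrightarrow> S ** cnjm S = mat 1" "S \<in> symmetric_unitary \<Longrightarrow> cnjm S ** S = mat 1"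
  unfolding symmetric_unitary_def using unitary_conj[of S] by (auto simp: cnjm_transpose[symmetric])

lemma gram_symmetric_unitary:
  assumes "A \<in> unitary_matrices" shows "A ** transpose A \<in> symmetric_unitary"
proof -
  have "transpose (cnjm (A ** transpose A)) ** (A ** transpose A)
     = (cnjm A ** (transpose (cnjm A) ** A)) ** transpose A"
    by (simp add: cnjm_mult cnjm_transpose matrix_transpose_mul matrix_mul_assoc)
  also have "\<dots> = mat 1" by (simp add: unitary_conj[OF assms])
  finally show ?thesis
    by (simp add: symmetric_unitary_def unitary_iff conj_transpose_def cnjm_transpose matrix_transpose_mul)
qed

definition cnj_vec :: "complex ^ 'n \<Rightarrow> complex ^ 'n" where "cnj_vec x = (\<chi> i. cnj (x $ i))"

text \<open>The columns of \<open>A\<close> are an orthonormal basis of the real space of all \<open>x\<close> with \<open>S cnj x = x\<close>.\<close>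

lemma takagi_factorization:
  fixes S :: "complex ^ 'n ^ 'n"
  assumes S: "S \<in> symmetric_unitary"
  obtains A where "A \<in> unitary_matrices" "A ** transpose A = S"
proof -
  define L where "L = {x. S *v cnj_vec x = x}"
  have Scomp: "S $ i $ j = S $ j $ i" for i j
    using S by (simp add: symmetric_unitary_def vec_eq_iff transpose_def)
  have cnj_vec: "cnj_vec (x + y) = cnj_vec x + cnj_vec y" "cnj_vec (r *\<^sub>R x) = r *\<^sub>R cnj_vec x" "cnj_vec (cnj_vec x) = x"
    "cnj_vec 0 = 0" "cnj_vec (c *s x) = cnj c *s cnj_vec x" "cnj_vec (A *v x) = cnjm A *v cnj_vec x"
    for x y :: "complex ^ 'n" and r c and A :: "complex ^ 'n ^ 'n"
    by (simp_all add: cnj_vec_def vec_eq_iff matrix_vector_mult_def)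
  have scR: "A *v (r *\<^sub>R x) = r *\<^sub>R (A *v x)" for A :: "complex ^ 'n ^ 'n" and r x
    by (simp add: vec_eq_iff matrix_vector_mult_def scaleR_sum_right)
  have sc: "A *v (c *s x) = c *s (A *v x)" for A :: "complex ^ 'n ^ 'n" and c x
    by (simp add: vec_eq_iff matrix_vector_mult_def sum_distrib_left mult_ac)
  have sub: "subspace L"
    by (auto simp: subspace_def L_def cnj_vec matrix_vector_right_distrib scR)
  \<comment> \<open>The antilinear involution \<open>x \<mapsto> S cnj x\<close> has
    \<open>L\<close> as eigenspace for 1 and the image of \<open>L\<close> under multiplication by
    the imaginary unit as eigenspace for -1; so \<open>L\<close> has half of the real dimension
    \<open>2 n\<close>.\<close>
  define I where "I = (\<lambda>x :: complex ^ 'n. \<i> *s x)"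
  have linI: "linear I" unfolding I_def
    by (rule linearI) (simp_all add: vec_eq_iff algebra_simps)
  have injI: "inj I" by (rule injI) (simp add: I_def vec_eq_iff)
  have I_L: "S *v cnj_vec (I x) = - I x" if "x \<in> L" for x
  proof -
    have "S *v cnj_vec (I x) = cnj \<i> *s (S *v cnj_vec x)" by (simp only: I_def cnj_vec sc)
    then show ?thesis using that by (simp add: I_def L_def vec_eq_iff)
  qed
  have int: "L \<inter> I ` L = {0}"
  proof (intro equalityI subsetI)
    fix y assume "y \<in> L \<inter> I ` L"
    then have "S *v cnj_vec y = y" "S *v cnj_vec y = - y" using I_L by (auto simp: L_def)
    then have "y $ i = - (y $ i)" for i by (metis vector_uminus_component)
    then show "y \<in> {0}" by (simp add: vec_eq_iff)
  next
    fix y :: "complex ^ 'n" assume "y \<in> {0}"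
    moreover have "I 0 = 0" using linear_0[OF linI] .
    ultimately show "y \<in> L \<inter> I ` L" using subspace_0[OF sub] by (auto intro: rev_image_eqI)
  qed
  have "{x + y |x y. x \<in> L \<and> y \<in> I ` L} = UNIV"
  proof -
    have "\<exists>u w. x = u + w \<and> u \<in> L \<and> w \<in> I ` L" for x
    proof -
      define t where "t = S *v cnj_vec x"
      have t: "S *v cnj_vec t = x"
        using symmetric_unitary_cnjm(1)[OF S] by (simp add: t_def cnj_vec matrix_vector_mul_assoc)
      have u: "(1/2) *\<^sub>R (x + t) \<in> L"
        using t by (simp add: L_def cnj_vec scR matrix_vector_right_distrib t_def[symmetric] add.commute)
      have w: "(1/2) *\<^sub>R ((- \<i>) *s (x - t)) \<in> L"
      proof -
        have "cnj_vec (x - t) = cnj_vec x - cnj_vec t" by (simp add: cnj_vec_def vec_eq_iff)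
        then have "S *v cnj_vec (x - t) = t - x" using t by (simp add: matrix_vector_mult_diff_distrib t_def[symmetric])
        then show ?thesis by (simp only: L_def cnj_vec scR sc mem_Collect_eq) (simp add: vec_eq_iff algebra_simps)
      qed
      have "I ((1/2) *\<^sub>R ((- \<i>) *s (x - t))) = (1/2) *\<^sub>R (x - t)" by (simp add: I_def vec_eq_iff algebra_simps)
      then have "(1/2) *\<^sub>R (x - t) \<in> I ` L" using w by (metis image_eqI)
      moreover have "x = (1/2) *\<^sub>R (x + t) + (1/2) *\<^sub>R (x - t)" by (simp add: algebra_simps scaleR_add_left[symmetric])
      ultimately show ?thesis using u by blast
    qed
    then show ?thesis by blast
  qed
  then have "DIM(complex ^ 'n) + dim (L \<inter> I ` L) = dim L + dim (I ` L)"
    using dim_sums_Int[OF sub linear_subspace_image[OF linI sub]] by simp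
  moreover have "dim (I ` L) = dim L" using dim_image_eq[OF linI, of L] injI by (simp add: inj_on_subset)
  ultimately have dimL: "dim L = CARD('n)" by (simp add: int)
  obtain B where B: "B \<subseteq> L" "pairwise orthogonal B" "\<And>x. x \<in> B \<Longrightarrow> norm x = 1" "independent B" "card B = dim L"
    using orthonormal_basis_subspace[OF sub] by metis
  have "finite B" using B(4) independent_imp_finite by blast
  then obtain \<beta> where \<beta>: "bij_betw \<beta> (UNIV :: 'n set) B"
    using finite_same_card_bij[of "UNIV :: 'n set" B] B(5) dimL by auto
  define A where "A = (\<chi> r c. \<beta> c $ r)"
  have \<beta>L: "\<beta> c \<in> L" "\<beta> c \<in> B" for c using \<beta> B(1) by (auto simp: bij_betw_def)
  \<comment> \<open>The symmetry of \<open>S\<close> makes the Hermitian product of two fixed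
    vectors equal to its own conjugate. A real orthonormal basis of \<open>L\<close> is therefore
    also orthonormal over the complex numbers.\<close>
  have herm: "(\<Sum>r\<in>UNIV. cnj (x $ r) * y $ r) = of_real (x \<bullet> y)" if "x \<in> L" "y \<in> L" for x y
  proof -
    let ?h = "\<Sum>r\<in>UNIV. cnj (x $ r) * y $ r"
    have x: "(\<Sum>r\<in>UNIV. S $ s $ r * cnj (x $ r)) = x $ s" and y: "(\<Sum>r\<in>UNIV. S $ s $ r * cnj (y $ r)) = y $ s" for s
      using that by (simp_all add: L_def vec_eq_iff matrix_vector_mult_def cnj_vec_def)
    have "?h = (\<Sum>r\<in>UNIV. \<Sum>s\<in>UNIV. cnj (x $ r) * (S $ r $ s * cnj (y $ s)))"
      by (subst y[symmetric]) (simp add: sum_distrib_left)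
    also have "\<dots> = (\<Sum>s\<in>UNIV. \<Sum>r\<in>UNIV. cnj (y $ s) * (S $ s $ r * cnj (x $ r)))"
      by (subst sum.swap) (intro sum.cong refl, simp add: Scomp mult_ac)
    also have "\<dots> = (\<Sum>s\<in>UNIV. cnj (y $ s) * x $ s)" by (simp only: sum_distrib_left[symmetric] x)
    also have "\<dots> = cnj ?h" by (simp add: mult.commute)
    finally have "Im ?h = 0" by (metis complex_cnj_cancel_iff complex_is_Real_iff Reals_cnj_iff)
    moreover have "Re ?h = x \<bullet> y" by (simp add: inner_vec_def inner_complex_def)
    ultimately show ?thesis by (simp add: complex_eq_iff)
  qed
  have "conj_transpose A ** A = mat 1"
  proof -
    have "\<beta> c \<bullet> \<beta> c' = (if c = c' then 1 else 0)" for c c'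
    proof (cases "c = c'")
      case True
      then show ?thesis using B(3)[OF \<beta>L(2), of c] by (simp add: dot_square_norm)
    next
      case False
      then have "\<beta> c \<noteq> \<beta> c'" using \<beta> by (auto simp: bij_betw_def dest: injD)
      then show ?thesis using B(2) \<beta>L(2) False by (auto simp: pairwise_def orthogonal_def)
    qed
    then show ?thesis
      using herm[OF \<beta>L(1) \<beta>L(1)]
      by (simp add: vec_eq_iff matrix_matrix_mult_def conj_transpose_def transpose_def A_def mat_def)
  qed
  then have A: "A \<in> unitary_matrices" by (simp add: unitary_iff)
  have "S ** cnjm A = A"
    using \<beta>L(1) by (simp add: L_def vec_eq_iff matrix_matrix_mult_def matrix_vector_mult_def A_def cnj_vec_def)
  then have "S ** (cnjm A ** transpose A) = A ** transpose A" by (simp add: matrix_mul_assoc)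
  then have "A ** transpose A = S" by (simp add: unitary_conj[OF A])
  with A show thesis by (rule that)
qed

section \<open>Continuity and compactness for matrices\<close>

lemma continuous_on_matrix_mult [continuous_intros]:
  fixes f g :: "_ \<Rightarrow> 'a::real_normed_algebra_1 ^ _ ^ _"
  assumes "continuous_on S f" "continuous_on S g"
  shows "continuous_on S (\<lambda>x. f x ** g x)"
  unfolding matrix_matrix_mult_def by (intro continuous_on_vec_lambda continuous_intros assms)

lemma continuous_on_map_matrix [continuous_intros]:
  assumes "continuous_on S f" "continuous_on UNIV h"
  shows "continuous_on S (\<lambda>x. map_matrix h (f x))"
  unfolding map_matrix_def
  by (intro continuous_on_vec_lambda continuous_on_compose2[OF assms(2)] continuous_intros assms(1)) auto

lemma continuous_on_transpose [continuous_intros]: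
  assumes "continuous_on S f"
  shows "continuous_on S (\<lambda>x. transpose (f x))"
  unfolding transpose_def by (intro continuous_on_vec_lambda continuous_intros assms)

lemma continuous_on_det [continuous_intros]:
  fixes f :: "'x::topological_space \<Rightarrow> 'a::real_normed_field ^ 'n ^ 'n"
  assumes "continuous_on S f"
  shows "continuous_on S (\<lambda>x. det (f x))"
  unfolding det_def by (intro continuous_intros assms)

lemma continuous_on_cnjm [continuous_intros]:
  "continuous_on S f \<Longrightarrow> continuous_on S (\<lambda>x. cnjm (f x))"
  by (rule continuous_on_map_matrix) (auto intro: continuous_intros)

lemma compact_unitary: "compact (unitary_matrices :: (complex ^ 'n ^ 'n) set)"
proof -
  have "unitary_matrices = {A :: complex ^ 'n ^ 'n. conj_transpose A ** A = mat 1}"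
    by (auto simp: unitary_iff)
  moreover have "closed {A :: complex ^ 'n ^ 'n. conj_transpose A ** A = mat 1}"
    unfolding conj_transpose_def by (intro closed_Collect_eq continuous_intros)
  moreover have "bounded (unitary_matrices :: (complex ^ 'n ^ 'n) set)"
    unfolding bounded_iff
  proof (intro exI ballI)
    fix A :: "complex ^ 'n ^ 'n" assume "A \<in> unitary_matrices"
    then have A: "A ** conj_transpose A = mat 1" by (simp add: unitary_matrices_def)
    have square_row: "norm (A $ i) = 1" for i
    proof -
      have "(A ** conj_transpose A) $ i $ i = 1" by (simp add: A mat_def)
      then have "(\<Sum>k\<in>UNIV. A $ i $ k * cnj (A $ i $ k)) = 1"
        by (simp add: matrix_matrix_mult_def conj_transpose_def transpose_def)
      then have "of_real (\<Sum>k\<in>UNIV. (norm (A $ i $ k))\<^sup>2) = (1 :: complex)"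
        by (simp add: complex_norm_square del: of_real_power)
      then have "(\<Sum>k\<in>UNIV. (norm (A $ i $ k))\<^sup>2) = 1" by (metis of_real_eq_1_iff)
      then show ?thesis by (simp add: norm_vec_def L2_set_def)
    qed
    have "norm A \<le> (\<Sum>i\<in>UNIV. norm (A $ i))"
      unfolding norm_vec_def[of A] by (rule L2_set_le_sum) simp
    then show "norm A \<le> real CARD('n)" by (simp add: square_row)
  qed
  ultimately show ?thesis by (simp add: compact_eq_bounded_closed)
qed

lemma compact_symmetric_unitary: "compact (symmetric_unitary :: (complex ^ 'n ^ 'n) set)"
proof -
  have "symmetric_unitary = unitary_matrices \<inter> {S :: complex ^ 'n ^ 'n. transpose S = S}" by (auto simp: symmetric_unitary_def)
  moreover have "closed {S :: complex ^ 'n ^ 'n. transpose S = S}"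
    by (intro closed_Collect_eq continuous_intros)
  ultimately show ?thesis using compact_Int_closed[OF compact_unitary] by metis
qed

lemma det_of_real: "det (map_matrix complex_of_real R) = of_real (det R)"
  by (simp add: det_def)

lemma negate_column_gram: "negate_column j A ** transpose (negate_column j A) = A ** transpose (A :: complex ^ 'n ^ 'n)"
  by (simp add: vec_eq_iff matrix_matrix_mult_def transpose_def negate_column_def)
    (intro allI sum.cong refl, simp)

lemma mult_negate_column: "X ** negate_column j A = negate_column j (X ** (A :: complex ^ 'n ^ 'n))"
  by (simp add: vec_eq_iff matrix_matrix_mult_def negate_column_def sum_negf)

lemma map_Re_negate_column: "map_matrix Re (negate_column j X) = negate_column j (map_matrix Re X)"
  by (simp add: negate_column_def vec_eq_iff)

text \<open>The matrix \<open>1 + S' cnj S\<close> maps the fixed space of \<open>x \<mapsto> S cnj x\<close> to that of \<open>x \<mapsto> S' cnj x\<close> (twice the orthogonal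
projection), isomorphically if \<open>S'\<close> is close to \<open>S\<close>. Composing such maps along the homotopy transports frames to the fibre over \<open>c\<close>.\<close>

lemma local_trivialisation:
  fixes K :: "(complex ^ 'n ^ 'n) set"
  assumes K: "compact K" "K \<subseteq> symmetric_unitary"
    and h: "continuous_on ({0..1} \<times> K) h" "\<And>t S. t \<in> {0..1} \<Longrightarrow> S \<in> K \<Longrightarrow> h (t, S) \<in> symmetric_unitary"
      "\<And>S. S \<in> K \<Longrightarrow> h (0::real, S) = S" "\<And>S. S \<in> K \<Longrightarrow> h (1, S) = c"
    and c: "c \<in> symmetric_unitary"
  shows "\<exists>G :: complex ^ 'n ^ 'n \<Rightarrow> real ^ 'n ^ 'n. continuous_on UNIV G \<and> (\<forall>j A. G (negate_column j A) = negate_column j (G A)) \<and>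
     (\<forall>A\<in>unitary_matrices. A ** transpose A \<in> K \<longrightarrow> invertible (G A))"
proof -
  \<comment> \<open>On the diagonal the matrix is twice the identity. Its determinant
    \<open>2 ^ CARD('n)\<close> is the distance to 0 that \<open>\<delta>\<close> has to
    respect.\<close>
  define \<phi> :: "(complex ^ 'n ^ 'n) \<times> (complex ^ 'n ^ 'n) \<Rightarrow> complex"
    where "\<phi> = (\<lambda>p. det (mat 1 + snd p ** cnjm (fst p)))"
  have diag: "\<phi> (S, S) = 2 ^ CARD('n)" if "S \<in> symmetric_unitary" for S
  proof -
    have "mat 1 + mat 1 = (mat 2 :: complex ^ 'n ^ 'n)" by (simp add: mat_def vec_eq_iff)
    then have "\<phi> (S, S) = det (mat 2 :: complex ^ 'n ^ 'n)" by (simp add: \<phi>_def symmetric_unitary_cnjm[OF that])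
    also have "\<dots> = 2 ^ CARD('n)" by (subst det_diagonal) (simp_all add: mat_def)
    finally show ?thesis .
  qed
  have "uniformly_continuous_on (symmetric_unitary \<times> symmetric_unitary) \<phi>"
    unfolding \<phi>_def by (intro compact_uniformly_continuous continuous_intros compact_Times compact_symmetric_unitary)
  moreover have "(0::real) < 2 ^ CARD('n)" by simp
  ultimately obtain \<delta> where \<delta>: "\<delta> > 0" "\<And>p q. p \<in> symmetric_unitary \<times> symmetric_unitary \<Longrightarrow> q \<in> symmetric_unitary \<times> symmetric_unitary \<Longrightarrow> dist p q < \<delta> \<Longrightarrow> dist (\<phi> p) (\<phi> q) < 2 ^ CARD('n)"
    unfolding uniformly_continuous_on_def by metis
  have \<phi>nz: "\<phi> (S, S') \<noteq> 0" if "S \<in> symmetric_unitary" "S' \<in> symmetric_unitary" "dist S S' < \<delta>" for S S'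
  proof
    assume 0: "\<phi> (S, S') = 0"
    have "dist (\<phi> (S, S)) (\<phi> (S, S')) < 2 ^ CARD('n)"
      using \<delta>(2)[of "(S,S)" "(S,S')"] that by (simp add: dist_Pair_Pair)
    then show False using 0 diag[OF that(1)] by (simp add: norm_power)
  qed
  have "uniformly_continuous_on ({0..1} \<times> K) h"
    by (intro compact_uniformly_continuous h(1) compact_Times K compact_Icc)
  then obtain \<eta> where \<eta>: "\<eta> > 0" "\<And>p q. p \<in> {0..1} \<times> K \<Longrightarrow> q \<in> {0..1} \<times> K \<Longrightarrow> dist p q < \<eta> \<Longrightarrow> dist (h p) (h q) < \<delta>"
    using \<delta>(1) unfolding uniformly_continuous_on_def by metis
  obtain N :: nat where N: "N > 0" "1 / N < \<eta>"
    using \<eta>(1) by (metis of_nat_0_less_iff reals_Archimedean inverse_eq_divide zero_less_Suc)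
  define s where "s r S = h (real r / N, S)" for r S
  have fr: "real r / N \<in> {0..1}" if "r \<le> N" for r using that N by auto
  have sSU: "s r S \<in> symmetric_unitary" if "r \<le> N" "S \<in> K" for r S unfolding s_def by (rule h(2)[OF fr[OF that(1)] that(2)])
  have s0: "s 0 S = S" and sN: "s N S = c" if "S \<in> K" for S using h(3,4)[OF that] N by (simp_all add: s_def)
  have scont: "continuous_on K (s r)" if "r \<le> N" for r
    unfolding s_def by (rule continuous_on_compose2[OF h(1)]) (use fr[OF that] in \<open>auto intro!: continuous_intros\<close>)
  have sstep: "det (mat 1 + s (Suc r) S ** cnjm (s r S)) \<noteq> 0" if "Suc r \<le> N" "S \<in> K" for r S
  proof -
    have "dist (real r / N) (real (Suc r) / N) = 1 / N"
      using N(1) by (simp add: dist_real_def diff_divide_distrib[symmetric] abs_divide)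
    then have "dist (s r S) (s (Suc r) S) < \<delta>"
      unfolding s_def using \<eta>(2)[of "(real r / N, S)" "(real (Suc r) / N, S)"] fr[of r] fr[of "Suc r"] that N
      by (auto simp: dist_Pair_Pair)
    then show ?thesis using \<phi>nz[OF sSU sSU, of r S "Suc r" S] that by (simp add: \<phi>_def)
  qed
  define B where "B = rec_nat (\<lambda>S. mat 1) (\<lambda>r b S. (mat 1 + s (Suc r) S ** cnjm (s r S)) ** b S)"
  have B0: "B 0 S = mat 1" and BS: "B (Suc r) S = (mat 1 + s (Suc r) S ** cnjm (s r S)) ** B r S" for r S
    by (simp_all add: B_def)
  have Bcont: "continuous_on K (B r)" if "r \<le> N" for r
    using that
  proof (induction r)
    case 0
    then show ?case by (simp add: B_def)
  next
    case (Suc r)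
    then have "continuous_on K (\<lambda>S. (mat 1 + s (Suc r) S ** cnjm (s r S)) ** B r S)"
      by (intro continuous_intros scont) auto
    then show ?case using BS[of r] by (metis (no_types, lifting) continuous_on_cong)
  qed
  have Bdet: "det (B r S) \<noteq> 0" if "r \<le> N" "S \<in> K" for r S
    using that by (induction r) (simp_all add: B0 BS det_mul sstep)
  \<comment> \<open>The columns of \<open>B r S ** A\<close> stay in the fixed space of
    \<open>x \<mapsto> s r S cnj x\<close>. For \<open>r = 0\<close> this follows from
    \<open>A ** transpose A = S\<close> and the unitarity of \<open>A\<close>.\<close>
  have Bframe: "s r S ** cnjm (B r S ** A) = B r S ** A"
    if "r \<le> N" "S \<in> K" "A \<in> unitary_matrices" "A ** transpose A = S" for r S A
    using that(1)
  proof (induction r)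
    case 0
    have "(A ** transpose A) ** cnjm A = A ** (transpose A ** cnjm A)" by (simp add: matrix_mul_assoc)
    then show ?case using that by (simp add: B0 s0 unitary_conj)
  next
    case (Suc r)
    let ?M = "B r S ** A" and ?T = "s r S" and ?T' = "s (Suc r) S"
    have IH: "?T ** cnjm ?M = ?M" using Suc by simp
    have T: "?T' ** cnjm ?T' = mat 1" "cnjm ?T ** ?T = mat 1"
      using symmetric_unitary_cnjm[OF sSU[of "Suc r" S]] symmetric_unitary_cnjm[OF sSU[of r S]] Suc.prems that by simp_all
    have M': "B (Suc r) S ** A = ?M + ?T' ** (cnjm ?T ** ?M)"
      by (simp add: BS matrix_add_mult matrix_mul_assoc)
    have "cnjm ?T ** ?M = (cnjm ?T ** ?T) ** cnjm ?M" by (subst IH[symmetric]) (simp add: matrix_mul_assoc)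
    then have M'': "B (Suc r) S ** A = ?M + ?T' ** cnjm ?M" unfolding M' by (simp add: T)
    have "?T' ** cnjm (?M + ?T' ** cnjm ?M) = ?T' ** cnjm ?M + (?T' ** cnjm ?T') ** ?M"
      by (simp add: cnjm_add cnjm_mult matrix_add_ldistrib matrix_mul_assoc)
    then show ?case unfolding M'' by (simp add: T add.commute)
  qed
  obtain C where C: "C \<in> unitary_matrices" "C ** transpose C = c" using takagi_factorization[OF c] .
  have "closed K" using K(1) by (rule compact_imp_closed)
  \<comment> \<open>Extending \<open>B N\<close> beyond \<open>K\<close> may destroy invertibility
    but keeps continuity, and only the latter is demanded on all matrices.\<close>
  then obtain Bx where Bx: "continuous_on UNIV Bx" "\<And>S. S \<in> K \<Longrightarrow> Bx S = B N S"
    using Dugundji[of UNIV UNIV K "B N"] Bcont[of N] by auto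
  \<comment> \<open>The transported frame in coordinates with respect to the basis \<open>C\<close>
    of the fibre over \<open>c\<close>; for unitary \<open>A\<close> over \<open>K\<close> these
    coordinates are real. The extension is evaluated at \<open>A ** transpose A\<close>, which does
    not see signs of columns, and this gives equivariance.\<close>
  define G where "G A = map_matrix Re (conj_transpose C ** Bx (A ** transpose A) ** A)" for A :: "complex ^ 'n ^ 'n"
  have "continuous_on UNIV G"
    unfolding G_def by (intro continuous_intros continuous_on_compose2[OF Bx(1)]) auto
  moreover have "G (negate_column j A) = negate_column j (G A)" for j A
    by (simp add: G_def negate_column_gram mult_negate_column map_Re_negate_column)
  moreover have "invertible (G A)" if A: "A \<in> unitary_matrices" "A ** transpose A \<in> K" for A
  proof -
    define M where "M = B N (A ** transpose A) ** A"
    have M: "c ** cnjm M = M"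
      using Bframe[OF order_refl A(2) A(1)] sN[OF A(2)] by (simp add: M_def)
    define W where "W = conj_transpose C ** M"
    have "cnjm W = transpose C ** cnjm M" by (simp add: W_def cnjm_mult conj_transpose_def)
    also have "\<dots> = transpose (cnjm C) ** (C ** transpose C) ** cnjm M"
      by (simp add: matrix_mul_assoc unitary_conj[OF C(1)])
    also have "\<dots> = W" using M by (simp add: W_def C(2) conj_transpose_def cnjm_transpose matrix_mul_assoc[symmetric])
    finally have "W = map_matrix complex_of_real (map_matrix Re W)"
      by (simp add: vec_eq_iff complex_eq_iff)
    moreover have "det W \<noteq> 0"
    proof -
      have "det A \<noteq> 0" "det (conj_transpose C) \<noteq> 0"
        using A(1) C(1) by (auto simp: unitary_matrices_def invertible_det_nz[symmetric] invertible_def)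
      then show ?thesis using Bdet[OF order_refl A(2)] by (simp add: W_def M_def det_mul)
    qed
    ultimately have "det (map_matrix Re W) \<noteq> 0" by (metis det_of_real of_real_0)
    moreover have "G A = map_matrix Re W" by (simp add: G_def W_def M_def Bx(2)[OF A(2)] matrix_mul_assoc)
    ultimately show ?thesis by (simp add: invertible_det_nz)
  qed
  ultimately show ?thesis by blast
qed

lemma card_categorical_cover:
  fixes \<U> :: "(complex ^ 'n ^ 'n) set set"
  assumes fin: "finite \<U>" and cat: "\<And>U. U \<in> \<U> \<Longrightarrow> categorical (top_of_set symmetric_unitary) U" and cov: "\<Union>\<U> = symmetric_unitary"
  shows "CARD('n) < card \<U>"
proof (rule ccontr)
  assume "\<not> CARD('n) < card \<U>"
  then have card: "card \<U> \<le> CARD('n)" by simp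
  have one: "mat 1 \<in> (symmetric_unitary :: (complex ^ 'n ^ 'n) set)"
    by (simp add: symmetric_unitary_def unitary_iff conj_transpose_def transpose_mat)
  then have ne: "\<U> \<noteq> {}" using cov by auto
  \<comment> \<open>The cover is indexed by \<open>'n\<close> with repetitions, as
    \<open>no_equivariant_frames\<close> expects one map for each index.\<close>
  obtain U :: "'n \<Rightarrow> _" where U: "range U = \<U>"
  proof -
    obtain f :: "(complex ^ 'n ^ 'n) set \<Rightarrow> 'n" where f: "inj_on f \<U>"
      using card_le_inj[OF fin finite_class.finite_UNIV card] by blast
    obtain U0 where "U0 \<in> \<U>" using ne by blast
    then have "range (\<lambda>k. if k \<in> f ` \<U> then inv_into \<U> f k else U0) = \<U>"
      using f by (auto simp: inv_into_into image_iff intro!: inv_into_f_f[symmetric])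
    then show thesis by (rule that)
  qed
  have op: "\<exists>T. open T \<and> V = symmetric_unitary \<inter> T" if "V \<in> \<U>" for V
    using cat[OF that] by (auto simp: categorical_def openin_open)
  define \<G> where "\<G> = {T. open T \<and> symmetric_unitary \<inter> T \<in> \<U>}"
  have "symmetric_unitary \<subseteq> \<Union>\<G>"
  proof
    fix S :: "complex ^ 'n ^ 'n" assume "S \<in> symmetric_unitary"
    then obtain V where V: "V \<in> \<U>" "S \<in> V" using cov by blast
    obtain T where T: "open T" "V = symmetric_unitary \<inter> T" using op[OF V(1)] by blast
    then have "T \<in> \<G>" using V(1) by (simp add: \<G>_def)
    then show "S \<in> \<Union>\<G>" using V(2) T(2) by blast
  qed
  then obtain e where e: "e > 0" "\<And>S. S \<in> symmetric_unitary \<Longrightarrow> \<exists>T\<in>\<G>. ball S e \<subseteq> T"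
    using Heine_Borel_lemma[OF compact_symmetric_unitary] unfolding \<G>_def by (metis (mono_tags, lifting) mem_Collect_eq)
  \<comment> \<open>The points at distance at least \<open>e\<close> from the rest of the space
    outside \<open>U k\<close>. These sets are compact, as uniform continuity and the extension
    require, and still cover because \<open>e\<close> is a Lebesgue number.\<close>
  define K where "K k = symmetric_unitary \<inter> (\<Inter>x\<in>symmetric_unitary - U k. - ball x e)" for k
  have compK: "compact (K k)" for k
    unfolding K_def by (intro compact_Int_closed compact_symmetric_unitary closed_INT) (auto simp: closed_def)
  have KU: "K k \<subseteq> U k" for k
    using e(1) by (force simp: K_def)
  have Kcov: "\<exists>k. S \<in> K k" if S: "S \<in> symmetric_unitary" for S
  proof -
    obtain T where T: "T \<in> \<G>" "ball S e \<subseteq> T" using e(2)[OF S] by blast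
    then obtain k where k: "U k = symmetric_unitary \<inter> T" using U by (auto simp: \<G>_def)
    have "S \<notin> ball x e" if "x \<in> symmetric_unitary - U k" for x
      using that T(2) k by (auto simp: dist_commute subset_iff)
    then show ?thesis using S by (auto simp: K_def)
  qed
  have "\<exists>G :: complex ^ 'n ^ 'n \<Rightarrow> real ^ 'n ^ 'n. continuous_on UNIV G \<and> (\<forall>j A. G (negate_column j A) = negate_column j (G A)) \<and>
     (\<forall>A\<in>unitary_matrices. A ** transpose A \<in> K k \<longrightarrow> invertible (G A))" for k
  proof -
    have "categorical (top_of_set symmetric_unitary) (U k)" using cat U by blast
    then obtain c where c: "c \<in> symmetric_unitary" "homotopic_with (\<lambda>h. True) (subtopology (top_of_set symmetric_unitary) (U k)) (top_of_set symmetric_unitary) (\<lambda>x. x) (\<lambda>x. c)"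
      by (auto simp: categorical_def)
    have "U k \<subseteq> symmetric_unitary" using U cov by blast
    then have sub: "subtopology (top_of_set symmetric_unitary) (U k) = top_of_set (U k)"
      by (simp add: subtopology_subtopology Int_absorb1)
    obtain h where h: "continuous_map (prod_topology (top_of_set {0..1::real}) (top_of_set (U k))) (top_of_set symmetric_unitary) h"
      "\<And>x. h (0, x) = x" "\<And>x. h (1, x) = c"
      using c(2) unfolding homotopic_with_def sub by blast
    have hU: "continuous_on ({0..1} \<times> U k) h" "h \<in> ({0..1} \<times> U k) \<rightarrow> symmetric_unitary"
      using h(1) by (auto simp: prod_topology_subtopology_eu continuous_map_in_subtopology)
    show ?thesis
    proof (rule local_trivialisation[OF compK])
      show "continuous_on ({0..1} \<times> K k) h" by (rule continuous_on_subset[OF hU(1)]) (use KU in auto)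
      show "h (t, S) \<in> symmetric_unitary" if "t \<in> {0..1}" "S \<in> K k" for t S using hU(2) that KU by fast
    qed (use h c in \<open>auto simp: K_def\<close>)
  qed
  then obtain G :: "'n \<Rightarrow> complex ^ 'n ^ 'n \<Rightarrow> real ^ 'n ^ 'n" where G:
    "\<And>k. continuous_on UNIV (G k)" "\<And>k j A. G k (negate_column j A) = negate_column j (G k A)"
    "\<And>k A. A \<in> unitary_matrices \<Longrightarrow> A ** transpose A \<in> K k \<Longrightarrow> invertible (G k A)"
    by metis
  show False
  proof (rule no_equivariant_frames[OF G(1,2)])
    fix A :: "complex ^ 'n ^ 'n" assume A: "A \<in> unitary_matrices"
    then show "\<exists>k. invertible (G k A)" using Kcov[OF gram_symmetric_unitary[OF A]] G(3) by blast
  qed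
qed

section \<open>A cover by categorical sets\<close>

lemma inner_conj_transpose: "(A *v x) \<bullet> y = x \<bullet> (conj_transpose A *v y)"
  for A :: "complex ^ 'n ^ 'm"
proof -
  have inn: "u \<bullet> v = Re (\<Sum>r\<in>UNIV. cnj (u $ r) * v $ r)" for u v :: "complex ^ 'k"
    by (simp add: inner_vec_def inner_complex_def)
  have "(\<Sum>r\<in>UNIV. cnj ((A *v x) $ r) * y $ r) = (\<Sum>r\<in>UNIV. \<Sum>s\<in>UNIV. cnj (x $ s) * (cnj (A $ r $ s) * y $ r))"
    by (simp add: matrix_vector_mult_def sum_distrib_right sum_distrib_left mult_ac)
  also have "\<dots> = (\<Sum>s\<in>UNIV. cnj (x $ s) * (conj_transpose A *v y) $ s)"
    by (subst sum.swap) (simp add: matrix_vector_mult_def conj_transpose_def transpose_def sum_distrib_left)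
  finally show ?thesis by (simp add: inn)
qed

lemma norm_unitary: "A \<in> unitary_matrices \<Longrightarrow> norm (A *v x) = norm x"
  by (simp add: norm_eq_sqrt_inner inner_conj_transpose matrix_vector_mul_assoc unitary_iff)

lemma mat_mult_left: "mat c ** A = (\<chi> i j. c * (A :: 'a::comm_semiring_1 ^ 'n ^ 'm) $ i $ j)"
proof -
  have "(\<Sum>k\<in>UNIV. (if i = k then c else 0) * A $ k $ j) = (\<Sum>k\<in>UNIV. if k = i then c * A $ k $ j else 0)" for i j
    by (rule sum.cong) auto
  then show ?thesis by (simp add: vec_eq_iff matrix_matrix_mult_def mat_def)
qed

lemma mat_commute: "mat c ** A = A ** mat (c :: 'a::comm_semiring_1)"
proof -
  have "(\<Sum>k\<in>UNIV. A $ i $ k * (if k = j then c else 0)) = (\<Sum>k\<in>UNIV. if k = j then c * A $ i $ k else 0)" for i j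
    by (rule sum.cong) (auto simp: mult.commute)
  then show ?thesis unfolding mat_mult_left by (simp add: vec_eq_iff matrix_matrix_mult_def mat_def)
qed

lemma mat_mult: "mat c ** mat d = mat (c * d :: 'a::comm_semiring_1)"
  unfolding mat_mult_left by (simp add: vec_eq_iff mat_def)

lemma cnjm_mat: "cnjm (mat c) = mat (cnj c)"
  by (simp add: vec_eq_iff mat_def)

lemma mat_add: "mat c + mat d = mat (c + d :: 'a::comm_semiring_1)"
  by (simp add: mat_def vec_eq_iff)

text \<open>Numerator and denominator of the Cayley path are of this form, so they commute. The
  homogeneous notation also covers \<open>t = 0\<close>, where the denominator is scalar and the
  numerator a multiple of \<open>S\<close>.\<close>

definition pencil :: "complex ^ 'n ^ 'n \<Rightarrow> complex \<Rightarrow> complex \<Rightarrow> complex ^ 'n ^ 'n" where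
  "pencil S x y = mat x ** S + mat y"

lemma pencil_mult: "pencil S x y ** pencil S x' y' = mat (x * x') ** (S ** S) + mat (x * y' + y * x') ** S + mat (y * y')"
proof -
  have "pencil S x y ** pencil S x' y' = (mat x ** S) ** (mat x' ** S) + (mat x ** S) ** mat y' + (mat y ** (mat x' ** S) + mat y ** mat y')"
    by (simp add: pencil_def matrix_add_mult matrix_add_ldistrib)
  moreover have "(mat x ** S) ** (mat x' ** S) = mat (x * x') ** (S ** S)"
    by (metis mat_commute mat_mult matrix_mul_assoc)
  moreover have "(mat x ** S) ** mat y' = mat (x * y') ** S"
    by (metis mat_commute mat_mult matrix_mul_assoc)
  ultimately show ?thesis
    by (simp add: mat_mult matrix_mul_assoc matrix_add_mult mat_add[symmetric] add_ac)
qed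

lemma pencil_commute: "pencil S x y ** pencil S x' y' = pencil S x' y' ** pencil S x y"
  by (simp add: pencil_mult mult.commute add.commute)

lemma pencil_transpose: "transpose S = S \<Longrightarrow> transpose (pencil S x y) = pencil S x y"
proof -
  assume S: "transpose S = S"
  have add: "transpose (A + B) = transpose A + transpose B" for A B :: "complex ^ 'n ^ 'n"
    by (simp add: transpose_def vec_eq_iff)
  show ?thesis
    by (simp add: pencil_def add matrix_transpose_mul S transpose_mat mat_commute[symmetric])
qed

text \<open>The point is that only \<open>|x|^2 + |y|^2\<close> and \<open>cnj x * y\<close> enter;
  these agree for the numerator and the denominator of the Cayley path.\<close>

lemma pencil_gram:
  assumes "S \<in> unitary_matrices"
  shows "conj_transpose (pencil S x y) ** pencil S x y =
    mat (cnj x * x + cnj y * y) + mat (cnj x * y) ** conj_transpose S + mat (cnj y * x) ** S"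
proof -
  have U: "conj_transpose S ** S = mat 1" using assms by (simp add: unitary_iff)
  have c1: "cnjm (transpose (mat x ** S)) = mat (cnj x) ** cnjm (transpose S)"
    by (simp only: matrix_transpose_mul cnjm_mult transpose_mat cnjm_mat mat_commute)
  have c2: "cnjm (transpose (A + B)) = cnjm (transpose A) + cnjm (transpose B)" for A B :: "complex ^ 'n ^ 'n"
    by (simp add: transpose_def vec_eq_iff)
  have ct: "conj_transpose (pencil S x y) = mat (cnj x) ** conj_transpose S + mat (cnj y)"
    by (simp only: conj_transpose_def pencil_def c1 c2 transpose_mat cnjm_mat)
  have 1: "(mat (cnj x) ** conj_transpose S) ** (mat x ** S) = mat (cnj x * x)"
  proof -
    have "(mat (cnj x) ** conj_transpose S) ** (mat x ** S) = mat (cnj x) ** ((conj_transpose S ** mat x) ** S)"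
      by (simp only: matrix_mul_assoc)
    also have "conj_transpose S ** mat x = mat x ** conj_transpose S" by (simp only: mat_commute)
    also have "mat (cnj x) ** ((mat x ** conj_transpose S) ** S) = mat (cnj x) ** (mat x ** (conj_transpose S ** S))"
      by (simp only: matrix_mul_assoc)
    finally show ?thesis by (simp add: U mat_mult)
  qed
  have 2: "(mat (cnj x) ** conj_transpose S) ** mat y = mat (cnj x * y) ** conj_transpose S"
    by (metis mat_commute mat_mult matrix_mul_assoc)
  have 3: "mat (cnj y) ** (mat x ** S) = mat (cnj y * x) ** S"
    by (simp only: mat_mult matrix_mul_assoc)
  have "conj_transpose (pencil S x y) ** pencil S x y =
      (mat (cnj x) ** conj_transpose S) ** (mat x ** S) + (mat (cnj x) ** conj_transpose S) ** mat y
      + (mat (cnj y) ** (mat x ** S) + mat (cnj y) ** mat y)"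
    unfolding ct unfolding pencil_def by (simp only: matrix_add_mult matrix_add_ldistrib add_ac)
  then show ?thesis unfolding 1 2 3 mat_mult mat_add[symmetric] by (simp only: add_ac)
qed

text \<open>A kernel vector satisfies \<open>x S v = - y v\<close>, and \<open>S\<close> preserves
  norms.\<close>

lemma pencil_det:
  assumes S: "S \<in> unitary_matrices" and xy: "norm x \<noteq> norm y"
  shows "det (pencil S x y) \<noteq> 0"
proof -
  have "v = 0" if v: "pencil S x y *v v = 0" for v
  proof -
    have m: "mat c *v u = c *s u" for c and u :: "complex ^ 'n"
      by (simp add: vec_eq_iff matrix_vector_mult_def mat_def if_distrib[of "\<lambda>x. x * _"] sum.delta' cong: if_cong)
    have n: "norm (c *s u) = norm c * norm u" for c and u :: "complex ^ 'n"
      by (simp add: norm_vec_def norm_mult L2_set_right_distrib)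
    have "x *s (S *v v) + y *s v = 0"
      using v by (simp add: pencil_def matrix_vector_mult_add_rdistrib m matrix_vector_mul_assoc[symmetric])
    then have "norm (x *s (S *v v)) = norm (y *s v)" by (metis add_eq_0_iff norm_minus_cancel)
    then show ?thesis using xy by (simp add: n norm_unitary[OF S])
  qed
  then have "invertible (pencil S x y)"
    by (metis invertible_left_inverse matrix_left_invertible_ker)
  then show ?thesis by (simp add: invertible_det_nz)
qed

text \<open>The inverse by Cramer's rule, a formula that is visibly continuous.\<close>

definition cramer_inverse :: "'a::field ^ 'n ^ 'n \<Rightarrow> 'a ^ 'n ^ 'n" where
  "cramer_inverse A = (\<chi> k l. det (\<chi> i j. if j = k then (if i = l then 1 else 0) else A $ i $ j) / det A)"

lemma cramer_inverse:
  assumes "det A \<noteq> 0" shows "A ** cramer_inverse A = mat 1" "cramer_inverse A ** A = mat 1"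
proof -
  have "A *v (\<chi> k. cramer_inverse A $ k $ l) = (\<chi> i. if i = l then 1 else 0)" for l
    using cramer[OF assms, of "\<chi> k. cramer_inverse A $ k $ l" "\<chi> i. if i = l then 1 else 0"]
    by (simp add: cramer_inverse_def cong: if_cong)
  then show "A ** cramer_inverse A = mat 1"
    by (simp add: vec_eq_iff matrix_vector_mult_def matrix_matrix_mult_def mat_def)
  then show "cramer_inverse A ** A = mat 1" by (simp add: matrix_left_right_inverse)
qed

lemma continuous_on_cramer_inverse [continuous_intros]:
  fixes f :: "'x::topological_space \<Rightarrow> 'a::real_normed_field ^ 'n ^ 'n"
  assumes "continuous_on S f" "\<And>x. x \<in> S \<Longrightarrow> det (f x) \<noteq> 0"
  shows "continuous_on S (\<lambda>x. cramer_inverse (f x))"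
proof -
  have "continuous_on S (\<lambda>x. if j = k then c else f x $ i $ j)" for i j k c
    by (cases "j = k") (auto intro!: continuous_intros assms(1))
  then show ?thesis unfolding cramer_inverse_def
    by (intro continuous_on_vec_lambda continuous_on_divide continuous_on_det assms) (use assms(2) in auto)
qed

text \<open>The condition says that \<open>- w\<close> is not an eigenvalue of
  \<open>S\<close>.\<close>

definition nonspectral :: "complex \<Rightarrow> (complex ^ 'n ^ 'n) set" where
  "nonspectral w = {S \<in> symmetric_unitary. det (pencil S 1 w) \<noteq> 0}"

text \<open>For \<open>w = 1\<close> this is \<open>(1 + i s H) (1 - i s H)\<^sup>-\<^sup>1\<close> with \<open>s = 1 - t\<close>, where \<open>S = (1 + i H) (1 - i H)\<^sup>-\<^sup>1\<close> is the Cayley transform of a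
real symmetric \<open>H\<close>.\<close>

definition cayley_path :: "complex \<Rightarrow> real \<Rightarrow> complex ^ 'n ^ 'n \<Rightarrow> complex ^ 'n ^ 'n" where
  "cayley_path w t S = (mat w ** pencil S (2 - t) (t * w)) ** cramer_inverse (pencil S t ((2 - t) * w))"

text \<open>For \<open>t < 1\<close> the moduli \<open>t\<close> and \<open>2 - t\<close> differ; at
  \<open>t = 1\<close> the pencil is \<open>S + w\<close>.\<close>

lemma cayley_path_det:
  assumes "norm w = 1" "t \<in> {0..1}" "S \<in> nonspectral w"
  shows "det (pencil S (of_real t) ((2 - of_real t) * w)) \<noteq> 0"
proof (cases "t = 1")
  case True
  then show ?thesis using assms(3) by (simp add: nonspectral_def)
next
  case False
  have "norm (2 - complex_of_real t) = 2 - t" using assms(2) norm_of_real[of "2 - t", where 'a = complex] by simp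
  then show ?thesis using assms False by (intro pencil_det) (auto simp: nonspectral_def symmetric_unitary_def norm_mult)
qed

text \<open>The value is \<open>w N\<close> times the inverse of \<open>D\<close>. Equal Gram
  matrices of \<open>N\<close> and \<open>D\<close> make it unitary; it is symmetric since
  \<open>N\<close> and \<open>D\<close> are symmetric and commute.\<close>

lemma cayley_path_symmetric_unitary:
  assumes w: "norm w = 1" and t: "t \<in> {0..1}" and S: "S \<in> nonspectral w"
  shows "cayley_path w t S \<in> symmetric_unitary"
proof -
  define D where "D = pencil S (of_real t) ((2 - of_real t) * w)"
  define N where "N = pencil S (2 - of_real t) (of_real t * w)"
  define J where "J = cramer_inverse D"
  have J: "D ** J = mat 1" "J ** D = mat 1" using cramer_inverse[OF cayley_path_det[OF assms]] by (simp_all add: D_def J_def)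
  have X: "cayley_path w t S = (mat w ** N) ** J" by (simp add: cayley_path_def D_def N_def J_def)
  have SS: "S \<in> unitary_matrices" "transpose S = S" using S by (auto simp: nonspectral_def symmetric_unitary_def)
  have ww: "cnj w * w = 1" using w complex_norm_square[of w] by (simp add: mult.commute)
  have gram: "conj_transpose N ** N = conj_transpose D ** D"
  proof -
    have s: "cnj (r * w) * (r * w) = cnj r * r" for r
    proof -
      have "cnj (r * w) * (r * w) = (cnj r * r) * (cnj w * w)" by (simp add: mult_ac)
      then show ?thesis by (simp add: ww)
    qed
    show ?thesis unfolding N_def D_def pencil_gram[OF SS(1)] s by (simp add: algebra_simps)
  qed
  have ct: "conj_transpose (A ** B) = conj_transpose B ** conj_transpose A" for A B :: "complex ^ 'n ^ 'n"
    by (simp add: conj_transpose_def matrix_transpose_mul cnjm_mult)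
  have ctw: "conj_transpose (mat w) ** mat w = (mat 1 :: complex ^ 'n ^ 'n)"
  proof -
    have "conj_transpose (mat w) = (mat (cnj w) :: complex ^ 'n ^ 'n)" by (simp add: conj_transpose_def transpose_def mat_def vec_eq_iff)
    then show ?thesis by (simp add: mat_mult ww)
  qed
  have "conj_transpose (cayley_path w t S) ** cayley_path w t S = conj_transpose J ** (conj_transpose N ** (conj_transpose (mat w) ** mat w) ** N) ** J"
    unfolding X by (simp add: ct matrix_mul_assoc)
  also have "\<dots> = conj_transpose J ** (conj_transpose D ** D) ** J" by (simp add: ctw gram)
  also have "\<dots> = conj_transpose (D ** J) ** (D ** J)" by (simp add: ct matrix_mul_assoc)
  also have "\<dots> = mat 1" by (simp add: J conj_transpose_def transpose_mat)
  finally have un: "cayley_path w t S \<in> unitary_matrices" by (simp add: unitary_iff)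
  have XD: "cayley_path w t S ** D = mat w ** N" unfolding X by (simp add: matrix_mul_assoc[symmetric] J)
  have DX: "D ** cayley_path w t S = mat w ** N"
  proof -
    have "D ** cayley_path w t S = (D ** mat w) ** N ** J" by (simp add: X matrix_mul_assoc)
    also have "D ** mat w = mat w ** D" by (simp only: mat_commute)
    also have "(mat w ** D) ** N ** J = mat w ** (D ** N) ** J" by (simp only: matrix_mul_assoc)
    also have "D ** N = N ** D" unfolding D_def N_def by (rule pencil_commute)
    also have "mat w ** (N ** D) ** J = mat w ** N ** (D ** J)" by (simp add: matrix_mul_assoc)
    finally show ?thesis by (simp add: J)
  qed
  have DN: "transpose D = D" "transpose N = N" unfolding D_def N_def by (rule pencil_transpose[OF SS(2)])+
  have "transpose (cayley_path w t S) ** D = transpose (D ** cayley_path w t S)" by (simp add: matrix_transpose_mul DN)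
  also have "\<dots> = cayley_path w t S ** D" by (simp add: DX XD matrix_transpose_mul DN transpose_mat mat_commute)
  finally have "transpose (cayley_path w t S) ** (D ** J) = cayley_path w t S ** (D ** J)" by (simp add: matrix_mul_assoc)
  then show ?thesis using un by (simp add: J symmetric_unitary_def)
qed

lemma pencil_0: "pencil S 0 y = mat y" and pencil_x0: "pencil S x 0 = mat x ** S"
  by (simp_all add: pencil_def mat_def vec_eq_iff matrix_matrix_mult_def)

lemma cayley_path_0:
  fixes S :: "complex ^ 'n ^ 'n"
  assumes "norm w = 1" "S \<in> nonspectral w" shows "cayley_path w 0 S = S"
proof -
  have J: "mat (2 * w) ** cramer_inverse (mat (2 * w)) = (mat 1 :: complex ^ 'n ^ 'n)"
    using cramer_inverse(1)[OF cayley_path_det[of w 0 S]] assms by (simp add: pencil_0)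
  have "cayley_path w 0 S = mat w ** (mat 2 ** S) ** cramer_inverse (mat (2 * w))" by (simp add: cayley_path_def pencil_0 pencil_x0)
  also have "\<dots> = (S ** mat (2 * w)) ** cramer_inverse (mat (2 * w))"
  proof -
    have "mat w ** (mat 2 ** S) = mat (w * 2) ** S" by (simp only: matrix_mul_assoc mat_mult)
    also have "\<dots> = S ** mat (2 * w)" by (simp only: mat_commute mult.commute)
    finally show ?thesis by simp
  qed
  also have "\<dots> = S" by (simp add: matrix_mul_assoc[symmetric] J)
  finally show ?thesis .
qed

lemma cayley_path_1:
  assumes "norm w = 1" "S \<in> nonspectral w" shows "cayley_path w 1 S = mat w"
  using cramer_inverse(1)[OF cayley_path_det[of w 1 S]] assms by (simp add: cayley_path_def matrix_mul_assoc[symmetric])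

lemma continuous_on_pencil [continuous_intros]:
  fixes S :: "'x::topological_space \<Rightarrow> complex ^ 'n ^ 'n"
  assumes "continuous_on A S" "continuous_on A x" "continuous_on A y"
  shows "continuous_on A (\<lambda>p. pencil (S p) (x p) (y p))"
proof -
  have m: "continuous_on A (\<lambda>p. mat (z p) :: complex ^ 'n ^ 'n)" if "continuous_on A z" for z
  proof -
    have "continuous_on A (\<lambda>p. if i = j then z p else 0)" for i j :: 'n
      by (cases "i = j") (auto intro: that)
    then show ?thesis unfolding mat_def by (intro continuous_on_vec_lambda) auto
  qed
  then show ?thesis unfolding pencil_def by (intro continuous_on_add continuous_on_matrix_mult m assms)
qed

lemma categorical_nonspectral:
  assumes w: "norm w = 1"
  shows "categorical (top_of_set symmetric_unitary) (nonspectral w :: (complex ^ 'n ^ 'n) set)"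
proof -
  let ?U = "nonspectral w :: (complex ^ 'n ^ 'n) set"
  have "openin (top_of_set symmetric_unitary) (symmetric_unitary \<inter> (\<lambda>S :: complex ^ 'n ^ 'n. det (pencil S 1 w)) -` (- {0}))"
    by (rule continuous_openin_preimage_gen) (intro continuous_intros open_Compl closed_singleton)+
  moreover have "symmetric_unitary \<inter> (\<lambda>S :: complex ^ 'n ^ 'n. det (pencil S 1 w)) -` (- {0}) = ?U" by (auto simp: nonspectral_def)
  ultimately have op: "openin (top_of_set symmetric_unitary) ?U" by simp
  have sub: "?U \<subseteq> symmetric_unitary" by (auto simp: nonspectral_def)
  have top: "subtopology (top_of_set symmetric_unitary) ?U = top_of_set ?U"
    using sub by (simp add: subtopology_subtopology Int_absorb1)
  have cont: "continuous_on ({0..1} \<times> ?U) (\<lambda>p. cayley_path w (fst p) (snd p))"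
    unfolding cayley_path_def
  proof (intro continuous_intros)
    fix p :: "real \<times> (complex ^ 'n ^ 'n)" assume "p \<in> {0..1} \<times> ?U"
    then show "det (pencil (snd p) (of_real (fst p)) ((2 - of_real (fst p)) * w)) \<noteq> 0"
      by (intro cayley_path_det[OF w]) auto
  qed
  \<comment> \<open>The equations at times 0 and 1 are demanded for all \<open>x\<close> of the
    type, so \<open>h\<close> needs suitable values outside \<open>?U\<close> as well.\<close>
  define h where "h = (\<lambda>p. if snd p \<in> ?U then cayley_path w (fst p) (snd p) else if fst p = 1 then mat w else snd p)"
  have "homotopic_with (\<lambda>h. True) (top_of_set ?U) (top_of_set symmetric_unitary) (\<lambda>x. x) (\<lambda>x. mat w)"
    unfolding homotopic_with_def
  proof (intro exI conjI allI)
    have "continuous_on ({0..1} \<times> ?U) h"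
      using cont by (rule continuous_on_eq) (auto simp: h_def)
    moreover have "h p \<in> symmetric_unitary" if "p \<in> {0..1} \<times> ?U" for p
      using that cayley_path_symmetric_unitary[OF w, of "fst p" "snd p"] by (auto simp: h_def)
    ultimately show "continuous_map (prod_topology (top_of_set {0..1}) (top_of_set ?U)) (top_of_set symmetric_unitary) h"
      unfolding prod_topology_subtopology_eu continuous_map_in_subtopology by (auto simp del: continuous_on_eq_continuous_at)
    show "h (0, x) = x" "h (1, x) = mat w" for x
      using cayley_path_0[OF w] cayley_path_1[OF w] by (auto simp: h_def)
  qed auto
  moreover have "mat w \<in> (symmetric_unitary :: (complex ^ 'n ^ 'n) set)"
  proof -
    have "conj_transpose (mat w) = (mat (cnj w) :: complex ^ 'n ^ 'n)" by (simp add: conj_transpose_def transpose_def mat_def vec_eq_iff)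
    moreover have "cnj w * w = 1" using w complex_norm_square[of w] by (simp add: mult.commute)
    ultimately show ?thesis by (simp add: symmetric_unitary_def unitary_iff mat_mult transpose_mat)
  qed
  ultimately show ?thesis unfolding categorical_def top topspace_euclidean_subtopology
    using op by (intro conjI bexI[of _ "mat w"])
qed

lemma card_spectrum_le:
  fixes S :: "complex ^ 'n ^ 'n"
  assumes "S \<in> symmetric_unitary"
  shows "finite {w. det (pencil S 1 w) = 0}" "card {w. det (pencil S 1 w) = 0} \<le> CARD('n)"
proof -
  define P :: "complex poly ^ 'n ^ 'n" where "P = (\<chi> i j. [:S $ i $ j, if i = j then 1 else 0:])"
  have chain_sum: "poly (det P) w = det (pencil S 1 w)" for w
  proof -
    have "pencil S 1 w = S + mat w" by (simp add: pencil_def)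
    moreover have "poly (P $ i $ j) w = (S + mat w) $ i $ j" for i j by (simp add: P_def mat_def)
    ultimately show ?thesis by (simp only: det_def poly_sum poly_mult poly_prod poly_of_int)
  qed
  \<comment> \<open>The number 2 serves because its modulus is not 1.\<close>
  have nz: "det P \<noteq> 0"
  proof
    assume "det P = 0"
    then have "det (pencil S 1 2) = 0" using chain_sum[of 2] by simp
    moreover have "det (pencil S 1 2) \<noteq> 0" using assms by (intro pencil_det) (auto simp: symmetric_unitary_def)
    ultimately show False by simp
  qed
  have "degree (det P) \<le> CARD('n)"
    unfolding det_def
  proof (rule degree_sum_le)
    fix p assume "p \<in> {p. p permutes (UNIV :: 'n set)}"
    have "degree (of_int (sign p) * (\<Prod>i\<in>UNIV. P $ i $ p i)) \<le> degree (\<Prod>i\<in>UNIV. P $ i $ p i)"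
      by (rule order_trans[OF degree_mult_le]) simp
    also have "\<dots> \<le> sum (degree \<circ> (\<lambda>i. P $ i $ p i)) UNIV" by (rule degree_prod_sum_le) simp
    also have "\<dots> \<le> (\<Sum>i\<in>(UNIV :: 'n set). 1)" by (rule sum_mono) (simp add: P_def)
    finally show "degree (of_int (sign p) * (\<Prod>i\<in>UNIV. P $ i $ p i)) \<le> CARD('n)" by simp
  qed (simp add: finite_permutations)
  moreover have "{w. det (pencil S 1 w) = 0} = {w. poly (det P) w = 0}" by (simp add: chain_sum)
  ultimately show "finite {w. det (pencil S 1 w) = 0}" "card {w. det (pencil S 1 w) = 0} \<le> CARD('n)"
    using poly_roots_finite[OF nz] card_poly_roots_bound[OF nz] by auto
qed

lemma symmetric_unitary_cover:
  "\<exists>\<U>. finite \<U> \<and> (\<forall>U\<in>\<U>. categorical (top_of_set symmetric_unitary) U) \<and> \<Union>\<U> = (symmetric_unitary :: (complex ^ 'n ^ 'n) set) \<and> card \<U> \<le> Suc CARD('n)"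
proof -
  \<comment> \<open>Any \<open>n + 1\<close> distinct numbers of modulus 1 would do; roots of unity
    come with a known count.\<close>
  define Z where "Z = {z::complex. z ^ Suc CARD('n) = 1}"
  have cZ: "card Z = Suc CARD('n)" unfolding Z_def by (rule card_roots_unity_eq) simp
  then have fZ: "finite Z" by (metis card.infinite nat.distinct(1))
  have nZ: "norm z = 1" if "z \<in> Z" for z
  proof -
    have "norm (z ^ Suc CARD('n)) = 1" using that by (simp only: Z_def mem_Collect_eq norm_one)
    then have "norm z ^ Suc CARD('n) = 1 ^ Suc CARD('n)" by (simp only: norm_power power_one)
    then show ?thesis by (rule power_eq_imp_eq_base) simp_all
  qed
  have "(\<Union>w\<in>Z. nonspectral w) = (symmetric_unitary :: (complex ^ 'n ^ 'n) set)"
  proof (intro equalityI subsetI)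
    fix S :: "complex ^ 'n ^ 'n" assume S: "S \<in> symmetric_unitary"
    have "\<not> Z \<subseteq> {w. det (pencil S 1 w) = 0}"
      using card_mono[OF card_spectrum_le(1)[OF S], of Z] card_spectrum_le(2)[OF S] cZ by auto
    then show "S \<in> (\<Union>w\<in>Z. nonspectral w)" using S by (auto simp: nonspectral_def)
  qed (auto simp: nonspectral_def)
  moreover have "\<forall>U\<in>nonspectral ` Z. categorical (top_of_set symmetric_unitary) (U :: (complex ^ 'n ^ 'n) set)"
    using nZ categorical_nonspectral by blast
  moreover have "card ((nonspectral :: complex \<Rightarrow> (complex ^ 'n ^ 'n) set) ` Z) \<le> Suc CARD('n)"
    using card_image_le[OF fZ] cZ by metis
  ultimately show ?thesis using fZ by (intro exI[of _ "nonspectral ` Z"] conjI finite_imageI)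
qed

section \<open>The homogeneous space\<close>

lemma categorical_homeomorphic:
  assumes fg: "homeomorphic_maps X Y f g" and U: "categorical X U"
  shows "categorical Y (f ` U)"
proof -
  have f: "homeomorphic_map X Y f" and pair_coeff: "continuous_map X Y f" and cg: "continuous_map Y X g"
    and gf: "\<And>x. x \<in> topspace X \<Longrightarrow> g (f x) = x" and fgy: "\<And>y. y \<in> topspace Y \<Longrightarrow> f (g y) = y"
    using fg by (auto simp: homeomorphic_maps_def homeomorphic_map_maps)
  obtain c where c: "c \<in> topspace X" "homotopic_with (\<lambda>h. True) (subtopology X U) X (\<lambda>x. x) (\<lambda>x. c)"
    and op: "openin X U" using U by (auto simp: categorical_def)
  have UX: "U \<subseteq> topspace X" using op openin_subset by blast
  have "openin Y (f ` U)" using homeomorphic_imp_open_map[OF f] op by (simp add: open_map_def)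
  moreover have "f c \<in> topspace Y" using pair_coeff c(1) by (auto simp: continuous_map_def)
  moreover have "homotopic_with (\<lambda>h. True) (subtopology Y (f ` U)) Y (\<lambda>x. x) (\<lambda>x. f c)"
  proof -
    have g: "continuous_map (subtopology Y (f ` U)) (subtopology X U) g"
      using cg gf UX by (auto simp: continuous_map_in_subtopology continuous_map_from_subtopology)
    have "homotopic_with (\<lambda>h. True) (subtopology X U) Y (f \<circ> (\<lambda>x. x)) (f \<circ> (\<lambda>x. c))"
      by (rule homotopic_with_compose_continuous_map_left[OF c(2) pair_coeff]) simp
    then have "homotopic_with (\<lambda>h. True) (subtopology Y (f ` U)) Y (f \<circ> (\<lambda>x. x) \<circ> g) (f \<circ> (\<lambda>x. c) \<circ> g)"
      by (rule homotopic_with_compose_continuous_map_right[OF _ g]) simp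
    then show ?thesis by (rule homotopic_with_eq) (auto simp: fgy)
  qed
  ultimately show ?thesis by (auto simp: categorical_def)
qed

lemma LS_cat_homeomorphic_le:
  assumes "homeomorphic_maps X Y f g"
  shows "LS_cat Y \<le> LS_cat X"
proof -
  have "(INF \<U> \<in> {\<U>. finite \<U> \<and> (\<forall>U\<in>\<U>. categorical Y U) \<and> \<Union>\<U> = topspace Y}. enat (card \<U>))
    \<le> (INF \<U> \<in> {\<U>. finite \<U> \<and> (\<forall>U\<in>\<U>. categorical X U) \<and> \<Union>\<U> = topspace X}. enat (card \<U>))"
  proof (rule INF_mono)
    fix \<U> assume \<U>: "\<U> \<in> {\<U>. finite \<U> \<and> (\<forall>U\<in>\<U>. categorical X U) \<and> \<Union>\<U> = topspace X}"
    have "f ` topspace X = topspace Y"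
      using assms homeomorphic_imp_surjective_map homeomorphic_maps_map by blast
    moreover have "\<Union>((`) f ` \<U>) = f ` \<Union>\<U>" by blast
    ultimately show "\<exists>\<V>\<in>{\<U>. finite \<U> \<and> (\<forall>U\<in>\<U>. categorical Y U) \<and> \<Union>\<U> = topspace Y}. enat (card \<V>) \<le> enat (card \<U>)"
      using \<U> categorical_homeomorphic[OF assms] by (intro bexI[of _ "(`) f ` \<U>"]) (auto simp: card_image_le)
  qed
  then show ?thesis unfolding LS_cat_def
    by (cases "INF \<U> \<in> {\<U>. finite \<U> \<and> (\<forall>U\<in>\<U>. categorical Y U) \<and> \<Union>\<U> = topspace Y}. enat (card \<U>)";
        cases "INF \<U> \<in> {\<U>. finite \<U> \<and> (\<forall>U\<in>\<U>. categorical X U) \<and> \<Union>\<U> = topspace X}. enat (card \<U>)")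
      (auto simp: one_enat_def)
qed

lemma LS_cat_symmetric_unitary: "LS_cat (top_of_set (symmetric_unitary :: (complex ^ 'n ^ 'n) set)) = enat CARD('n)"
proof -
  let ?C = "{\<U>. finite \<U> \<and> (\<forall>U\<in>\<U>. categorical (top_of_set symmetric_unitary) U) \<and> \<Union>\<U> = (symmetric_unitary :: (complex ^ 'n ^ 'n) set)}"
  have "(INF \<U>\<in>?C. enat (card \<U>)) = enat (Suc CARD('n))"
  proof (rule antisym)
    obtain \<U> where "\<U> \<in> ?C" "card \<U> \<le> Suc CARD('n)" using symmetric_unitary_cover by blast
    then show "(INF \<U>\<in>?C. enat (card \<U>)) \<le> enat (Suc CARD('n))" by (intro INF_lower2[of \<U>]) auto
    show "enat (Suc CARD('n)) \<le> (INF \<U>\<in>?C. enat (card \<U>))"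
      by (rule INF_greatest) (use card_categorical_cover in \<open>auto simp: Suc_le_eq\<close>)
  qed
  then show ?thesis by (simp add: LS_cat_def one_enat_def)
qed

lemma real_orthogonal_mult:
  assumes "P \<in> real_orthogonal_matrices" "Q \<in> real_orthogonal_matrices"
  shows "P ** Q \<in> (real_orthogonal_matrices :: (complex ^ 'n ^ 'n) set)"
proof -
  have "map_matrix complex_of_real R ** map_matrix complex_of_real R' = map_matrix complex_of_real (R ** R')" for R R' :: "real ^ 'n ^ 'n"
    by (simp add: vec_eq_iff matrix_matrix_mult_def)
  then show ?thesis using assms orthogonal_matrix_mul unfolding real_orthogonal_matrices_def by force
qed

lemma real_orthogonal_transpose:
  assumes "Q \<in> (real_orthogonal_matrices :: (complex ^ 'n ^ 'n) set)"
  shows "Q ** transpose Q = mat 1"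
proof -
  have "cnjm Q = Q" using assms by (auto simp: real_orthogonal_matrices_def vec_eq_iff)
  then show ?thesis
    using unitary_conj(4)[of Q] assms real_orthogonal_subset_unitary by auto
qed

lemma one_real_orthogonal: "mat 1 \<in> real_orthogonal_matrices"
proof -
  have "mat 1 = map_matrix complex_of_real (mat 1)" by (simp add: vec_eq_iff mat_def)
  then show ?thesis by (auto simp: real_orthogonal_matrices_def orthogonal_matrix)
qed

lemma coset_gram: "B \<in> orthogonal_coset A \<Longrightarrow> B ** transpose B = A ** transpose A"
proof -
  assume "B \<in> orthogonal_coset A"
  then obtain Q where Q: "Q \<in> real_orthogonal_matrices" "B = A ** Q" by (auto simp: orthogonal_coset_def)
  have "B ** transpose B = A ** (Q ** transpose Q) ** transpose A"
    by (simp add: Q matrix_transpose_mul matrix_mul_assoc)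
  then show ?thesis by (simp add: real_orthogonal_transpose[OF Q(1)])
qed

text \<open>The quotient \<open>Q\<close> of the two matrices is unitary and satisfies
  \<open>Q ** transpose Q = mat 1\<close>, so its conjugate transpose equals its transpose: it is
  real and orthogonal.\<close>

lemma gram_coset:
  assumes A: "A \<in> unitary_matrices" and B: "B \<in> unitary_matrices" and eq: "A ** transpose A = B ** transpose B"
  shows "orthogonal_coset B \<subseteq> orthogonal_coset A"
proof -
  define Q where "Q = transpose (cnjm A) ** B"
  have BQ: "B = A ** Q" by (simp add: Q_def matrix_mul_assoc unitary_conj[OF A])
  have "Q ** transpose Q = transpose (cnjm A) ** (B ** transpose B) ** cnjm A"
    by (simp add: Q_def matrix_transpose_mul matrix_mul_assoc)
  also have "\<dots> = (transpose (cnjm A) ** A) ** (transpose A ** cnjm A)"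
    by (simp add: eq[symmetric] matrix_mul_assoc)
  finally have QT: "Q ** transpose Q = mat 1" by (simp add: unitary_conj[OF A])
  then have TQ: "transpose Q ** Q = mat 1" by (simp add: matrix_left_right_inverse)
  have "transpose (cnjm Q) ** Q = transpose (cnjm B) ** (A ** transpose (cnjm A)) ** B"
    by (simp add: Q_def cnjm_mult cnjm_transpose matrix_transpose_mul matrix_mul_assoc)
  then have CQ: "transpose (cnjm Q) ** Q = mat 1" by (simp add: unitary_conj[OF A] unitary_conj[OF B])
  have "transpose (cnjm Q) = transpose (cnjm Q) ** (Q ** transpose Q)" by (simp add: QT)
  also have "\<dots> = transpose Q" by (simp add: matrix_mul_assoc CQ)
  finally have "cnjm Q = Q" by (metis transpose_transpose)
  then have re: "Q = map_matrix complex_of_real (map_matrix Re Q)"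
    by (simp add: vec_eq_iff complex_eq_iff)
  have "transpose (map_matrix Re Q) ** map_matrix Re Q = mat 1"
  proof -
    have "map_matrix complex_of_real (transpose (map_matrix Re Q) ** map_matrix Re Q)
       = transpose (map_matrix complex_of_real (map_matrix Re Q)) ** map_matrix complex_of_real (map_matrix Re Q)"
      by (simp add: vec_eq_iff matrix_matrix_mult_def transpose_def)
    also have "\<dots> = mat 1" by (simp only: re[symmetric] TQ)
    finally have "complex_of_real ((transpose (map_matrix Re Q) ** map_matrix Re Q) $ i $ j) = (if i = j then 1 else 0)" for i j
      by (simp add: vec_eq_iff mat_def)
    then have "(transpose (map_matrix Re Q) ** map_matrix Re Q) $ i $ j = (if i = j then 1 else 0)" for i j
      by (metis of_real_0 of_real_1 of_real_eq_iff)
    then show ?thesis by (simp add: vec_eq_iff mat_def)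
  qed
  then have Q: "Q \<in> real_orthogonal_matrices"
    using re unfolding real_orthogonal_matrices_def orthogonal_matrix by blast
  show ?thesis
    using real_orthogonal_mult[OF Q] by (auto simp: orthogonal_coset_def BQ matrix_mul_assoc[symmetric])
qed

text \<open>A continuous bijection from a compact space to a Hausdorff space; surjectivity is the
  Takagi factorisation.\<close>

lemma unitary_mod_orthogonal_homeomorphic:
  "(unitary_mod_orthogonal :: (complex ^ 'n ^ 'n) set topology) homeomorphic_space top_of_set (symmetric_unitary :: (complex ^ 'n ^ 'n) set)"
proof -
  let ?X = "unitary_mod_orthogonal :: (complex ^ 'n ^ 'n) set topology"
  let ?V = "unitary_matrices :: (complex ^ 'n ^ 'n) set"
  \<comment> \<open>An arbitrary representative of the coset is used; by \<open>coset_gram\<close>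
    the choice does not matter.\<close>
  define \<psi> :: "(complex ^ 'n ^ 'n) set \<Rightarrow> complex ^ 'n ^ 'n"
    where "\<psi> Z = (SOME B. B \<in> Z) ** transpose (SOME B. B \<in> Z)" for Z
  have \<psi>: "\<psi> (orthogonal_coset A) = A ** transpose A" for A
  proof -
    have "A ** mat 1 \<in> orthogonal_coset A"
      unfolding orthogonal_coset_def using one_real_orthogonal by blast
    then have "(SOME B. B \<in> orthogonal_coset A) \<in> orthogonal_coset A" by (rule someI)
    then show ?thesis unfolding \<psi>_def by (rule coset_gram)
  qed
  have q: "quotient_map (top_of_set ?V) ?X orthogonal_coset"
    unfolding unitary_mod_orthogonal_def by (rule quotient_map_quotient_topology)
  have tX: "topspace ?X = orthogonal_coset ` ?V" by (simp add: unitary_mod_orthogonal_def)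
  have "homeomorphic_map ?X (top_of_set symmetric_unitary) \<psi>"
  proof (rule continuous_imp_homeomorphic_map)
    have "compactin (top_of_set ?V) ?V" using compact_unitary by (simp add: compactin_subtopology)
    then have "compactin ?X (orthogonal_coset ` ?V)"
      by (rule image_compactin) (rule quotient_imp_continuous_map[OF q])
    then show "compact_space ?X" by (simp add: compact_space_def tX)
    show "Hausdorff_space (top_of_set (symmetric_unitary :: (complex ^ 'n ^ 'n) set))"
      by (simp add: Hausdorff_space_subtopology)
    have "continuous_map (top_of_set ?V) (top_of_set symmetric_unitary) (\<psi> \<circ> orthogonal_coset)"
      by (auto simp: \<psi> gram_symmetric_unitary comp_def intro!: continuous_intros)
    then show "continuous_map ?X (top_of_set symmetric_unitary) \<psi>" by (rule continuous_compose_quotient_map[OF q])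
    have "symmetric_unitary \<subseteq> (\<lambda>A. A ** transpose A) ` ?V"
    proof
      fix S :: "complex ^ 'n ^ 'n" assume "S \<in> symmetric_unitary"
      then obtain A where "A \<in> ?V" "A ** transpose A = S" by (rule takagi_factorization)
      then show "S \<in> (\<lambda>A. A ** transpose A) ` ?V" by blast
    qed
    then show "\<psi> ` topspace ?X = topspace (top_of_set symmetric_unitary)"
      by (auto simp: tX image_image \<psi> gram_symmetric_unitary)
    show "inj_on \<psi> (topspace ?X)"
      unfolding tX
    proof (rule inj_onI, elim imageE, simp only: \<psi>)
      fix A B assume "A \<in> ?V" "B \<in> ?V" "A ** transpose A = B ** transpose B"
      then show "orthogonal_coset A = orthogonal_coset B" by (metis gram_coset subset_antisym)
    qed
  qed
  then show ?thesis using homeomorphic_map_imp_homeomorphic_space by blast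
qed

theorem theorem6:
  shows "LS_cat (unitary_mod_orthogonal :: (complex ^ 'n ^ 'n) set topology) = enat CARD('n)"
proof -
  obtain f g where fg: "homeomorphic_maps (unitary_mod_orthogonal :: (complex ^ 'n ^ 'n) set topology) (top_of_set (symmetric_unitary :: (complex ^ 'n ^ 'n) set)) f g"
    using unitary_mod_orthogonal_homeomorphic unfolding homeomorphic_space_def by blast
  show ?thesis
    using antisym[OF LS_cat_homeomorphic_le[OF fg[unfolded homeomorphic_maps_sym[of _ _ f]]] LS_cat_homeomorphic_le[OF fg]]
    by (simp only: LS_cat_symmetric_unitary)
qed

end
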